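(* Let $n\ge 2$ and let $Q(x,y)=0$ be a hyperbola in the plane. A real sequence $\beta\equiv\beta^{(2n)}=\{\beta_{ij}\}_{i,j\ge 0,\,i+j\le 2n}$ with $\beta_{00}>0$ has a representing measure supported in $Q(x,y)=0$ (a $Q$-representing measure) if and only if $\mathcal{M}(n)$ is positive semi-definite, recursively generated, $Q(X,Y)=0$ in $\mathcal{C}_{\mathcal{M}(n)}$, and $\operatorname{rank}\mathcal{M}(n)\le\operatorname{card}\mathcal{V}(\mathcal{M}(n))$. In this case, $\operatorname{rank}\mathcal{M}(n)\le 2n+1$; if $\operatorname{rank}\mathcal{M}(n)\le 2n$, then there is a $\operatorname{rank}\mathcal{M}(n)$-atomic $Q$-representing measure, while if $\operatorname{rank}\mathcal{M}(n)=2n+1$, there is a $Q$-representing measure $\mu$ for which $2n+1\le\operatorname{card}\operatorname{supp}\mu\le 2n+2$.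
   Context: A hyperbola $Q(x,y)=0$ is given by a real polynomial $Q$ of degree 2 whose quadratic part is indefinite and nondegenerate, i.e. $Q=Ax^2+Bxy+Cy^2+Dx+Ey+F$ with $B^2-4AC>0$; equivalently an invertible affine change of variables carries $Q$ to a nonzero scalar multiple of $yx-1$ (nondegenerate case) or $yx$ (degenerate case: two intersecting lines). Both cases are included. A representing measure for $\beta=\beta^{(2n)}$ is a positive Borel measure $\mu$ on $\mathbb{R}^2$ with convergent moments such that $\beta_{ij}=\int y^ix^j\,d\mu$ for $i,j\ge0$, $i+j\le 2n$. It is a $Q$-representing measure if moreover $\operatorname{supp}\mu\subseteq\mathcal{Z}(Q):=\{(x,y)\in\mathbb{R}^2:Q(x,y)=0\}$. A measure is $r$-atomic if it is a positive combination of $r$ distinct point masses. $\mathbb{R}_n[x,y]$ is the space of real polynomials of degree at most $n$. The moment matrix $\mathcal{M}(n)\equiv\mathcal{M}(n)(\beta)$ is the real symmetric matrix of size $(n+1)(n+2)/2$ with rows and columns indexed by $1,X,Y,X^2,YX,Y^2,\dots,X^n,YX^{n-1},\dots,Y^n$, whose entry in row $Y^iX^j$, column $Y^kX^\ell$ is $\beta_{i+k,j+\ell}$. $\mathcal{C}_{\mathcal{M}(n)}$ is its column space. For $p(x,y)=\sum a_{ij}y^ix^j\in\mathbb{R}_n[x,y]$, $p(X,Y):=\sum a_{ij}Y^iX^j\in\mathcal{C}_{\mathcal{M}(n)}$, where $Y^iX^j$ denotes the corresponding column. $\mathcal{M}(n)$ is recursively generated if whenever $p,q,pq\in\mathbb{R}_n[x,y]$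 and $p(X,Y)=0$, then $(pq)(X,Y)=0$. The variety is $\mathcal{V}(\mathcal{M}(n)):=\bigcap\{\mathcal{Z}(p):p\in\mathbb{R}_n[x,y],\ p(X,Y)=0\}$, where $\mathcal{Z}(p)$ is the real zero set of $p$. *)

theory Defs
  imports
    "HOL-Analysis.Analysis"
    "HOL-Computational_Algebra.Polynomial"
    "Jordan_Normal_Form.DL_Rank"
begin

text \<open>
  A real polynomial in \<open>x\<close> and \<open>y\<close> is an element of \<open>\<real>[x][y]\<close>, i.e. of type
  \<open>real poly poly\<close> with \<open>y\<close> as the outer variable.  Index pairs \<open>(i, j)\<close> always stand for
  the monomial \<open>y\<^sup>i x\<^sup>j\<close>, so the exponent of \<open>y\<close> comes first, while points of the plane are
  written \<open>(x, y)\<close>.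
\<close>

type_synonym bipoly = "real poly poly"

definition cf :: "bipoly \<Rightarrow> nat \<Rightarrow> nat \<Rightarrow> real" where
  "cf p i j = Polynomial.coeff (Polynomial.coeff p i) j"

definition bieval :: "bipoly \<Rightarrow> real \<Rightarrow> real \<Rightarrow> real" where
  "bieval p x y = poly (poly p [:y:]) x"

lemma bieval_monom:
  "bieval (Polynomial.monom (Polynomial.monom a j) i) x y = a * y ^ i * x ^ j"
  by (simp add: bieval_def poly_monom poly_const_pow)

definition bipolys :: "nat \<Rightarrow> bipoly set" where
  "bipolys n = {p. \<forall>i j. cf p i j \<noteq> 0 \<longrightarrow> i + j \<le> n}"

definition zero_set :: "bipoly \<Rightarrow> (real \<times> real) set" where
  "zero_set p = {(x, y). bieval p x y = 0}"

text \<open>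
  The discriminant condition on \<open>Ax\<^sup>2 + Bxy + Cy\<^sup>2 + Dx + Ey + F\<close> forces the total degree
  to be exactly 2; it includes the case of two intersecting lines.
\<close>

definition hyperbola :: "bipoly \<Rightarrow> bool" where
  "hyperbola Q \<longleftrightarrow> Q \<in> bipolys 2 \<and> (cf Q 1 1)\<^sup>2 - 4 * cf Q 0 2 * cf Q 2 0 > 0"

text \<open>
  Since moments of order 0 are included, a representing measure is automatically finite.
\<close>

definition representing_measure ::
  "nat \<Rightarrow> (nat \<Rightarrow> nat \<Rightarrow> real) \<Rightarrow> (real \<times> real) measure \<Rightarrow> bool" where
  "representing_measure n \<beta> \<mu> \<longleftrightarrow>
     sets \<mu> = sets borel \<and>
     (\<forall>i j. i + j \<le> 2 * n \<longrightarrow>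
        integrable \<mu> (\<lambda>(x, y). y ^ i * x ^ j) \<and>
        \<beta> i j = (\<integral>(x, y). y ^ i * x ^ j \<partial>\<mu>))"

definition measure_supp :: "'a::topological_space measure \<Rightarrow> 'a set" where
  "measure_supp \<mu> = - \<Union>{U. open U \<and> emeasure \<mu> U = 0}"

definition Q_representing_measure ::
  "nat \<Rightarrow> (nat \<Rightarrow> nat \<Rightarrow> real) \<Rightarrow> bipoly \<Rightarrow> (real \<times> real) measure \<Rightarrow> bool" where
  "Q_representing_measure n \<beta> Q \<mu> \<longleftrightarrow>
     representing_measure n \<beta> \<mu> \<and> measure_supp \<mu> \<subseteq> zero_set Q"

definition atomic :: "nat \<Rightarrow> (real \<times> real) measure \<Rightarrow> bool" where
  "atomic r \<mu> \<longleftrightarrow>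
     sets \<mu> = sets borel \<and>
     (\<exists>S w. finite S \<and> card S = r \<and> (\<forall>z\<in>S. w z > (0::real)) \<and>
        (\<forall>A\<in>sets borel. emeasure \<mu> A = (\<Sum>z\<in>S. ennreal (w z) * indicator A z)))"

text \<open>
  The exponent pairs of \<open>1, X, Y, X\<^sup>2, YX, Y\<^sup>2, \<dots>, X\<^sup>n, YX\<^sup>n\<^sup>-\<^sup>1, \<dots>, Y\<^sup>n\<close>, in this order.
\<close>

definition mono_idx :: "nat \<Rightarrow> (nat \<times> nat) list" where
  "mono_idx n = concat (map (\<lambda>d. map (\<lambda>i. (i, d - i)) [0..<Suc d]) [0..<Suc n])"

abbreviation mdim :: "nat \<Rightarrow> nat" where
  "mdim n \<equiv> length (mono_idx n)"

lemma mdim_eq: "mdim n = (n + 1) * (n + 2) div 2"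
proof (induction n)
  case 0
  show ?case by (simp add: mono_idx_def)
next
  case (Suc n)
  have "mdim (Suc n) = mdim n + (n + 2)"
    by (simp add: mono_idx_def)
  with Suc show ?case by simp
qed

lemma set_mono_idx: "set (mono_idx n) = {(i, j). i + j \<le> n}"
proof -
  have "(i, j) \<in> set (mono_idx n) \<longleftrightarrow> i + j \<le> n" for i j
    by (auto simp: mono_idx_def image_iff less_Suc_eq_le simp del: upt_Suc
        intro!: bexI[of _ "i + j"])
  then show ?thesis by auto
qed

lemma mono_idx_2: "mono_idx 2 = [(0,0), (0,1), (1,0), (0,2), (1,1), (2,0)]"
  by (simp add: mono_idx_def upt_rec)

definition moment_matrix :: "nat \<Rightarrow> (nat \<Rightarrow> nat \<Rightarrow> real) \<Rightarrow> real mat" where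
  "moment_matrix n \<beta> = mat (mdim n) (mdim n)
     (\<lambda>(r, c). case (mono_idx n ! r, mono_idx n ! c) of ((i, j), (k, l)) \<Rightarrow> \<beta> (i + k) (j + l))"

definition rank_M :: "nat \<Rightarrow> (nat \<Rightarrow> nat \<Rightarrow> real) \<Rightarrow> nat" where
  "rank_M n \<beta> = vec_space.rank (mdim n) (moment_matrix n \<beta>)"

definition psd :: "real mat \<Rightarrow> bool" where
  "psd A \<longleftrightarrow> transpose_mat A = A \<and>
     (\<forall>v\<in>carrier_vec (dim_row A). scalar_prod v (A *\<^sub>v v) \<ge> 0)"

text \<open>The column vector \<open>p(X,Y)\<close>, meaningful for \<open>p \<in> bipolys n\<close>.\<close>

definition col_poly :: "nat \<Rightarrow> (nat \<Rightarrow> nat \<Rightarrow> real) \<Rightarrow> bipoly \<Rightarrow> real vec" where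
  "col_poly n \<beta> p = finsum_vec TYPE(real) (mdim n)
     (\<lambda>c. case mono_idx n ! c of (i, j) \<Rightarrow> cf p i j \<cdot>\<^sub>v col (moment_matrix n \<beta>) c) {..<mdim n}"

definition recursively_generated :: "nat \<Rightarrow> (nat \<Rightarrow> nat \<Rightarrow> real) \<Rightarrow> bool" where
  "recursively_generated n \<beta> \<longleftrightarrow>
     (\<forall>p q. p \<in> bipolys n \<longrightarrow> q \<in> bipolys n \<longrightarrow> p * q \<in> bipolys n \<longrightarrow>
        col_poly n \<beta> p = 0\<^sub>v (mdim n) \<longrightarrow> col_poly n \<beta> (p * q) = 0\<^sub>v (mdim n))"

definition variety :: "nat \<Rightarrow> (nat \<Rightarrow> nat \<Rightarrow> real) \<Rightarrow> (real \<times> real) set" where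
  "variety n \<beta> = \<Inter>{zero_set p |p. p \<in> bipolys n \<and> col_poly n \<beta> p = 0\<^sub>v (mdim n)}"

end

theory Submission
  imports
    Defs
    "HOL-Computational_Algebra.Fundamental_Theorem_Algebra"
begin

text \<open>
  Let \<open>L\<close> be the Riesz functional of \<open>\<beta>\<close>, defined on the polynomials of degree at most \<open>2n\<close>, and
  let \<open>N\<close> be the space of the polynomials \<open>p\<close> of degree at most \<open>n\<close> with \<open>L (p q) = 0\<close> for all
  \<open>q\<close> of degree at most \<open>n\<close>. The moment matrix is the Gram matrix of the form
  \<open>(p, q) \<mapsto> L (p q)\<close>. Hence positive semidefiniteness says \<open>L (p\<^sup>2) \<ge> 0\<close>, the relation
  \<open>p(X,Y) = 0\<close> says \<open>p \<in> N\<close>, the rank is the dimension of the space of polynomials of degree at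
  most \<open>n\<close> modulo \<open>N\<close>, and the variety is the set of common zeros of \<open>N\<close>. For a representing
  measure, \<open>N\<close> consists of the polynomials which vanish on the support
  (\<open>null_iff_vanishes_on_supp\<close>), and all the conditions follow at once.

  For the converse, affine coordinates \<open>u\<close>, \<open>v\<close> are chosen in which \<open>Q = u v - c\<close>. It suffices
  to find a quadrature formula \<open>L q = (\<Sum>z. w z * q z)\<close> for all \<open>q\<close> of degree at most \<open>2n\<close>, with
  nodes on the curve. Two observations reduce the work. If the polynomials of degree at most \<open>n\<close>
  can take arbitrary values at the nodes, then the weights cannot be negative, and the nodes of
  positive weight are as many as the rank (\<open>solved_of_signed\<close>). If they can take arbitrary
  values on a finite variety, then the inequality between the rank and its cardinality forces
  \<open>N\<close> to contain every polynomial that vanishes on it (\<open>null_if_vanishes\<close>).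

  Let \<open>c \<noteq> 0\<close>. The parametrisation \<open>t \<mapsto> (t, c / t)\<close> and multiplication by \<open>t\<^sup>n\<close> turn the
  polynomials of degree at most \<open>n\<close> on the curve into the univariate polynomials of degree at
  most \<open>2n\<close>, and \<open>L\<close> into a univariate functional on degree \<open>4n\<close>. If this functional is positive
  definite, Gauss quadrature gives \<open>2n + 1\<close> nodes; the moment of order \<open>4n + 1\<close> is free, and it
  can be chosen so that 0 is not a node (\<open>positive_quadrature\<close>). Otherwise the variety has at
  most \<open>2n\<close> points, \<open>N\<close> corresponds to the multiples of the polynomial with these roots, and the
  functional annihilates all multiples of it up to degree \<open>4n\<close>; so interpolation at these points
  is an exact quadrature formula.

  Let \<open>c = 0\<close>. A polynomial on the curve is a pair \<open>(f, g)\<close> of univariate polynomials with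
  \<open>f(0) = g(0)\<close>. A finite variety is treated as before, on each line separately
  (\<open>finite_variety_solved\<close>). If the variety contains exactly one of the lines, then \<open>N\<close> consists
  of pairs \<open>(0, g)\<close>; the pair \<open>(0, v h)\<close> in \<open>N\<close> with \<open>h\<close> of least degree has an \<open>h\<close> with simple
  real nonzero roots. These are the nodes on the second line, and what is left of \<open>L\<close> on the
  first line is positive definite, so that Gauss quadrature provides \<open>n + 1\<close> nodes there
  (\<open>line_in_variety_solved\<close>). If the variety contains both lines, the moment \<open>L 1\<close> can be
  divided between the lines in such a way that both parts are positive definite; Gauss
  quadrature on each line gives \<open>2n + 2\<close> nodes (\<open>cross_in_variety_solved\<close>).
\<close>

section \<open>The moment matrix as the Gram matrix of the Riesz functional\<close>

definition scal :: "real \<Rightarrow> bipoly" where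
  "scal c = [:[:c:]:]"

definition mono2 :: "nat \<Rightarrow> nat \<Rightarrow> bipoly" where
  "mono2 i j = Polynomial.monom (Polynomial.monom 1 j) i"

lemma cf_add [simp]: "cf (p + q) i j = cf p i j + cf q i j"
  and cf_diff [simp]: "cf (p - q) i j = cf p i j - cf q i j"
  and cf_zero [simp]: "cf 0 i j = 0"
  by (simp_all add: cf_def)

lemma cf_scal [simp]: "cf (scal c * p) i j = c * cf p i j"
  by (simp add: cf_def scal_def)

lemma cf_sum: "cf (sum f A) i j = (\<Sum>a\<in>A. cf (f a) i j)"
  by (induction A rule: infinite_finite_induct) simp_all

lemma cf_mono2: "cf (mono2 i j) k l = (if i = k \<and> j = l then 1 else 0)"
  by (simp add: cf_def mono2_def)

lemma bipoly_eqI: "(\<And>i j. cf p i j = cf q i j) \<Longrightarrow> p = q"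
  by (simp add: cf_def poly_eq_iff)

lemma bieval_simps [simp]:
  "bieval (p + q) x y = bieval p x y + bieval q x y"
  "bieval (p - q) x y = bieval p x y - bieval q x y"
  "bieval (p * q) x y = bieval p x y * bieval q x y"
  "bieval (p ^ k) x y = bieval p x y ^ k"
  "bieval (scal c) x y = c"
  "bieval 0 x y = 0"
  "bieval 1 x y = 1"
  by (simp_all add: bieval_def scal_def poly_power)

lemma bieval_sum: "bieval (sum f A) x y = (\<Sum>a\<in>A. bieval (f a) x y)"
  by (induction A rule: infinite_finite_induct) simp_all

lemma bieval_mono2 [simp]: "bieval (mono2 i j) x y = y ^ i * x ^ j"
  using bieval_monom[of 1 j i x y] by (simp add: mono2_def)

lemma scal_simps: "scal 0 = 0" "scal 1 = 1" "scal (a + b) = scal a + scal b"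
   "scal (a * b) = scal a * scal b" "scal (a - b) = scal a - scal b"
  by (simp_all add: scal_def one_pCons)

lemma mono2_mult: "mono2 i j * mono2 k l = mono2 (i + k) (j + l)"
  by (simp add: mono2_def mult_monom)

lemma mono2_00: "mono2 0 0 = 1"
  by (simp add: mono2_def one_pCons monom_0)

lemma finite_idx [simp]: "finite {(i::nat, j::nat). i + j \<le> m}"
  by (metis set_mono_idx List.finite_set)

subsection \<open>The degree filtration\<close>

lemma bipolysI: "(\<And>i j. cf p i j \<noteq> 0 \<Longrightarrow> i + j \<le> n) \<Longrightarrow> p \<in> bipolys n"
  by (simp add: bipolys_def)

lemma bipolys_add: "p \<in> bipolys n \<Longrightarrow> q \<in> bipolys n \<Longrightarrow> p + q \<in> bipolys n"
  unfolding bipolys_def mem_Collect_eq cf_add by (metis add.right_neutral)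

lemma bipolys_scal: "p \<in> bipolys n \<Longrightarrow> scal c * p \<in> bipolys n"
  unfolding bipolys_def mem_Collect_eq cf_scal by auto

lemma bipolys_diff: "p \<in> bipolys n \<Longrightarrow> q \<in> bipolys n \<Longrightarrow> p - q \<in> bipolys n"
  unfolding bipolys_def mem_Collect_eq cf_diff by (metis diff_self)

lemma bipolys_zero [simp]: "0 \<in> bipolys n"
  by (simp add: bipolys_def)

lemma bipolys_sum: "(\<And>a. a \<in> A \<Longrightarrow> f a \<in> bipolys n) \<Longrightarrow> sum f A \<in> bipolys n"
  by (induction A rule: infinite_finite_induct) (auto intro: bipolys_add)

lemma bipolys_mono: "p \<in> bipolys m \<Longrightarrow> m \<le> n \<Longrightarrow> p \<in> bipolys n"
  unfolding bipolys_def by fastforce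

lemma mono2_bipolys: "i + j \<le> n \<Longrightarrow> mono2 i j \<in> bipolys n"
  by (rule bipolysI) (auto simp: cf_mono2 split: if_splits)

lemma bipolys_expand:
  assumes "p \<in> bipolys n"
  shows "p = (\<Sum>(i, j)\<in>{(i, j). i + j \<le> n}. scal (cf p i j) * mono2 i j)"
proof (rule bipoly_eqI)
  fix k l
  have "cf (\<Sum>(i, j)\<in>{(i, j). i + j \<le> n}. scal (cf p i j) * mono2 i j) k l
      = (\<Sum>z\<in>{(i, j). i + j \<le> n}. if z = (k, l) then cf p k l else 0)"
    unfolding cf_sum by (rule sum.cong) (auto simp: cf_mono2 split: if_splits)
  also have "\<dots> = cf p k l"
    using assms by (auto simp: sum.delta bipolys_def)
  finally show "cf p k l = cf (\<Sum>(i, j)\<in>{(i, j). i + j \<le> n}. scal (cf p i j) * mono2 i j) k l"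
    by simp
qed

lemma bipolys_mult:
  assumes p: "p \<in> bipolys m" and q: "q \<in> bipolys n"
  shows "p * q \<in> bipolys (m + n)"
proof -
  have "p * q = (\<Sum>z\<in>{(i, j). i + j \<le> m}. scal (case_prod (cf p) z) * case_prod mono2 z)
      * (\<Sum>z\<in>{(i, j). i + j \<le> n}. scal (case_prod (cf q) z) * case_prod mono2 z)"
    using bipolys_expand[OF p] bipolys_expand[OF q] by (simp add: case_prod_unfold)
  also have "\<dots> = (\<Sum>z\<in>{(i, j). i + j \<le> m}. \<Sum>z'\<in>{(i, j). i + j \<le> n}.
      scal (case_prod (cf p) z) * (scal (case_prod (cf q) z') * mono2 (fst z + fst z') (snd z + snd z')))"
    unfolding sum_product
  proof (intro sum.cong refl)
    fix z z' :: "nat \<times> nat"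
    have R: "(a * b) * (c * d) = a * (c * (b * d))" for a b c d :: bipoly
      by (simp only: mult.assoc mult.left_commute)
    show "scal (case_prod (cf p) z) * case_prod mono2 z * (scal (case_prod (cf q) z') * case_prod mono2 z')
        = scal (case_prod (cf p) z) * (scal (case_prod (cf q) z') * mono2 (fst z + fst z') (snd z + snd z'))"
      unfolding R by (simp add: mono2_mult case_prod_unfold)
  qed
  also have "\<dots> \<in> bipolys (m + n)"
    by (auto intro!: bipolys_sum bipolys_scal mono2_bipolys)
  finally show ?thesis .
qed

lemma bipolys_scal0: "scal c \<in> bipolys n"
  using bipolys_scal[OF mono2_bipolys[of 0 0 n]] by (simp add: mono2_00)

lemma bipolys_one: "1 \<in> bipolys n"
  using bipolys_scal0[of 1] by (simp add: scal_simps)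

lemma bipolys_power: "p \<in> bipolys m \<Longrightarrow> p ^ k \<in> bipolys (k * m)"
  by (induction k) (auto intro: bipolys_one bipolys_mult)

subsection \<open>Linear forms and null polynomials\<close>

definition lin :: "(bipoly \<Rightarrow> real) \<Rightarrow> bool" where
  "lin L \<longleftrightarrow> (\<forall>p q. L (p + q) = L p + L q) \<and> (\<forall>c p. L (scal c * p) = c * L p)"

lemma linD: assumes "lin L"
  shows "L (p + q) = L p + L q" "L (scal c * p) = c * L p" "L 0 = 0" "L (p - q) = L p - L q"
proof -
  show A: "L (p + q) = L p + L q" "L (scal c * p) = c * L p" for p q c
    using assms by (auto simp: lin_def)
  show "L 0 = 0" using A(2)[of 0 0] by (simp add: scal_simps)
  have "L (p - q) = L (p + scal (-1) * q)" by (rule arg_cong[of _ _ L], rule bipoly_eqI) simp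
  also have "\<dots> = L p - L q" unfolding A by simp
  finally show "L (p - q) = L p - L q" .
qed

lemma lin_sum: "lin L \<Longrightarrow> L (sum f A) = (\<Sum>a\<in>A. L (f a))"
  by (induction A rule: infinite_finite_induct) (simp_all add: linD)

definition riesz :: "nat \<Rightarrow> (nat \<Rightarrow> nat \<Rightarrow> real) \<Rightarrow> bipoly \<Rightarrow> real" where
  "riesz n \<beta> p = (\<Sum>(i, j)\<in>{(i, j). i + j \<le> 2 * n}. cf p i j * \<beta> i j)"

lemma lin_riesz: "lin (riesz n \<beta>)"
  by (simp add: lin_def riesz_def case_prod_unfold distrib_right sum.distrib sum_distrib_left mult.assoc)

lemma lin_mult: "lin L \<Longrightarrow> lin (\<lambda>p. L (q * p))"
  unfolding lin_def by (simp add: distrib_left) (metis mult.left_commute)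

lemma lin_bieval: "lin (\<lambda>p. bieval p x y)"
  by (simp add: lin_def)

lemma riesz_mono2: "i + j \<le> 2 * n \<Longrightarrow> riesz n \<beta> (mono2 i j) = \<beta> i j"
proof -
  assume a: "i + j \<le> 2 * n"
  have "riesz n \<beta> (mono2 i j) = (\<Sum>z\<in>{(i, j). i + j \<le> 2 * n}. if z = (i, j) then \<beta> i j else 0)"
    unfolding riesz_def by (rule sum.cong) (auto simp: cf_mono2 split: if_splits)
  then show ?thesis using a by (simp add: sum.delta)
qed

definition null :: "nat \<Rightarrow> (bipoly \<Rightarrow> real) \<Rightarrow> bipoly set" where
  "null n L = {p \<in> bipolys n. \<forall>q\<in>bipolys n. L (q * p) = 0}"

text \<open>
  Linear forms are compared on monomials; this is how facts about entries of the moment matrix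
  become facts about polynomials.
\<close>

lemma lin_bipolys_ext:
  assumes "lin L" "lin L'" "p \<in> bipolys n" "\<And>i j. i + j \<le> n \<Longrightarrow> L (mono2 i j) = L' (mono2 i j)"
  shows "L p = L' p"
proof -
  have "L p = (\<Sum>(i, j)\<in>{(i, j). i + j \<le> n}. cf p i j * L (mono2 i j))"
    by (subst bipolys_expand[OF assms(3)]) (auto simp: lin_sum linD assms(1) intro!: sum.cong)
  also have "\<dots> = (\<Sum>(i, j)\<in>{(i, j). i + j \<le> n}. cf p i j * L' (mono2 i j))"
    by (auto simp: assms(4) intro!: sum.cong)
  also have "\<dots> = L' p"
    by (subst (2) bipolys_expand[OF assms(3)]) (auto simp: lin_sum linD assms(2) intro!: sum.cong)
  finally show ?thesis .
qed

lemma null_mono2: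
  assumes "lin L" "p \<in> bipolys n"
  shows "p \<in> null n L \<longleftrightarrow> (\<forall>i j. i + j \<le> n \<longrightarrow> L (mono2 i j * p) = 0)"
proof
  assume "p \<in> null n L" then show "\<forall>i j. i + j \<le> n \<longrightarrow> L (mono2 i j * p) = 0"
    by (auto simp: null_def mono2_bipolys)
next
  assume a: "\<forall>i j. i + j \<le> n \<longrightarrow> L (mono2 i j * p) = 0"
  have "L (p * q) = 0" if "q \<in> bipolys n" for q
    using lin_bipolys_ext[OF lin_mult[OF assms(1), of p], of "\<lambda>_. 0" q n] that a
    by (simp add: lin_def mult.commute)
  then show "p \<in> null n L" using assms by (simp add: null_def mult.commute)
qed

lemma null_zero: "lin L \<Longrightarrow> 0 \<in> null n L"
  by (simp add: null_def linD)

lemma null_add: "lin L \<Longrightarrow> p \<in> null n L \<Longrightarrow> q \<in> null n L \<Longrightarrow> p + q \<in> null n L"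
  by (simp add: null_def linD bipolys_add distrib_left)

lemma null_scal: "lin L \<Longrightarrow> p \<in> null n L \<Longrightarrow> scal c * p \<in> null n L"
  by (simp add: null_def linD bipolys_scal mult.left_commute[of _ "scal c"])

text \<open>
  The Cauchy-Schwarz argument: if \<open>L (p\<^sup>2) = 0\<close>, then \<open>L ((q + c p)\<^sup>2)\<close> is an affine function of
  \<open>c\<close>, and being nonnegative it must be constant.
\<close>

lemma null_iff_square:
  assumes L: "lin L" and pos: "\<And>p. p \<in> bipolys n \<Longrightarrow> L (p * p) \<ge> 0" and p: "p \<in> bipolys n"
  shows "p \<in> null n L \<longleftrightarrow> L (p * p) = 0"
proof
  assume "p \<in> null n L" then show "L (p * p) = 0" using p by (simp add: null_def)
next
  assume 0: "L (p * p) = 0"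
  have "L (q * p) = 0" if q: "q \<in> bipolys n" for q
  proof (rule ccontr)
    assume ne: "L (q * p) \<noteq> 0"
    \<comment> \<open>the slope for which the affine function \<open>c \<mapsto> L ((q + c p)\<^sup>2)\<close> takes the value \<open>-1\<close>\<close>
    define c where "c = - (L (q * q) + 1) / (2 * L (q * p))"
    have "(q + scal c * p) * (q + scal c * p)
        = q * q + (scal (2 * c) * (q * p) + scal (c * c) * (p * p))"
      using scal_simps(3)[of c c] by (simp add: scal_simps(4) algebra_simps)
    then have "L ((q + scal c * p) * (q + scal c * p)) = L (q * q) + 2 * c * L (q * p)"
      by (simp add: linD[OF L] 0)
    also have "\<dots> = -1" using ne by (simp add: c_def field_simps)
    finally show False
      using pos[of "q + scal c * p"] p q by (simp add: bipolys_add bipolys_scal)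
  qed
  then show "p \<in> null n L" using p by (simp add: null_def)
qed

subsection \<open>Translation of the matrix conditions\<close>

lemma moment_matrix_carrier: "moment_matrix n \<beta> \<in> carrier_mat (mdim n) (mdim n)"
  by (simp add: moment_matrix_def)

lemma idx_in: "r < mdim n \<Longrightarrow> mono_idx n ! r = (i, j) \<Longrightarrow> i + j \<le> n"
  by (metis (mono_tags, lifting) case_prodD mem_Collect_eq nth_mem set_mono_idx)

definition mono_at :: "nat \<Rightarrow> nat \<Rightarrow> bipoly" where
  "mono_at n r = case_prod mono2 (mono_idx n ! r)"

lemma mono_at_bipolys: "r < mdim n \<Longrightarrow> mono_at n r \<in> bipolys n"
  by (cases "mono_idx n ! r") (auto simp: mono_at_def idx_in intro: mono2_bipolys)

lemma moment_matrix_index: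
  assumes "r < mdim n" "c < mdim n"
  shows "moment_matrix n \<beta> $$ (r, c) = riesz n \<beta> (mono_at n r * mono_at n c)"
proof -
  obtain i j k l where e: "mono_idx n ! r = (i, j)" "mono_idx n ! c = (k, l)"
    by (metis surj_pair)
  have "(i + k) + (j + l) \<le> 2 * n"
    using idx_in[OF assms(1) e(1)] idx_in[OF assms(2) e(2)] by simp
  then show ?thesis
    using assms e by (simp add: moment_matrix_def mono_at_def mono2_mult riesz_mono2)
qed

lemma mono_idx_distinct: "distinct (mono_idx n)"
proof -
  have "card (set (mono_idx n)) = mdim n"
  proof -
    have "set (mono_idx n) = (SIGMA i:{..n}. {..n - i})"
      unfolding set_mono_idx by auto
    then have "card (set (mono_idx n)) = (\<Sum>i\<le>n. Suc (n - i))"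
      by simp
    also have "\<dots> = (\<Sum>i\<le>n. Suc i)"
      by (rule sum.reindex_bij_witness[of _ "\<lambda>i. n - i" "\<lambda>i. n - i"]) auto
    also have "2 * \<dots> = (n + 1) * (n + 2)"
      by (induction n) auto
    finally show ?thesis
      unfolding mdim_eq by (metis div_mult_self1_is_m pos2)
  qed
  then show ?thesis by (simp add: card_distinct)
qed

lemma sum_idx:
  "(\<Sum>c<mdim n. f (mono_idx n ! c)) = (\<Sum>z\<in>{(i, j). i + j \<le> n}. f z)"
  unfolding set_mono_idx[symmetric]
  by (rule sum.reindex_bij_betw) (rule bij_betw_nth[OF mono_idx_distinct], auto)

definition coeff_vec :: "nat \<Rightarrow> bipoly \<Rightarrow> real vec" where
  "coeff_vec n p = vec (mdim n) (\<lambda>c. case_prod (cf p) (mono_idx n ! c))"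

lemma bipolys_expand_idx:
  assumes "p \<in> bipolys n"
  shows "p = (\<Sum>c<mdim n. scal (coeff_vec n p $ c) * mono_at n c)"
proof -
  have "p = (\<Sum>z\<in>{(i, j). i + j \<le> n}. scal (case_prod (cf p) z) * case_prod mono2 z)"
    by (subst bipolys_expand[OF assms]) (auto intro!: sum.cong)
  also have "\<dots> = (\<Sum>c<mdim n. scal (case_prod (cf p) (mono_idx n ! c)) * case_prod mono2 (mono_idx n ! c))"
    by (rule sum_idx[symmetric])
  also have "\<dots> = (\<Sum>c<mdim n. scal (coeff_vec n p $ c) * mono_at n c)"
    by (rule sum.cong) (auto simp: coeff_vec_def mono_at_def)
  finally show ?thesis .
qed

lemma coeff_vec_surj:
  assumes "v \<in> carrier_vec (mdim n)"
  obtains p where "p \<in> bipolys n" "coeff_vec n p = v"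
proof
  let ?p = "\<Sum>c<mdim n. scal (v $ c) * mono_at n c"
  show "?p \<in> bipolys n"
    by (auto intro!: bipolys_sum bipolys_scal mono_at_bipolys)
  show "coeff_vec n ?p = v"
  proof (rule eq_vecI)
    fix r assume "r < dim_vec v"
    then have r: "r < mdim n" using assms by auto
    obtain i j where ij: "mono_idx n ! r = (i, j)" by (metis surj_pair)
    have "cf ?p i j = (\<Sum>c<mdim n. if c = r then v $ r else 0)"
      unfolding cf_sum
    proof (rule sum.cong)
      fix c assume "c \<in> {..<mdim n}"
      then have "mono_idx n ! c = (i, j) \<longleftrightarrow> c = r"
        using ij r mono_idx_distinct[of n] by (metis lessThan_iff nth_eq_iff_index_eq)
      then show "cf (scal (v $ c) * mono_at n c) i j = (if c = r then v $ r else 0)"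
        by (cases "mono_idx n ! c") (auto simp: mono_at_def cf_mono2)
    qed simp
    then show "coeff_vec n ?p $ r = v $ r"
      using r ij by (simp add: coeff_vec_def)
  qed (use assms in \<open>simp add: coeff_vec_def\<close>)
qed

lemma col_poly_index:
  assumes "p \<in> bipolys n" "r < mdim n"
  shows "col_poly n \<beta> p $ r = riesz n \<beta> (mono_at n r * p)"
proof -
  have "col_poly n \<beta> p $ r = (\<Sum>c<mdim n. coeff_vec n p $ c * riesz n \<beta> (mono_at n r * mono_at n c))"
    unfolding col_poly_def
  proof (subst index_finsum_vec)
    show "(\<lambda>c. case mono_idx n ! c of (i, j) \<Rightarrow> cf p i j \<cdot>\<^sub>v col (moment_matrix n \<beta>) c)
        \<in> {..<mdim n} \<rightarrow> carrier_vec (mdim n)"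
      using moment_matrix_carrier by (auto split: prod.splits)
    show "(\<Sum>c<mdim n. (case mono_idx n ! c of (i, j) \<Rightarrow> cf p i j \<cdot>\<^sub>v col (moment_matrix n \<beta>) c) $ r)
      = (\<Sum>c<mdim n. coeff_vec n p $ c * riesz n \<beta> (mono_at n r * mono_at n c))"
    proof (rule sum.cong)
      fix c assume c: "c \<in> {..<mdim n}"
      have d: "dim_row (moment_matrix n \<beta>) = mdim n" "dim_col (moment_matrix n \<beta>) = mdim n"
        using moment_matrix_carrier by auto
      have "col (moment_matrix n \<beta>) c $ r = riesz n \<beta> (mono_at n r * mono_at n c)"
        using c assms(2) d by (subst index_col) (simp_all add: moment_matrix_index)
      then show "(case mono_idx n ! c of (i, j) \<Rightarrow> cf p i j \<cdot>\<^sub>v col (moment_matrix n \<beta>) c) $ r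
        = coeff_vec n p $ c * riesz n \<beta> (mono_at n r * mono_at n c)"
        using c assms(2) d by (auto simp: coeff_vec_def split: prod.splits)
    qed simp
  qed (use assms in auto)
  also have "\<dots> = riesz n \<beta> (mono_at n r * p)"
    by (subst (2) bipolys_expand_idx[OF assms(1)])
      (auto simp: sum_distrib_left lin_sum[OF lin_riesz] linD[OF lin_riesz]
         mult.left_commute[of _ "scal _"] intro!: sum.cong)
  finally show ?thesis .
qed

lemma col_poly_dim: "col_poly n \<beta> p \<in> carrier_vec (mdim n)"
  unfolding col_poly_def
  using moment_matrix_carrier by (intro finsum_vec_closed) (auto split: prod.splits)

lemma col_poly_null:
  assumes "p \<in> bipolys n"
  shows "col_poly n \<beta> p = 0\<^sub>v (mdim n) \<longleftrightarrow> p \<in> null n (riesz n \<beta>)"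
proof -
  have "col_poly n \<beta> p = 0\<^sub>v (mdim n) \<longleftrightarrow> (\<forall>r<mdim n. riesz n \<beta> (mono_at n r * p) = 0)"
    using col_poly_dim[of n \<beta> p] by (auto simp: vec_eq_iff col_poly_index[OF assms] carrier_vecD)
  also have "\<dots> \<longleftrightarrow> (\<forall>z\<in>set (mono_idx n). riesz n \<beta> (case_prod mono2 z * p) = 0)"
    by (simp add: all_set_conv_all_nth mono_at_def)
  also have "\<dots> \<longleftrightarrow> p \<in> null n (riesz n \<beta>)"
    unfolding null_mono2[OF lin_riesz assms] set_mono_idx by auto
  finally show ?thesis .
qed

lemma moment_matrix_form:
  assumes "p \<in> bipolys n"
  shows "scalar_prod (coeff_vec n p) (moment_matrix n \<beta> *\<^sub>v coeff_vec n p) = riesz n \<beta> (p * p)"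
proof -
  have d: "dim_row (moment_matrix n \<beta>) = mdim n" "dim_col (moment_matrix n \<beta>) = mdim n"
    using moment_matrix_carrier by auto
  have "(moment_matrix n \<beta> *\<^sub>v coeff_vec n p) $ r = riesz n \<beta> (mono_at n r * p)" if r: "r < mdim n" for r
  proof -
    have "(moment_matrix n \<beta> *\<^sub>v coeff_vec n p) $ r = (\<Sum>c<mdim n. riesz n \<beta> (mono_at n r * mono_at n c) * coeff_vec n p $ c)"
      using r d by (auto simp: scalar_prod_def moment_matrix_index lessThan_atLeast0 coeff_vec_def intro!: sum.cong)
    also have "\<dots> = riesz n \<beta> (mono_at n r * p)"
      by (subst (2) bipolys_expand_idx[OF assms(1)])
        (auto simp: sum_distrib_left lin_sum[OF lin_riesz] linD[OF lin_riesz]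
         mult.left_commute[of _ "scal _"] intro!: sum.cong)
    finally show ?thesis .
  qed
  then have "scalar_prod (coeff_vec n p) (moment_matrix n \<beta> *\<^sub>v coeff_vec n p)
     = (\<Sum>r<mdim n. coeff_vec n p $ r * riesz n \<beta> (mono_at n r * p))"
    using d by (auto simp: scalar_prod_def lessThan_atLeast0 intro!: sum.cong)
  also have "\<dots> = riesz n \<beta> (p * p)"
      by (subst (3) bipolys_expand_idx[OF assms(1)])
        (auto simp: sum_distrib_right lin_sum[OF lin_riesz] linD[OF lin_riesz]
         mult.assoc intro!: sum.cong)
  finally show ?thesis .
qed

lemma psd_iff: "psd (moment_matrix n \<beta>) \<longleftrightarrow> (\<forall>p\<in>bipolys n. riesz n \<beta> (p * p) \<ge> 0)"
proof -
  have d: "dim_row (moment_matrix n \<beta>) = mdim n" "dim_col (moment_matrix n \<beta>) = mdim n"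
    using moment_matrix_carrier by auto
  have "transpose_mat (moment_matrix n \<beta>) = moment_matrix n \<beta>"
    by (rule eq_matI) (auto simp: d moment_matrix_index mult.commute)
  then have "psd (moment_matrix n \<beta>) \<longleftrightarrow>
     (\<forall>v\<in>carrier_vec (mdim n). scalar_prod v (moment_matrix n \<beta> *\<^sub>v v) \<ge> 0)"
    by (simp add: psd_def d)
  also have "\<dots> \<longleftrightarrow> (\<forall>p\<in>bipolys n. riesz n \<beta> (p * p) \<ge> 0)"
  proof safe
    fix p assume "\<forall>v\<in>carrier_vec (mdim n). scalar_prod v (moment_matrix n \<beta> *\<^sub>v v) \<ge> 0" "p \<in> bipolys n"
    moreover have "coeff_vec n p \<in> carrier_vec (mdim n)" by (simp add: coeff_vec_def)
    ultimately show "riesz n \<beta> (p * p) \<ge> 0" using moment_matrix_form by metis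
  next
    fix v :: "real Matrix.vec" assume a: "\<forall>p\<in>bipolys n. riesz n \<beta> (p * p) \<ge> 0" "v \<in> carrier_vec (mdim n)"
    show "scalar_prod v (moment_matrix n \<beta> *\<^sub>v v) \<ge> 0"
      by (rule coeff_vec_surj[OF a(2)]) (use a moment_matrix_form in metis)
  qed
  finally show ?thesis .
qed



section \<open>Rank of the moment matrix\<close>

lemma homogeneous_system:
  fixes A :: "'b \<Rightarrow> 's \<Rightarrow> real"
  assumes "finite S" "finite B" "card S < card B"
  shows "\<exists>c. (\<exists>b\<in>B. c b \<noteq> 0) \<and> (\<forall>s\<in>S. (\<Sum>b\<in>B. c b * A b s) = 0)"
  using assms
proof (induction S arbitrary: B A rule: finite_induct)
  case empty
  then have "B \<noteq> {}" by auto
  then show ?case by (intro exI[of _ "\<lambda>_. 1"]) auto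
next
  case (insert s S)
  show ?case
  proof (cases "\<forall>b\<in>B. A b s = 0")
    case True
    have "card S < card B" using insert.hyps insert.prems by simp
    then obtain c where "\<exists>b\<in>B. c b \<noteq> 0" "\<forall>s\<in>S. (\<Sum>b\<in>B. c b * A b s) = 0"
      using insert.IH[of B A] insert.prems(1) by blast
    then show ?thesis using True by (intro exI[of _ c]) auto
  next
    case False
    then obtain b0 where b0: "b0 \<in> B" "A b0 s \<noteq> 0" by blast
    define B' where "B' = B - {b0}"
    have B: "B = insert b0 B'" "b0 \<notin> B'" "finite B'" using b0 insert.prems by (auto simp: B'_def)
    then have "card S < card B'" using insert.hyps insert.prems by simp
    then obtain c where c: "\<exists>b\<in>B'. c b \<noteq> 0"
        "\<forall>x\<in>S. (\<Sum>b\<in>B'. c b * (A b x - A b s / A b0 s * A b0 x)) = 0"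
      using insert.IH[of B' "\<lambda>b x. A b x - A b s / A b0 s * A b0 x"] B(3) by blast
    define c0 where "c0 = - (\<Sum>b\<in>B'. c b * A b s / A b0 s)"
    have S: "(\<Sum>b\<in>B. (c(b0 := c0)) b * A b x) = c0 * A b0 x + (\<Sum>b\<in>B'. c b * A b x)" for x
    proof -
      have "(\<Sum>b\<in>B'. (c(b0 := c0)) b * A b x) = (\<Sum>b\<in>B'. c b * A b x)"
        using B by (intro sum.cong) auto
      then show ?thesis unfolding B(1) using B by simp
    qed
    have "(\<Sum>b\<in>B. (c(b0 := c0)) b * A b x) = (\<Sum>b\<in>B'. c b * (A b x - A b s / A b0 s * A b0 x))" for x
      unfolding S unfolding c0_def by (simp add: sum_distrib_right sum_subtractf right_diff_distrib mult.assoc sum_negf)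
    moreover have "(\<Sum>b\<in>B'. c b * (A b s - A b s / A b0 s * A b0 s)) = 0"
      using b0 by simp
    ultimately have "\<forall>x\<in>insert s S. (\<Sum>b\<in>B. (c(b0 := c0)) b * A b x) = 0"
      using c(2) by auto
    moreover have "\<exists>b\<in>B. (c(b0 := c0)) b \<noteq> 0" using c(1) B by auto
    ultimately show ?thesis by blast
  qed
qed

text \<open>
  A maximal independent set of columns, read as a set \<open>B\<close> of monomials, is a basis of the
  polynomials of degree at most \<open>n\<close> modulo the null polynomials. The matrix rank is used only
  through this fact and the two bounds derived from it.
\<close>

lemma rank_basis:
  obtains B where "finite B" "card B = rank_M n \<beta>" "B \<subseteq> {..<mdim n}"
    "\<And>c. (\<Sum>b\<in>B. scal (c b) * mono_at n b) \<in> null n (riesz n \<beta>) \<Longrightarrow> \<forall>b\<in>B. c b = 0"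
    "\<And>p. p \<in> bipolys n \<Longrightarrow>
        \<exists>c. p - (\<Sum>b\<in>B. scal (c b) * mono_at n b) \<in> null n (riesz n \<beta>)"
proof -
  interpret vec_space "TYPE(real)" "mdim n" .
  let ?L = "riesz n \<beta>" and ?M = "moment_matrix n \<beta>"
  note L = lin_riesz[of n \<beta>]
  have M: "?M \<in> carrier_mat (mdim n) (mdim n)" by (rule moment_matrix_carrier)
  have cols: "set (cols ?M) \<subseteq> carrier_vec (mdim n)" using cols_dim[of ?M] M by auto
  have null_at: "p \<in> null n ?L \<longleftrightarrow> (\<forall>r<mdim n. ?L (mono_at n r * p) = 0)" if "p \<in> bipolys n" for p
    using that by (auto simp: vec_eq_iff col_poly_null[symmetric] col_poly_index carrier_vecD[OF col_poly_dim])
  obtain S where S: "maximal S (\<lambda>T. T \<subseteq> set (cols ?M) \<and> lin_indpt T)" "finite S"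
  proof -
    have "lin_indpt {}" by (rule finite_lin_indpt2) auto
    then show ?thesis
      using that maximal_exists_superset[of "set (cols ?M)" "\<lambda>T. T \<subseteq> set (cols ?M) \<and> lin_indpt T" "{}"]
      by auto
  qed
  have Sc: "S \<subseteq> set (cols ?M)" and Si: "lin_indpt S" using S(1) by (auto simp: maximal_def)
  have SC: "S \<subseteq> carrier_vec (mdim n)" using Sc cols by auto
  define g where "g x = (SOME c. c < mdim n \<and> col ?M c = x)" for x
  have ex: "\<exists>c<mdim n. col ?M c = x" if "x \<in> set (cols ?M)" for x
    using that M by (auto simp: in_set_conv_nth)
  have g: "g x < mdim n" "col ?M (g x) = x" if "x \<in> S" for x
    using someI_ex[OF ex[of x]] that Sc by (auto simp: g_def)
  have inj: "inj_on g S" using g by (metis inj_onI)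
  have col_at: "col ?M c $ r = ?L (mono_at n r * mono_at n c)" if "r < mdim n" "c < mdim n" for r c
    using that M by (simp add: moment_matrix_index)
  have S_at: "x $ r = ?L (mono_at n r * mono_at n (g x))" if "x \<in> S" "r < mdim n" for x r
    using col_at[of r "g x"] g[OF that(1)] that by simp
  have sumL: "?L (mono_at n r * (\<Sum>b\<in>g ` S. scal (c b) * mono_at n b)) = (\<Sum>x\<in>S. c (g x) * x $ r)"
    if "r < mdim n" for r c
  proof -
    have "?L (mono_at n r * (\<Sum>b\<in>g ` S. scal (c b) * mono_at n b))
        = (\<Sum>b\<in>g ` S. c b * ?L (mono_at n r * mono_at n b))"
      by (simp add: lin_sum[OF lin_mult[OF L]] linD(2)[OF lin_mult[OF L]])
    also have "\<dots> = (\<Sum>x\<in>S. c (g x) * ?L (mono_at n r * mono_at n (g x)))"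
      by (simp add: sum.reindex[OF inj])
    finally show ?thesis using S_at that by simp
  qed
  have sum_in: "(\<Sum>b\<in>g ` S. scal (c b) * mono_at n b) \<in> bipolys n" for c
    using g by (auto intro!: bipolys_sum bipolys_scal mono_at_bipolys)
  have span1: "\<exists>c. mono_at n k - (\<Sum>b\<in>g ` S. scal (c b) * mono_at n b) \<in> null n ?L" if k: "k < mdim n" for k
  proof -
    define x where "x = col ?M k"
    have x: "x \<in> set (cols ?M)" using k M by (auto simp: x_def cols_def)
    have "x \<in> span S"
    proof (cases "x \<in> S")
      case True
      then show ?thesis using in_own_span[OF SC[folded module_vec_simps(3)]] by auto
    next
      case False
      have "\<not> lin_indpt (S \<union> {x})"
        using S(1) x False unfolding maximal_def by (metis Un_insert_right insertI1 insert_subset subset_insertI sup_bot_right)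
      then show ?thesis
        using lin_dep_iff_in_span[of S x] SC Si x cols False by auto
    qed
    then obtain a where a: "lincomb a S = x"
      using finite_in_span[OF S(2)] SC by auto
    have "?L (mono_at n r * (mono_at n k - (\<Sum>b\<in>g ` S. scal (a (inv_into S g b)) * mono_at n b))) = 0"
      if r: "r < mdim n" for r
    proof -
      have "(\<Sum>x\<in>S. a (inv_into S g (g x)) * x $ r) = (\<Sum>x\<in>S. a x * x $ r)"
        using inj by (intro sum.cong) auto
      also have "\<dots> = x $ r"
        using lincomb_index[OF r SC, of a] a by simp
      also have "\<dots> = ?L (mono_at n r * mono_at n k)"
        using col_at r k by (simp add: x_def)
      finally show ?thesis
        unfolding right_diff_distrib linD(4)[OF L] sumL[OF r] by simp
    qed
    then have "mono_at n k - (\<Sum>b\<in>g ` S. scal (a (inv_into S g b)) * mono_at n b) \<in> null n ?L"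
      unfolding null_at[OF bipolys_diff[OF mono_at_bipolys[OF k] sum_in]] by blast
    then show ?thesis by (rule exI[of _ "\<lambda>b. a (inv_into S g b)"])
  qed
  show ?thesis
  proof (rule that[of "g ` S"])
    show "finite (g ` S)" using S by simp
    show "card (g ` S) = rank_M n \<beta>"
      using rank_card_indpt[OF M S(1)] card_image[OF inj] by (simp add: rank_M_def)
    show "g ` S \<subseteq> {..<mdim n}" using g by auto
    show "\<forall>b\<in>g ` S. c b = 0" if c: "(\<Sum>b\<in>g ` S. scal (c b) * mono_at n b) \<in> null n ?L" for c
    proof (rule ccontr)
      assume "\<not> ?thesis"
      then obtain x where x: "x \<in> S" "c (g x) \<noteq> 0" by auto
      have "lincomb (c \<circ> g) S = 0\<^sub>v (mdim n)"
      proof (rule eq_vecI)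
        fix r assume "r < dim_vec (0\<^sub>v (mdim n))"
        then have r: "r < mdim n" by simp
        then show "lincomb (c \<circ> g) S $ r = 0\<^sub>v (mdim n) $ r"
          using lincomb_index[OF r SC, of "c \<circ> g"] sumL[OF r, of c] c null_at[OF sum_in] by simp
      qed (use lincomb_dim[OF S(2) SC] in auto)
      then have "lin_dep S"
        using x by (intro lin_dep_crit[OF S(2) order_refl, where a = "c \<circ> g" and v = x]) (auto simp: class_ring_simps)
      then show False using Si by simp
    qed
    show "\<exists>c. p - (\<Sum>b\<in>g ` S. scal (c b) * mono_at n b) \<in> null n ?L" if p: "p \<in> bipolys n" for p
    proof -
      define a where "a k = (SOME c. mono_at n k - (\<Sum>b\<in>g ` S. scal (c b) * mono_at n b) \<in> null n ?L)" for k
      have a: "mono_at n k - (\<Sum>b\<in>g ` S. scal (a k b) * mono_at n b) \<in> null n ?L" if "k < mdim n" for k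
        unfolding a_def by (rule someI_ex[OF span1[OF that]])
      have "(\<Sum>k\<in>K. scal (v k) * mono_at n k)
          - (\<Sum>b\<in>g ` S. scal (\<Sum>k\<in>K. v k * a k b) * mono_at n b) \<in> null n ?L"
        if "finite K" "K \<subseteq> {..<mdim n}" for K v
        using that
      proof (induction K rule: finite_induct)
        case empty
        then show ?case by (simp add: scal_simps null_zero[OF L])
      next
        case (insert k K)
        have e: "(\<Sum>k\<in>insert k K. scal (v k) * mono_at n k)
          - (\<Sum>b\<in>g ` S. scal (\<Sum>k\<in>insert k K. v k * a k b) * mono_at n b)
          = scal (v k) * (mono_at n k - (\<Sum>b\<in>g ` S. scal (a k b) * mono_at n b))
            + ((\<Sum>k\<in>K. scal (v k) * mono_at n k)
          - (\<Sum>b\<in>g ` S. scal (\<Sum>k\<in>K. v k * a k b) * mono_at n b))"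
          using insert by (simp add: scal_simps distrib_right right_diff_distrib sum.distrib sum_distrib_left mult.assoc)
        show ?case unfolding e using insert a by (intro null_add[OF L] null_scal[OF L]) auto
      qed
      from this[of "{..<mdim n}" "\<lambda>k. coeff_vec n p $ k"] show ?thesis
        using bipolys_expand_idx[OF p] by auto
    qed
  qed
qed

text \<open>
  More basis monomials than linear forms \<open>\<phi> s\<close> would admit a nontrivial combination on which all
  the forms vanish, hence a nontrivial null combination.
\<close>

lemma rank_le:
  assumes S: "finite S" and lin: "\<And>s. s \<in> S \<Longrightarrow> lin (\<phi> s)"
    and null: "\<And>p. p \<in> bipolys n \<Longrightarrow> (\<And>s. s \<in> S \<Longrightarrow> \<phi> s p = 0) \<Longrightarrow> p \<in> null n (riesz n \<beta>)"
  shows "rank_M n \<beta> \<le> card S"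
proof (rule ccontr)
  assume less: "\<not> ?thesis"
  obtain B where B: "finite B" "card B = rank_M n \<beta>" "B \<subseteq> {..<mdim n}"
    and indep: "\<And>c. (\<Sum>b\<in>B. scal (c b) * mono_at n b) \<in> null n (riesz n \<beta>) \<Longrightarrow> \<forall>b\<in>B. c b = 0"
    by (rule rank_basis[of n \<beta>]) blast
  obtain c where c: "\<exists>b\<in>B. c b \<noteq> 0" "\<forall>s\<in>S. (\<Sum>b\<in>B. c b * \<phi> s (mono_at n b)) = 0"
    using homogeneous_system[OF S B(1), of "\<lambda>b s. \<phi> s (mono_at n b)"] less B(2) by auto
  have "(\<Sum>b\<in>B. scal (c b) * mono_at n b) \<in> null n (riesz n \<beta>)"
  proof (rule null)
    show "(\<Sum>b\<in>B. scal (c b) * mono_at n b) \<in> bipolys n"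
      using B(3) by (intro bipolys_sum bipolys_scal mono_at_bipolys) auto
    show "\<phi> s (\<Sum>b\<in>B. scal (c b) * mono_at n b) = 0" if "s \<in> S" for s
      using c(2) that by (simp add: lin_sum[OF lin[OF that]] linD(2)[OF lin[OF that]])
  qed
  then show False using indep c(1) by blast
qed

text \<open>
  Modulo null polynomials the \<open>p i\<close> are combinations of the basis monomials, so if they
  outnumbered the basis they would be dependent modulo null polynomials.
\<close>

lemma rank_ge:
  assumes I: "finite I" and p: "\<And>i. i \<in> I \<Longrightarrow> p i \<in> bipolys n"
    and indep: "\<And>c. (\<Sum>i\<in>I. scal (c i) * p i) \<in> null n (riesz n \<beta>) \<Longrightarrow> \<forall>i\<in>I. c i = 0"
  shows "card I \<le> rank_M n \<beta>"
proof (rule ccontr)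
  assume less: "\<not> ?thesis"
  note L = lin_riesz[of n \<beta>]
  obtain B where B: "finite B" "card B = rank_M n \<beta>" "B \<subseteq> {..<mdim n}"
    and span: "\<And>p. p \<in> bipolys n \<Longrightarrow>
        \<exists>c. p - (\<Sum>b\<in>B. scal (c b) * mono_at n b) \<in> null n (riesz n \<beta>)"
    by (rule rank_basis[of n \<beta>]) blast
  have "\<forall>i\<in>I. \<exists>c. p i - (\<Sum>b\<in>B. scal (c b) * mono_at n b) \<in> null n (riesz n \<beta>)"
    using span p by blast
  then obtain a where a: "\<forall>i\<in>I. p i - (\<Sum>b\<in>B. scal (a i b) * mono_at n b) \<in> null n (riesz n \<beta>)"
    by metis
  obtain c where c: "\<exists>i\<in>I. c i \<noteq> 0" "\<forall>b\<in>B. (\<Sum>i\<in>I. c i * a i b) = 0"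
    using homogeneous_system[OF B(1) I, of a] less B(2) by auto
  have "(\<Sum>i\<in>J. scal (c i) * p i) - (\<Sum>b\<in>B. scal (\<Sum>i\<in>J. c i * a i b) * mono_at n b) \<in> null n (riesz n \<beta>)"
    if "finite J" "J \<subseteq> I" for J
    using that
  proof (induction J rule: finite_induct)
    case empty
    then show ?case by (simp add: scal_simps null_zero[OF L])
  next
    case (insert i J)
    have e: "(\<Sum>i\<in>insert i J. scal (c i) * p i) - (\<Sum>b\<in>B. scal (\<Sum>i\<in>insert i J. c i * a i b) * mono_at n b)
      = scal (c i) * (p i - (\<Sum>b\<in>B. scal (a i b) * mono_at n b))
       + ((\<Sum>i\<in>J. scal (c i) * p i) - (\<Sum>b\<in>B. scal (\<Sum>i\<in>J. c i * a i b) * mono_at n b))"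
      using insert by (simp add: scal_simps distrib_right right_diff_distrib sum.distrib sum_distrib_left mult.assoc)
    show ?case unfolding e using insert a by (intro null_add[OF L] null_scal[OF L]) auto
  qed
  from this[OF I order_refl] have "(\<Sum>i\<in>I. scal (c i) * p i) \<in> null n (riesz n \<beta>)"
    using c(2) by (simp add: scal_simps)
  then show False using indep c(1) by blast
qed

definition interpolable :: "nat \<Rightarrow> (real \<times> real) set \<Rightarrow> bool" where
  "interpolable n S \<longleftrightarrow> (\<forall>y. \<exists>p\<in>bipolys n. \<forall>z\<in>S. bieval p (fst z) (snd z) = y z)"

lemma interpolable_dual:
  assumes "interpolable n S"
  obtains l where "\<And>z. l z \<in> bipolys n"
    "\<And>z z'. z' \<in> S \<Longrightarrow> bieval (l z) (fst z') (snd z') = (if z' = z then 1 else 0)"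
proof -
  have "\<forall>z. \<exists>p\<in>bipolys n. \<forall>z'\<in>S. bieval p (fst z') (snd z') = (if z' = z then 1 else 0)"
    using assms unfolding interpolable_def by (intro allI) (erule allE, assumption)
  then show ?thesis using that by metis
qed

lemma rank_eq_card:
  assumes S: "finite S" "interpolable n S"
    and null: "\<And>p. p \<in> bipolys n \<Longrightarrow>
      p \<in> null n (riesz n \<beta>) \<longleftrightarrow> (\<forall>z\<in>S. bieval p (fst z) (snd z) = 0)"
  shows "rank_M n \<beta> = card S"
proof (rule antisym)
  show "rank_M n \<beta> \<le> card S"
    by (rule rank_le[of S "\<lambda>z p. bieval p (fst z) (snd z)"]) (auto simp: S lin_bieval null)
  obtain l where l: "\<And>z. l z \<in> bipolys n"
    "\<And>z z'. z' \<in> S \<Longrightarrow> bieval (l z) (fst z') (snd z') = (if z' = z then 1 else 0)"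
    using interpolable_dual[OF S(2)] by blast
  show "card S \<le> rank_M n \<beta>"
  proof (rule rank_ge[of S l])
    fix c assume a: "(\<Sum>z\<in>S. scal (c z) * l z) \<in> null n (riesz n \<beta>)"
    then have "(\<Sum>z\<in>S. scal (c z) * l z) \<in> bipolys n" by (simp add: null_def)
    then have z0: "\<forall>z\<in>S. bieval (\<Sum>z\<in>S. scal (c z) * l z) (fst z) (snd z) = 0"
      using null a by blast
    have "bieval (\<Sum>z\<in>S. scal (c z) * l z) (fst z') (snd z') = c z'" if "z' \<in> S" for z'
    proof -
      have "bieval (\<Sum>z\<in>S. scal (c z) * l z) (fst z') (snd z') = (\<Sum>z\<in>S. if z = z' then c z' else 0)"
        unfolding bieval_sum using that l(2)[OF that] by (intro sum.cong) auto
      then show ?thesis using that S by simp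
    qed
    then show "\<forall>z\<in>S. c z = 0" using z0 by auto
  qed (use S l in auto)
qed

text \<open>A polynomial which vanishes at all the nodes without being null would form, together with the
  polynomials dual to the nodes, a family independent modulo null polynomials and larger than the
  rank.\<close>

lemma null_if_vanishes:
  assumes S: "finite S" "interpolable n S"
    and null: "\<And>p z. p \<in> null n (riesz n \<beta>) \<Longrightarrow> z \<in> S \<Longrightarrow> bieval p (fst z) (snd z) = 0"
    and rank: "rank_M n \<beta> \<le> card S"
    and p: "p \<in> bipolys n" "\<And>z. z \<in> S \<Longrightarrow> bieval p (fst z) (snd z) = 0"
  shows "p \<in> null n (riesz n \<beta>)"
proof (rule ccontr)
  assume np: "p \<notin> null n (riesz n \<beta>)"
  obtain l where l: "\<And>z. l z \<in> bipolys n"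
    "\<And>z z'. z' \<in> S \<Longrightarrow> bieval (l z) (fst z') (snd z') = (if z' = z then 1 else 0)"
    using interpolable_dual[OF S(2)] by blast
  define I where "I = insert None (Some ` S)"
  define q where "q i = (case i of None \<Rightarrow> p | Some z \<Rightarrow> l z)" for i
  have "card I \<le> rank_M n \<beta>"
  proof (rule rank_ge[of I q])
    fix c assume a: "(\<Sum>i\<in>I. scal (c i) * q i) \<in> null n (riesz n \<beta>)"
    have e: "(\<Sum>i\<in>I. scal (c i) * q i) = scal (c None) * p + (\<Sum>z\<in>S. scal (c (Some z)) * l z)"
      unfolding I_def using S(1) by (simp add: sum.reindex image_iff q_def)
    have cz: "c (Some z') = 0" if "z' \<in> S" for z'
    proof -
      have "bieval (\<Sum>z\<in>S. scal (c (Some z)) * l z) (fst z') (snd z') = (\<Sum>z\<in>S. if z = z' then c (Some z') else 0)"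
        unfolding bieval_sum using that l(2)[OF that] by (intro sum.cong) auto
      then have "bieval (\<Sum>i\<in>I. scal (c i) * q i) (fst z') (snd z') = c (Some z')"
        unfolding e using that S p(2)[OF that] by simp
      then show ?thesis using null[OF a that] by simp
    qed
    then have "scal (c None) * p \<in> null n (riesz n \<beta>)"
      using a unfolding e by (simp add: scal_simps)
    then have "scal (1 / c None) * (scal (c None) * p) \<in> null n (riesz n \<beta>)"
      by (rule null_scal[OF lin_riesz])
    then have "c None = 0"
      using np
      by (cases "c None = 0") (auto simp: mult.assoc[symmetric] scal_simps(2) scal_simps(4)[symmetric])
    then show "\<forall>i\<in>I. c i = 0" using cz by (auto simp: I_def)
  qed (use S l p in \<open>auto simp: I_def q_def\<close>)
  moreover have "card I = Suc (card S)"
    unfolding I_def using S by (simp add: card_image image_iff)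
  ultimately show False using rank by simp
qed



section \<open>Univariate quadrature\<close>

definition ulin :: "(real poly \<Rightarrow> real) \<Rightarrow> bool" where
  "ulin \<Lambda> \<longleftrightarrow> (\<forall>f g. \<Lambda> (f + g) = \<Lambda> f + \<Lambda> g) \<and> (\<forall>c f. \<Lambda> (Polynomial.smult c f) = c * \<Lambda> f)"

lemma ulinD: assumes "ulin \<Lambda>"
  shows "\<Lambda> (f + g) = \<Lambda> f + \<Lambda> g" "\<Lambda> (Polynomial.smult c f) = c * \<Lambda> f" "\<Lambda> 0 = 0" "\<Lambda> (f - g) = \<Lambda> f - \<Lambda> g"
proof -
  show A: "\<Lambda> (f + g) = \<Lambda> f + \<Lambda> g" "\<Lambda> (Polynomial.smult c f) = c * \<Lambda> f" for f g c
    using assms by (auto simp: ulin_def)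
  show "\<Lambda> 0 = 0" using A(2)[of 0 0] by simp
  have "\<Lambda> (f - g) = \<Lambda> (f + Polynomial.smult (-1) g)" by simp
  also have "\<dots> = \<Lambda> f - \<Lambda> g" unfolding A by simp
  finally show "\<Lambda> (f - g) = \<Lambda> f - \<Lambda> g" .
qed

lemma ulin_sum: "ulin \<Lambda> \<Longrightarrow> \<Lambda> (sum f A) = (\<Sum>a\<in>A. \<Lambda> (f a))"
  by (induction A rule: infinite_finite_induct) (simp_all add: ulinD)

lemma ulin_mult: "ulin \<Lambda> \<Longrightarrow> ulin (\<lambda>f. \<Lambda> (g * f))"
  by (simp add: ulin_def distrib_left)

definition root_poly :: "real set \<Rightarrow> real poly" where
  "root_poly Z = (\<Prod>z\<in>Z. [:-z, 1:])"

lemma root_poly_nz: "root_poly Z \<noteq> 0"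
  by (cases "finite Z") (auto simp: root_poly_def)

lemma degree_root_poly: "Polynomial.degree (root_poly Z) = card Z"
  unfolding root_poly_def
  by (cases "finite Z") (auto simp: degree_prod_eq_sum_degree)

lemma poly_root_poly: "finite Z \<Longrightarrow> poly (root_poly Z) x = 0 \<longleftrightarrow> x \<in> Z"
  by (auto simp: root_poly_def poly_prod)

lemma root_poly_dvd:
  assumes "finite Z" "\<And>z. z \<in> Z \<Longrightarrow> poly f z = 0"
  shows "root_poly Z dvd f"
  using assms
proof (induction Z arbitrary: f rule: finite_induct)
  case empty
  then show ?case by (simp add: root_poly_def)
next
  case (insert z Z)
  then obtain g where g: "f = [:-z, 1:] * g"
    using poly_eq_0_iff_dvd[of f z] by (auto elim: dvdE)
  have "root_poly Z dvd g"
    by (rule insert.IH) (use insert g in auto)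
  then show ?case
    using insert.hyps mult_dvd_mono[of "[:-z, 1:]" "[:-z, 1:]"] unfolding g root_poly_def by simp
qed

definition lagrange :: "real set \<Rightarrow> real \<Rightarrow> real poly" where
  "lagrange Z z = Polynomial.smult (1 / poly (root_poly (Z - {z})) z) (root_poly (Z - {z}))"

lemma poly_lagrange:
  assumes "finite Z" "x \<in> Z" "z \<in> Z"
  shows "poly (lagrange Z z) x = (if x = z then 1 else 0)"
  using assms poly_root_poly[of "Z - {z}"] by (auto simp: lagrange_def)

lemma degree_lagrange: "finite Z \<Longrightarrow> z \<in> Z \<Longrightarrow> Polynomial.degree (lagrange Z z) = card Z - 1"
  using poly_root_poly[of "Z - {z}" z] by (simp add: lagrange_def degree_root_poly)

lemma univariate_interpolation:
  fixes y :: "real \<Rightarrow> real"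
  assumes Z: "finite Z"
  obtains f where "Polynomial.degree f \<le> card Z - 1" "\<And>z. z \<in> Z \<Longrightarrow> poly f z = y z"
proof
  let ?f = "\<Sum>z\<in>Z. Polynomial.smult (y z) (lagrange Z z)"
  show "Polynomial.degree ?f \<le> card Z - 1"
    using Z by (intro degree_sum_le) (auto intro: order_trans[OF degree_smult_le] simp: degree_lagrange)
  show "poly ?f x = y x" if x: "x \<in> Z" for x
  proof -
    have "poly ?f x = (\<Sum>z\<in>Z. if z = x then y x else 0)"
      unfolding poly_sum using poly_lagrange[OF Z x] by (intro sum.cong) auto
    then show ?thesis using Z x by simp
  qed
qed

text \<open>
  Subtracting the Lagrange interpolant leaves a multiple of the root polynomial, which the
  functional annihilates. The weights may have any sign.
\<close>

lemma interpolatory_quadrature: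
  assumes L: "ulin \<Lambda>" and Z: "finite Z"
    and orth: "\<And>s. Polynomial.degree s + card Z \<le> D \<Longrightarrow> \<Lambda> (root_poly Z * s) = 0"
  obtains w where "\<And>f. Polynomial.degree f \<le> D \<Longrightarrow> \<Lambda> f = (\<Sum>z\<in>Z. w z * poly f z)"
proof
  fix f :: "real poly" assume f: "Polynomial.degree f \<le> D"
  let ?g = "\<Sum>z\<in>Z. Polynomial.smult (poly f z) (lagrange Z z)"
  have "poly (f - ?g) x = 0" if x: "x \<in> Z" for x
  proof -
    have "poly ?g x = (\<Sum>z\<in>Z. if z = x then poly f x else 0)"
      unfolding poly_sum using poly_lagrange[OF Z x] by (intro sum.cong) auto
    then show ?thesis using Z x by simp
  qed
  then obtain s where s: "f - ?g = root_poly Z * s"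
    by (rule dvdE[OF root_poly_dvd[OF Z]])
  have "\<Lambda> (root_poly Z * s) = 0"
  proof (cases "s = 0 \<or> Z = {}")
    case True
    then show ?thesis
    proof
      assume "Z = {}"
      then have "f = root_poly Z * s" "card Z = 0" using s by auto
      moreover have "f = s" using s \<open>Z = {}\<close> by (simp add: root_poly_def)
      ultimately show ?thesis using orth f by simp
    qed (simp add: ulinD[OF L])
  next
    case False
    have "card Z + Polynomial.degree s = Polynomial.degree (f - ?g)"
      unfolding s using False by (simp add: degree_mult_eq root_poly_nz degree_root_poly)
    also have "\<dots> \<le> max D (card Z - 1)"
    proof (rule order_trans[OF degree_diff_le_max], rule max.mono[OF f])
      show "Polynomial.degree ?g \<le> card Z - 1"
        using Z by (intro degree_sum_le) (auto intro: order_trans[OF degree_smult_le] simp: degree_lagrange)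
    qed
    finally have "Polynomial.degree s + card Z \<le> D"
      using False Z card_gt_0_iff[of Z] by (auto simp: max_def split: if_splits)
    then show ?thesis by (rule orth)
  qed
  then have "\<Lambda> f = \<Lambda> ?g"
    using ulinD(4)[OF L, of f ?g] s by simp
  then show "\<Lambda> f = (\<Sum>z\<in>Z. \<Lambda> (lagrange Z z) * poly f z)"
    by (simp add: ulin_sum[OF L] ulinD[OF L] mult.commute)
qed

text \<open>
  Orthogonality is known for products of a null polynomial and another factor, both of bounded
  degree. Since every monomial of degree at most \<open>a + b\<close> splits accordingly, it extends to all
  polynomials of that degree.
\<close>

lemma degree_le_mult_split:
  assumes L: "ulin \<Lambda>"
    and a: "\<And>s t. Polynomial.degree s \<le> a \<Longrightarrow> Polynomial.degree t \<le> b \<Longrightarrow> \<Lambda> (s * t) = 0"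
    and s: "Polynomial.degree s \<le> a + b"
  shows "\<Lambda> s = 0"
proof -
  have "\<Lambda> (Polynomial.monom 1 i) = 0" if "i \<le> a + b" for i
  proof -
    have "Polynomial.monom 1 i = Polynomial.monom (1::real) (min i a) * Polynomial.monom 1 (i - min i a)"
      by (simp add: mult_monom)
    then show ?thesis using a[of "Polynomial.monom 1 (min i a)" "Polynomial.monom 1 (i - min i a)"] that
      by (simp add: degree_monom_eq)
  qed
  then have "\<Lambda> (Polynomial.monom c i) = 0" if "i \<le> a + b" for i c
    using ulinD(2)[OF L, of c "Polynomial.monom 1 i"] that by (simp add: smult_monom)
  then have "\<Lambda> (\<Sum>i\<le>Polynomial.degree s. Polynomial.monom (Polynomial.coeff s i) i) = 0"
    unfolding ulin_sum[OF L] using s by (intro sum.neutral) auto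
  then show ?thesis by (simp add: poly_as_sum_of_monoms)
qed

lemma of_real_poly_add:
  "map_poly complex_of_real (p + q) = map_poly complex_of_real p + map_poly complex_of_real q"
  by (rule poly_eqI) (simp add: coeff_map_poly)

lemma of_real_poly_mult:
  "map_poly complex_of_real (p * q) = map_poly complex_of_real p * map_poly complex_of_real q"
  by (rule poly_eqI) (simp add: coeff_map_poly coeff_mult)

lemma poly_of_real: "poly (map_poly complex_of_real p) (of_real x) = of_real (poly p x)"
  by (induction p) (simp_all add: map_poly_pCons)

text \<open>
  The remainder modulo the real quadratic with roots \<open>z\<close> and its conjugate has degree at most 1
  and real coefficients, so it can vanish at the nonreal number \<open>z\<close> only if it is zero.
\<close>

lemma conjugate_quadratic_dvd:
  fixes h :: "real poly"
  assumes "poly (map_poly complex_of_real h) z = 0" "Im z \<noteq> 0"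
  obtains k where "h = [:(Re z)\<^sup>2 + (Im z)\<^sup>2, - 2 * Re z, 1:] * k"
proof -
  let ?q = "[:(Re z)\<^sup>2 + (Im z)\<^sup>2, - 2 * Re z, 1:]"
  define r where "r = h mod ?q"
  have "Polynomial.degree r < 2 \<or> r = 0"
    using degree_mod_less[of ?q h] by (auto simp: r_def)
  then have r: "r = [:Polynomial.coeff r 0, Polynomial.coeff r 1:]"
    by (auto simp: poly_eq_iff coeff_pCons coeff_eq_0 split: nat.splits)
  have e: "poly (map_poly complex_of_real h) z =
     poly (map_poly complex_of_real (h div ?q)) z * poly (map_poly complex_of_real ?q) z
     + poly (map_poly complex_of_real r) z"
    using div_mult_mod_eq[of h ?q]
    by (metis r_def of_real_poly_add of_real_poly_mult poly_add poly_mult)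
  have "poly (map_poly complex_of_real ?q) z = 0"
    by (simp add: map_poly_pCons complex_eq_iff power2_eq_square algebra_simps)
  then have z: "poly (map_poly complex_of_real r) z = 0" using e assms by simp
  have "poly (map_poly complex_of_real r) z = of_real (Polynomial.coeff r 0) + z * of_real (Polynomial.coeff r 1)"
    by (subst r) (simp add: map_poly_pCons)
  then have "Polynomial.coeff r 1 = 0" "Polynomial.coeff r 0 = 0"
    using z assms by (auto simp: complex_eq_iff)
  then have "r = 0" using r by simp
  then show ?thesis using that[of "h div ?q"] div_mult_mod_eq[of h ?q] by (simp add: r_def mult.commute)
qed

text \<open>
  The excluded factor \<open>(x - a)\<^sup>2 + b\<^sup>2\<close> stands for a pair of conjugate roots if \<open>b \<noteq> 0\<close> and for
  a double root if \<open>b = 0\<close>. Both are excluded at once in the applications, by positivity of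
  \<open>((x - a) k)\<^sup>2 + b\<^sup>2 k\<^sup>2\<close>.
\<close>

lemma simple_real_roots:
  fixes h :: "real poly"
  assumes "h \<noteq> 0" and "\<And>a b k. h \<noteq> [:a\<^sup>2 + b\<^sup>2, - 2 * a, 1:] * k"
  shows "card {x. poly h x = 0} = Polynomial.degree h"
  using assms
proof (induction "Polynomial.degree h" arbitrary: h)
  case 0
  then obtain c where "h = [:c:]" "c \<noteq> 0" by (metis degree_eq_zeroE pCons_0_0)
  then show ?case by simp
next
  case (Suc d)
  have "Polynomial.degree (map_poly complex_of_real h) = Suc d"
    using Suc(2) by (simp add: degree_map_poly)
  then have "\<not> constant (poly (map_poly complex_of_real h))"
    by (simp add: constant_degree)
  then obtain z where z: "poly (map_poly complex_of_real h) z = 0"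
    using fundamental_theorem_of_algebra by blast
  have "Im z = 0"
    using conjugate_quadratic_dvd[OF z] Suc.prems(2) by metis
  then have "z = of_real (Re z)" by (simp add: complex_eq_iff)
  then have "poly h (Re z) = 0" using z by (metis of_real_eq_0_iff poly_of_real)
  then obtain k where k: "h = [:- Re z, 1:] * k"
    using poly_eq_0_iff_dvd[of h "Re z"] by (auto elim: dvdE)
  have k0: "k \<noteq> 0" using k Suc.prems by auto
  have "poly k (Re z) \<noteq> 0"
  proof
    assume "poly k (Re z) = 0"
    then obtain l where "k = [:- Re z, 1:] * l"
      using poly_eq_0_iff_dvd[of k "Re z"] by (auto elim: dvdE)
    then have "h = [:(Re z)\<^sup>2 + 0\<^sup>2, - 2 * Re z, 1:] * l"
    proof -
      have "[:(Re z)\<^sup>2 + 0\<^sup>2, - 2 * Re z, 1:] = [:- Re z, 1:] * [:- Re z, 1:]"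
        by (simp add: power2_eq_square)
      then show ?thesis unfolding k \<open>k = [:- Re z, 1:] * l\<close> by (simp only: mult.assoc)
    qed
    then show False using Suc.prems(2) by blast
  qed
  moreover have "{x. poly h x = 0} = insert (Re z) {x. poly k x = 0}"
    unfolding k by auto
  moreover have "card {x. poly k x = 0} = Polynomial.degree k"
  proof (rule Suc.hyps(1))
    have "Polynomial.degree h = Suc (Polynomial.degree k)"
      unfolding k using k0 by (subst degree_mult_eq) auto
    then show "d = Polynomial.degree k" using Suc(2) by simp
    show "k \<noteq> [:a\<^sup>2 + b\<^sup>2, - 2 * a, 1:] * l" for a b l
    proof
      assume "k = [:a\<^sup>2 + b\<^sup>2, - 2 * a, 1:] * l"
      then have "h = [:a\<^sup>2 + b\<^sup>2, - 2 * a, 1:] * ([:- Re z, 1:] * l)"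
        unfolding k by (simp only: mult.left_commute)
      then show False using Suc.prems(2) by blast
    qed
  qed (rule k0)
  moreover have "Polynomial.degree h = Suc (Polynomial.degree k)"
    unfolding k using k0 by (subst degree_mult_eq) auto
  ultimately show ?case using poly_roots_finite[OF k0] by simp
qed

lemma root_poly_of_simple_roots:
  fixes h :: "real poly"
  assumes "h \<noteq> 0" "card {x. poly h x = 0} = Polynomial.degree h"
  shows "h = Polynomial.smult (lead_coeff h) (root_poly {x. poly h x = 0})"
proof -
  define Z where "Z = {x. poly h x = 0}"
  have Z: "finite Z" "\<And>z. z \<in> Z \<Longrightarrow> poly h z = 0" "card Z = Polynomial.degree h"
    using poly_roots_finite[OF assms(1)] assms(2) by (auto simp: Z_def)
  obtain k where k: "h = root_poly Z * k"
    by (rule dvdE[OF root_poly_dvd[OF Z(1,2)]])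
  then have "k \<noteq> 0" using assms(1) by auto
  then have "Polynomial.degree h = card Z + Polynomial.degree k"
    unfolding k by (simp add: degree_mult_eq root_poly_nz degree_root_poly)
  then obtain c where c: "k = [:c:]" using Z(3) degree_eq_zeroE by auto
  have "lead_coeff (root_poly Z) = 1"
    by (simp add: root_poly_def lead_coeff_prod)
  moreover have "lead_coeff h = lead_coeff (root_poly Z) * lead_coeff k"
    unfolding k by (rule lead_coeff_mult)
  ultimately have lc: "lead_coeff h = c" using c by simp
  have "h = Polynomial.smult c (root_poly Z)" unfolding k c by simp
  then have "h = Polynomial.smult (lead_coeff h) (root_poly Z)" unfolding lc .
  then show ?thesis unfolding Z_def .
qed

lemma quadratic_factor_form:
  fixes k :: "real poly"
  shows "([:a\<^sup>2 + b\<^sup>2, - 2 * a, 1:] * k) * k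
     = ([:-a, 1:] * k) * ([:-a, 1:] * k) + Polynomial.smult (b\<^sup>2) (k * k)"
proof -
  have "[:a\<^sup>2 + b\<^sup>2, - 2 * a, 1:] = [:-a, 1:] * [:-a, 1:] + [:b\<^sup>2:]"
    by (simp add: power2_eq_square)
  moreover have "((A * A + B) * k) * k = (A * k) * (A * k) + B * (k * k)" for A B :: "real poly"
    by (simp add: algebra_simps)
  ultimately show ?thesis by (simp only:) simp
qed

text \<open>
  Induction on the degree by a Gram-Schmidt step: \<open>q\<close> is the monomial of degree \<open>m + 1\<close> made
  orthogonal to all polynomials of degree at most \<open>m\<close>, and a multiple of \<open>q\<close> corrects the
  representing polynomial.
\<close>

lemma riesz_representation:
  assumes L: "ulin \<Lambda>" and P: "ulin \<phi>"
    and pos: "\<And>f. f \<noteq> 0 \<Longrightarrow> Polynomial.degree f \<le> m \<Longrightarrow> \<Lambda> (f * f) > 0"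
  shows "\<exists>f. Polynomial.degree f \<le> m \<and> (\<forall>s. Polynomial.degree s \<le> m \<longrightarrow> \<Lambda> (f * s) = \<phi> s)"
  using P pos
proof (induction m arbitrary: \<phi>)
  case 0
  have p: "\<Lambda> 1 > 0" using 0(2)[of 1] by simp
  show ?case
  proof (intro exI[of _ "[:\<phi> 1 / \<Lambda> 1:]"] conjI allI impI)
    fix s :: "real poly" assume "Polynomial.degree s \<le> 0"
    then obtain a where s: "s = Polynomial.smult a 1" by (metis degree_eq_zeroE le_zero_eq smult_one)
    have "[:\<phi> 1 / \<Lambda> 1:] * s = Polynomial.smult (\<phi> 1 / \<Lambda> 1 * a) 1" by (simp add: s)
    then show "\<Lambda> ([:\<phi> 1 / \<Lambda> 1:] * s) = \<phi> s"
      using p unfolding s by (simp only: ulinD(2)[OF L] ulinD(2)[OF 0(1)]) simp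
  qed simp
next
  case (Suc m)
  have pos: "\<And>f. f \<noteq> 0 \<Longrightarrow> Polynomial.degree f \<le> m \<Longrightarrow> \<Lambda> (f * f) > 0"
    using Suc.prems(2) by simp
  obtain f0 where f0: "Polynomial.degree f0 \<le> m"
     "\<And>s. Polynomial.degree s \<le> m \<Longrightarrow> \<Lambda> (f0 * s) = \<Lambda> (Polynomial.monom 1 (Suc m) * s)"
    using Suc.IH[OF ulin_mult[OF L, of "Polynomial.monom 1 (Suc m)"] pos] by blast
  define q where "q = Polynomial.monom 1 (Suc m) - f0"
  have q_deg: "Polynomial.degree q \<le> Suc m"
    unfolding q_def using f0(1) by (intro degree_diff_le) (auto simp: degree_monom_eq)
  have q_coeff: "Polynomial.coeff q (Suc m) = 1"
    using f0(1) by (simp add: q_def coeff_eq_0)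
  have q_orth: "\<Lambda> (q * s) = 0" if "Polynomial.degree s \<le> m" for s
    using f0(2)[OF that] by (simp add: q_def left_diff_distrib ulinD[OF L])
  have "q \<noteq> 0" using q_coeff by auto
  then have qpos: "\<Lambda> (q * q) > 0" using Suc.prems(2)[of q] q_deg by blast
  obtain f1 where f1: "Polynomial.degree f1 \<le> m"
     "\<And>s. Polynomial.degree s \<le> m \<Longrightarrow> \<Lambda> (f1 * s) = \<phi> s"
    using Suc.IH[OF Suc.prems(1) pos] by blast
  define c where "c = \<phi> q / \<Lambda> (q * q)"
  show ?case
  proof (intro exI[of _ "f1 + Polynomial.smult c q"] conjI allI impI)
    show "Polynomial.degree (f1 + Polynomial.smult c q) \<le> Suc m"
      using f1(1) q_deg by (intro degree_add_le) (auto intro: order_trans[OF degree_smult_le])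
    fix s :: "real poly" assume s: "Polynomial.degree s \<le> Suc m"
    define a where "a = Polynomial.coeff s (Suc m)"
    define t where "t = s - Polynomial.smult a q"
    have "Polynomial.degree t \<le> Suc m"
      unfolding t_def using s q_deg by (intro degree_diff_le) (auto intro: order_trans[OF degree_smult_le])
    moreover have "Polynomial.coeff t (Suc m) = 0" by (simp add: t_def a_def q_coeff)
    ultimately have t: "Polynomial.degree t \<le> m"
      by (metis degree_0 le_SucE leading_coeff_0_iff zero_le)
    have st: "s = t + Polynomial.smult a q" by (simp add: t_def)
    have "(f1 + Polynomial.smult c q) * s = f1 * t + (Polynomial.smult a (q * f1)
        + (Polynomial.smult c (q * t) + Polynomial.smult (a * c) (q * q)))"
      unfolding st by (simp add: algebra_simps)
    then have "\<Lambda> ((f1 + Polynomial.smult c q) * s) = \<phi> t + a * c * \<Lambda> (q * q)"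
      by (simp add: ulinD[OF L] f1 q_orth t)
    also have "\<dots> = \<phi> s"
      using qpos unfolding st by (simp add: ulinD[OF Suc.prems(1)] c_def)
    finally show "\<Lambda> ((f1 + Polynomial.smult c q) * s) = \<phi> s" .
  qed
qed

text \<open>
  Gauss quadrature: the nodes are the roots of the monic polynomial of degree \<open>m + 1\<close> orthogonal
  to all polynomials of degree at most \<open>m\<close>. This polynomial depends on the moment of order
  \<open>2m + 1\<close>, which can be prescribed freely; a suitable change \<open>\<sigma>\<close> of that moment keeps 0 from
  being a root.
\<close>

lemma positive_quadrature:
  assumes L: "ulin \<Lambda>"
    and pos: "\<And>f. f \<noteq> 0 \<Longrightarrow> Polynomial.degree f \<le> m \<Longrightarrow> \<Lambda> (f * f) > 0"
  obtains S w where "finite S" "card S = Suc m" "0 \<notin> S" "\<And>z. z \<in> S \<Longrightarrow> w z > 0"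
    "\<And>f. Polynomial.degree f \<le> 2 * m \<Longrightarrow> \<Lambda> f = (\<Sum>z\<in>S. w z * poly f z)"
proof -
  define \<Lambda>' where "\<Lambda>' \<sigma> f = \<Lambda> f + \<sigma> * Polynomial.coeff f (2 * m + 1)" for \<sigma> f
  have L': "ulin (\<Lambda>' \<sigma>)" for \<sigma>
    by (auto simp: ulin_def \<Lambda>'_def ulinD[OF L] algebra_simps)
  have same: "\<Lambda>' \<sigma> f = \<Lambda> f" if "Polynomial.degree f \<le> 2 * m" for \<sigma> f
    using that by (simp add: \<Lambda>'_def coeff_eq_0)
  have pos': "\<Lambda>' \<sigma> (f * f) > 0" if "f \<noteq> 0" "Polynomial.degree f \<le> m" for \<sigma> f
    using pos[OF that] that by (subst same) (auto simp: degree_mult_eq)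
  have "\<exists>p. Polynomial.degree p = Suc m \<and> lead_coeff p = 1 \<and> (\<forall>s. Polynomial.degree s \<le> m \<longrightarrow> \<Lambda>' \<sigma> (p * s) = 0)" for \<sigma>
  proof -
    obtain f where f: "Polynomial.degree f \<le> m"
      "\<And>s. Polynomial.degree s \<le> m \<Longrightarrow> \<Lambda>' \<sigma> (f * s) = \<Lambda>' \<sigma> (Polynomial.monom 1 (Suc m) * s)"
      using riesz_representation[OF L' ulin_mult[OF L', of \<sigma> "Polynomial.monom 1 (Suc m)"] pos'] by blast
    let ?p = "Polynomial.monom 1 (Suc m) - f"
    have c: "Polynomial.coeff ?p (Suc m) = 1" using f(1) by (simp add: coeff_eq_0)
    have "Polynomial.degree ?p \<le> Suc m"
      using f(1) by (intro degree_diff_le) (auto simp: degree_monom_eq)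
    moreover have "Suc m \<le> Polynomial.degree ?p" using c by (intro le_degree) simp
    ultimately have "Polynomial.degree ?p = Suc m" by simp
    then show ?thesis using c f(2)
      by (intro exI[of _ ?p]) (simp add: left_diff_distrib ulinD[OF L'])
  qed
  then obtain p where p: "\<And>\<sigma>. Polynomial.degree (p \<sigma>) = Suc m" "\<And>\<sigma>. lead_coeff (p \<sigma>) = 1"
     "\<And>\<sigma> s. Polynomial.degree s \<le> m \<Longrightarrow> \<Lambda>' \<sigma> (p \<sigma> * s) = 0" by metis
  \<comment> \<open>if \<open>p 0 = x e\<close> and \<open>p 1 - p 0 = x k\<close>, then \<open>x e k\<close> gives \<open>\<Lambda> (p 0 * k) = 0\<close> by orthogonality of \<open>p 0\<close>,
      but \<open>\<Lambda> ((p 1 - p 0) * e) = -1\<close> because \<open>e\<close> is monic of degree \<open>m\<close>\<close>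
  have "poly (p 0) 0 \<noteq> 0 \<or> poly (p 1) 0 \<noteq> 0"
  proof (rule ccontr)
    assume "\<not> ?thesis"
    then have 0: "poly (p 0) 0 = 0" "poly (p 1) 0 = 0" by auto
    obtain e where e: "p 0 = [:0, 1:] * e" using 0(1) poly_eq_0_iff_dvd[of "p 0" 0] by (auto elim: dvdE)
    define d where "d = p 1 - p 0"
    have "poly d 0 = 0" using 0 by (simp add: d_def)
    then obtain k where k: "d = [:0, 1:] * k" using poly_eq_0_iff_dvd[of d 0] by (auto elim: dvdE)
    have p1: "Polynomial.coeff (p 1 * s) (2 * m + 1) = Polynomial.coeff s m" if s: "Polynomial.degree s \<le> m" for s
    proof -
      have "Polynomial.coeff (p 1 * s) (2 * m + 1) = (\<Sum>i\<le>2 * m + 1. if i = Suc m then Polynomial.coeff s m else 0)"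
        unfolding coeff_mult
      proof (rule sum.cong)
        fix i assume "i \<in> {..2 * m + 1}"
        show "Polynomial.coeff (p 1) i * Polynomial.coeff s (2 * m + 1 - i) = (if i = Suc m then Polynomial.coeff s m else 0)"
        proof (cases i "Suc m" rule: linorder_cases)
          case less
          then have "Polynomial.degree s < 2 * m + 1 - i" using s by simp
          then show ?thesis using less by (simp add: coeff_eq_0)
        next
          case equal
          have "2 * m + 1 - i = m" using equal by simp
          then show ?thesis using equal p(1,2)[of 1] by simp
        next
          case greater
          then show ?thesis using p(1)[of 1] by (simp add: coeff_eq_0)
        qed
      qed simp
      also have "\<dots> = Polynomial.coeff s m" by simp
      finally show ?thesis .
    qed
    have p0: "\<Lambda> (p 0 * s) = 0" if "Polynomial.degree s \<le> m" for s
      using p(3)[OF that, of 0] by (simp add: \<Lambda>'_def)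
    have ds: "\<Lambda> (d * s) = - Polynomial.coeff s m" if "Polynomial.degree s \<le> m" for s
      using p(3)[OF that, of 1] p0[OF that] p1[OF that]
      by (simp add: \<Lambda>'_def d_def left_diff_distrib ulinD[OF L])
    have e0: "e \<noteq> 0" using e p(1)[of 0] by auto
    have e_deg: "Polynomial.degree e = m"
      using p(1)[of 0] e0 unfolding e by (subst (asm) degree_mult_eq) auto
    have "lead_coeff e = 1" using p(2)[of 0] unfolding e lead_coeff_mult by simp
    then have e_coeff: "Polynomial.coeff e m = 1" using e_deg by simp
    have k_deg: "Polynomial.degree k \<le> m"
    proof (cases "k = 0")
      case False
      have "Suc (Polynomial.degree k) = Polynomial.degree d"
        unfolding k using False by (subst degree_mult_eq) auto
      also have "\<dots> \<le> Suc m" unfolding d_def using p(1) by (intro degree_diff_le) simp_all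
      finally show ?thesis by simp
    qed simp
    have "d * e = p 0 * k" unfolding k e by (simp only: mult_ac)
    then show False using ds[of e] p0[of k] e_deg e_coeff k_deg by simp
  qed
  then obtain \<sigma> where \<sigma>: "poly (p \<sigma>) 0 \<noteq> 0" by blast
  let ?S = "{x. poly (p \<sigma>) x = 0}"
  have pn: "p \<sigma> \<noteq> 0" using p(1)[of \<sigma>] by auto
  have card: "card ?S = Polynomial.degree (p \<sigma>)"
  proof (rule simple_real_roots[OF pn])
    fix a b :: real and k
    show "p \<sigma> \<noteq> [:a\<^sup>2 + b\<^sup>2, - 2 * a, 1:] * k"
    proof
      assume e: "p \<sigma> = [:a\<^sup>2 + b\<^sup>2, - 2 * a, 1:] * k"
      have k0: "k \<noteq> 0" using e pn by auto
      have d: "Suc m = 2 + Polynomial.degree k"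
        using p(1)[of \<sigma>] k0 unfolding e by (subst (asm) degree_mult_eq) auto
      have d1: "Polynomial.degree ([:-a, 1:] * k) \<le> m"
        using k0 d by (subst degree_mult_eq) auto
      have "[:-a, 1:] * k \<noteq> 0" using k0 by (metis mult_eq_0_iff one_neq_zero pCons_eq_0_iff)
      then have "0 < \<Lambda>' \<sigma> (([:-a, 1:] * k) * ([:-a, 1:] * k)) + b\<^sup>2 * \<Lambda>' \<sigma> (k * k)"
        using pos'[of "[:-a, 1:] * k" \<sigma>] pos'[OF k0, of \<sigma>] d d1
        by (intro add_pos_nonneg mult_nonneg_nonneg) auto
      also have "\<dots> = \<Lambda>' \<sigma> (p \<sigma> * k)"
        unfolding e quadratic_factor_form by (simp only: ulinD[OF L'])
      also have "\<dots> = 0" using d by (intro p(3)) simp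
      finally show False by simp
    qed
  qed
  have fin: "finite ?S" using poly_roots_finite[OF pn] .
  have rp: "root_poly ?S = p \<sigma>"
    using root_poly_of_simple_roots[OF pn card] p(2)[of \<sigma>] by simp
  have orth: "\<Lambda>' \<sigma> (root_poly ?S * s) = 0" if "Polynomial.degree s + card ?S \<le> 2 * m + 1" for s
    unfolding rp using that card p(1)[of \<sigma>] by (intro p(3)) simp
  obtain w where w: "\<And>f. Polynomial.degree f \<le> 2 * m + 1 \<Longrightarrow> \<Lambda>' \<sigma> f = (\<Sum>z\<in>?S. w z * poly f z)"
    by (rule interpolatory_quadrature[OF L' fin orth]) blast+
  have wpos: "w z > 0" if z: "z \<in> ?S" for z
  proof -
    let ?l = "lagrange ?S z"
    have d: "Polynomial.degree ?l \<le> m" using degree_lagrange[OF fin z] card p(1)[of \<sigma>] by simp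
    have "?l \<noteq> 0" using poly_lagrange[OF fin z z] by auto
    then have "0 < \<Lambda>' \<sigma> (?l * ?l)" using pos' d by blast
    also have "\<dots> = (\<Sum>x\<in>?S. w x * poly (?l * ?l) x)"
      using d by (intro w) (auto intro: order_trans[OF degree_mult_le])
    also have "\<dots> = (\<Sum>x\<in>?S. if x = z then w z else 0)"
      using poly_lagrange[OF fin _ z] by (intro sum.cong) auto
    also have "\<dots> = w z" using fin z by simp
    finally show ?thesis .
  qed
  show ?thesis
  proof (rule that[of ?S w])
    show "\<Lambda> f = (\<Sum>z\<in>?S. w z * poly f z)" if "Polynomial.degree f \<le> 2 * m" for f
      using w[of f] same[OF that, of \<sigma>] that by simp
  qed (use fin card p(1) \<sigma> wpos in auto)
qed



section \<open>Affine coordinates adapted to a hyperbola\<close>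

text \<open>
  The coordinates \<open>u\<close>, \<open>v\<close> of a point are the values of the two linear polynomials \<open>U\<close>, \<open>V\<close>; the
  coefficients \<open>a1, \<dots>, b3\<close> describe the inverse affine map.
\<close>

locale plane_coords =
  fixes U V :: bipoly and a1 a2 a3 b1 b2 b3 :: real
  assumes U_deg: "U \<in> bipolys 1" and V_deg: "V \<in> bipolys 1"
    and X_eq: "mono2 0 1 = scal a1 * U + scal a2 * V + scal a3"
    and Y_eq: "mono2 1 0 = scal b1 * U + scal b2 * V + scal b3"
    and U_eval: "\<And>u v. bieval U (a1 * u + a2 * v + a3) (b1 * u + b2 * v + b3) = u"
    and V_eval: "\<And>u v. bieval V (a1 * u + a2 * v + a3) (b1 * u + b2 * v + b3) = v"
begin

definition pt :: "real \<Rightarrow> real \<Rightarrow> real \<times> real" where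
  "pt u v = (a1 * u + a2 * v + a3, b1 * u + b2 * v + b3)"

definition ev :: "bipoly \<Rightarrow> real \<Rightarrow> real \<Rightarrow> real" where
  "ev p u v = bieval p (fst (pt u v)) (snd (pt u v))"

lemma ev_simps [simp]:
  "ev (p + q) u v = ev p u v + ev q u v"
  "ev (p - q) u v = ev p u v - ev q u v"
  "ev (p * q) u v = ev p u v * ev q u v"
  "ev (p ^ k) u v = ev p u v ^ k"
  "ev (scal a) u v = a"
  "ev U u v = u" "ev V u v = v"
  by (simp_all add: ev_def pt_def U_eval V_eval)

lemma ev_sum: "ev (sum f A) u v = (\<Sum>a\<in>A. ev (f a) u v)"
  by (simp add: ev_def bieval_sum)

lemma pt_surj: "z = pt (bieval U (fst z) (snd z)) (bieval V (fst z) (snd z))"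
proof -
  have "fst z = bieval (mono2 0 1) (fst z) (snd z)" "snd z = bieval (mono2 1 0) (fst z) (snd z)"
    by simp_all
  then show ?thesis unfolding X_eq Y_eq by (simp add: pt_def prod_eq_iff)
qed

lemma pt_inject [simp]: "pt u v = pt u' v' \<longleftrightarrow> u = u' \<and> v = v'"
  by (metis ev_def ev_simps(6,7))

text \<open>
  The degree filtration does not depend on the affine coordinates. As an inductive set, the span
  of the monomials in \<open>U\<close> and \<open>V\<close> yields the induction rule \<open>coord_induct\<close>, by which identities
  between linear forms are checked on these monomials.
\<close>

inductive_set uv_span :: "nat \<Rightarrow> bipoly set" for m where
  mono: "i + j \<le> m \<Longrightarrow> U ^ i * V ^ j \<in> uv_span m"
| add: "p \<in> uv_span m \<Longrightarrow> q \<in> uv_span m \<Longrightarrow> p + q \<in> uv_span m"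
| scal: "p \<in> uv_span m \<Longrightarrow> scal a * p \<in> uv_span m"

lemma uv_span_mono: "p \<in> uv_span m \<Longrightarrow> m \<le> m' \<Longrightarrow> p \<in> uv_span m'"
  by (induction rule: uv_span.induct) (auto intro: uv_span.intros)

lemma uv_span_mult_UV: "p \<in> uv_span m \<Longrightarrow> U * p \<in> uv_span (Suc m) \<and> V * p \<in> uv_span (Suc m)"
proof (induction rule: uv_span.induct)
  case (mono i j)
  have "U * (U ^ i * V ^ j) = U ^ Suc i * V ^ j" "V * (U ^ i * V ^ j) = U ^ i * V ^ Suc j"
    by (simp_all only: power_Suc mult_ac)
  then show ?case using mono by (auto simp only: intro!: uv_span.mono)
next
  case (add p q)
  then show ?case by (auto simp: distrib_left intro: uv_span.add)
next
  case (scal p a)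
  then show ?case by (auto simp: mult.left_commute[of _ "scal a"] intro: uv_span.scal)
qed

lemma uv_span_mult_XY:
  assumes "p \<in> uv_span m" shows "mono2 0 1 * p \<in> uv_span (Suc m)" "mono2 1 0 * p \<in> uv_span (Suc m)"
  unfolding X_eq Y_eq distrib_right mult.assoc
  using uv_span_mult_UV[OF assms] uv_span_mono[OF assms, of "Suc m"]
  by (auto intro!: uv_span.add uv_span.scal)

lemma mono2_uv_span: "mono2 i j \<in> uv_span (i + j)"
proof (induction j)
  case 0
  show ?case
  proof (induction i)
    case 0
    then show ?case using uv_span.mono[of 0 0 0] by (simp add: mono2_00)
  next
    case (Suc i)
    then show ?case using uv_span_mult_XY(2)[of "mono2 i 0" i] by (simp add: mono2_mult)
  qed
next
  case (Suc j)
  then show ?case using uv_span_mult_XY(1)[of "mono2 i j" "i + j"] by (simp add: mono2_mult)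
qed

lemma uv_span_sum: "(\<And>a. a \<in> A \<Longrightarrow> f a \<in> uv_span m) \<Longrightarrow> sum f A \<in> uv_span m"
  using uv_span.scal[OF uv_span.mono[of 0 0 m], of 0]
  by (induction A rule: infinite_finite_induct) (auto intro: uv_span.add simp: scal_simps)

lemma bipolys_uv_span: "p \<in> bipolys m \<Longrightarrow> p \<in> uv_span m"
  by (subst bipolys_expand[of p m]) (auto intro!: uv_span_sum uv_span.scal uv_span_mono[OF mono2_uv_span])

lemma coord_induct [consumes 1, case_names mono add scal]:
  assumes "q \<in> bipolys m"
    and "\<And>i j. i + j \<le> m \<Longrightarrow> P (U ^ i * V ^ j)"
    and "\<And>p q. P p \<Longrightarrow> P q \<Longrightarrow> P (p + q)"
    and "\<And>p a. P p \<Longrightarrow> P (scal a * p)"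
  shows "P q"
  using bipolys_uv_span[OF assms(1)] by (induction rule: uv_span.induct) (use assms in auto)

lemma UV_bipolys: "i + j \<le> m \<Longrightarrow> U ^ i * V ^ j \<in> bipolys m"
  using bipolys_mult[OF bipolys_power[OF U_deg, of i] bipolys_power[OF V_deg, of j]]
  by (auto intro: bipolys_mono)

lemma U_bipolys: "i \<le> m \<Longrightarrow> U ^ i \<in> bipolys m"
  using UV_bipolys[of i 0 m] by simp

lemma V_bipolys: "j \<le> m \<Longrightarrow> V ^ j \<in> bipolys m"
  using UV_bipolys[of 0 j m] by simp

end

locale hyperbolic_moments = plane_coords +
  fixes c :: real and n :: nat and \<beta> :: "nat \<Rightarrow> nat \<Rightarrow> real"
  assumes n: "n \<ge> 2"
    and pos: "\<And>p. p \<in> bipolys n \<Longrightarrow> riesz n \<beta> (p * p) \<ge> 0"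
    and rg: "\<And>p q. p \<in> null n (riesz n \<beta>) \<Longrightarrow> q \<in> bipolys n \<Longrightarrow> p * q \<in> bipolys n \<Longrightarrow>
      p * q \<in> null n (riesz n \<beta>)"
    and Q_null: "U * V - scal c \<in> null n (riesz n \<beta>)"
begin

abbreviation "L \<equiv> riesz n \<beta>"
abbreviation "N \<equiv> null n L"

text \<open>
  The variety of the moment matrix, described through the null polynomials (see \<open>variety_eq\<close>).
\<close>

definition var :: "(real \<times> real) set" where
  "var = {z. \<forall>p\<in>N. bieval p (fst z) (snd z) = 0}"

definition curve :: "(real \<times> real) set" where
  "curve = {z. bieval (U * V - scal c) (fst z) (snd z) = 0}"

lemmas L = lin_riesz[of n \<beta>]

lemma N_iff: "p \<in> bipolys n \<Longrightarrow> p \<in> N \<longleftrightarrow> L (p * p) = 0"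
  by (rule null_iff_square[OF L pos])

lemma N_sub: "p \<in> N \<Longrightarrow> p \<in> bipolys n"
  by (simp add: null_def)

lemma N_orth: "p \<in> N \<Longrightarrow> q \<in> bipolys n \<Longrightarrow> L (q * p) = 0"
  by (simp add: null_def)

lemma pt_curve: "pt u v \<in> curve \<longleftrightarrow> u * v = c"
proof -
  have "pt u v \<in> curve \<longleftrightarrow> ev (U * V - scal c) u v = 0" by (simp only: curve_def mem_Collect_eq ev_def)
  then show ?thesis by simp
qed

lemma var_curve: "var \<subseteq> curve"
  using Q_null by (auto simp: var_def curve_def)

lemma pt_var: "pt u v \<in> var \<longleftrightarrow> (\<forall>p\<in>N. ev p u v = 0)"
  by (simp add: var_def ev_def)

text \<open>
  On the curve \<open>U V = c\<close>. The polynomial \<open>Q U\<^sup>i V\<^sup>j\<close> may have degree up to \<open>2n\<close>, whereas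
  recursive generation reaches degree \<open>n\<close> only; the remaining factors are moved to the other
  argument of the bilinear form.
\<close>

lemma L_reduce:
  assumes "i + j + 2 \<le> 2 * n"
  shows "L (U ^ Suc i * V ^ Suc j) = c * L (U ^ i * V ^ j)"
proof -
  define a where "a = min i (n - 2)"
  define b where "b = min j (n - 2 - a)"
  have ab: "a \<le> i" "b \<le> j" "a + b + 2 \<le> n" "(i - a) + (j - b) \<le> n"
    using assms n by (auto simp: a_def b_def min_def)
  let ?Q = "U * V - scal c"
  have "?Q \<in> bipolys 2"
    using UV_bipolys[of 1 1 2] by (intro bipolys_diff bipolys_scal0) simp
  then have "?Q * (U ^ a * V ^ b) \<in> bipolys (2 + (a + b))"
    by (rule bipolys_mult) (simp add: UV_bipolys)
  then have "?Q * (U ^ a * V ^ b) \<in> N"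
    using ab by (intro rg Q_null UV_bipolys) (auto intro: bipolys_mono)
  then have "L ((U ^ (i - a) * V ^ (j - b)) * (?Q * (U ^ a * V ^ b))) = 0"
    using ab by (intro N_orth UV_bipolys)
  moreover have "(U ^ (i - a) * V ^ (j - b)) * (?Q * (U ^ a * V ^ b)) = ?Q * (U ^ i * V ^ j)"
  proof -
    have "U ^ i = U ^ (i - a) * U ^ a" "V ^ j = V ^ (j - b) * V ^ b"
      using ab by (simp_all add: power_add[symmetric])
    then show ?thesis by (simp only: mult_ac)
  qed
  moreover have "?Q * (U ^ i * V ^ j) = U ^ Suc i * V ^ Suc j - scal c * (U ^ i * V ^ j)"
  proof -
    have "(A * B - C) * (X * Y) = (A * X) * (B * Y) - C * (X * Y)" for A B C X Y :: bipoly
      by (simp add: algebra_simps)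
    then show ?thesis by (simp only: power_Suc)
  qed
  ultimately show ?thesis by (simp add: linD[OF L])
qed

text \<open>
  The quadrature formula from which the measure is built. The alternative on the number of nodes
  separates the minimal formulas from the one with up to one node more than the rank.
\<close>

definition solved :: bool where
  "solved \<longleftrightarrow> (\<exists>S w. finite S \<and> S \<subseteq> curve \<and> (\<forall>z\<in>S. w z > (0::real)) \<and>
     (\<forall>q\<in>bipolys (2 * n). L q = (\<Sum>z\<in>S. w z * bieval q (fst z) (snd z))) \<and>
     (rank_M n \<beta> = card S \<and> card S \<le> 2 * n + 1 \<or>
        rank_M n \<beta> = 2 * n + 1 \<and> card S \<le> 2 * n + 2))"

text \<open>Interpolation turns a signed quadrature formula into a positive one: evaluating the formula at
  the square of the polynomial dual to a node isolates the weight of that node.  Nodes of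
  weight zero are dropped, and counting the others gives the rank.\<close>

lemma solved_of_signed:
  assumes S: "finite S" "S \<subseteq> curve" "interpolable n S" and card: "card S \<le> 2 * n + 1"
    and rep: "\<And>q. q \<in> bipolys (2 * n) \<Longrightarrow> L q = (\<Sum>z\<in>S. w z * bieval q (fst z) (snd z))"
  shows solved
proof -
  obtain l where l: "\<And>z. l z \<in> bipolys n"
    "\<And>z z'. z' \<in> S \<Longrightarrow> bieval (l z) (fst z') (snd z') = (if z' = z then 1 else 0)"
    using interpolable_dual[OF S(3)] by blast
  have sq: "p * p \<in> bipolys (2 * n)" if "p \<in> bipolys n" for p
    using bipolys_mult[OF that that] by (simp add: mult_2)
  have w: "w z \<ge> 0" if z: "z \<in> S" for z
  proof -
    have "L (l z * l z) = (\<Sum>x\<in>S. w x * bieval (l z * l z) (fst x) (snd x))"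
      by (rule rep[OF sq[OF l(1)]])
    also have "\<dots> = (\<Sum>x\<in>S. if x = z then w z else 0)"
      using l(2) by (intro sum.cong) auto
    also have "\<dots> = w z" using S z by simp
    finally show ?thesis using pos[OF l(1)] by metis
  qed
  define S' where "S' = {z \<in> S. w z \<noteq> 0}"
  have S': "finite S'" "S' \<subseteq> S" "\<forall>z\<in>S'. w z > 0"
    using S w by (auto simp: S'_def less_le)
  have rep': "L q = (\<Sum>z\<in>S'. w z * bieval q (fst z) (snd z))" if "q \<in> bipolys (2 * n)" for q
    unfolding rep[OF that] using S(1) by (intro sum.mono_neutral_right) (auto simp: S'_def)
  have "rank_M n \<beta> = card S'"
  proof (rule rank_eq_card)
    show "interpolable n S'" using S(3) S'(2) unfolding interpolable_def by (metis subsetD)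
    fix p assume p: "p \<in> bipolys n"
    have "p \<in> N \<longleftrightarrow> (\<Sum>z\<in>S'. w z * bieval (p * p) (fst z) (snd z)) = 0"
      using N_iff[OF p] rep'[OF sq[OF p]] by simp
    also have "\<dots> \<longleftrightarrow> (\<forall>z\<in>S'. w z * bieval (p * p) (fst z) (snd z) = 0)"
      using S'(1,3) by (intro sum_nonneg_eq_0_iff) (auto intro!: mult_nonneg_nonneg[OF _ zero_le_square] intro: less_imp_le)
    also have "\<dots> \<longleftrightarrow> (\<forall>z\<in>S'. bieval p (fst z) (snd z) = 0)"
      using S'(3) by (intro ball_cong) (auto simp: less_le)
    finally show "p \<in> N \<longleftrightarrow> (\<forall>z\<in>S'. bieval p (fst z) (snd z) = 0)" .
  qed (rule S'(1))
  moreover have "card S' \<le> 2 * n + 1" using card_mono[OF S(1) S'(2)] card by simp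
  ultimately show ?thesis
    unfolding solved_def using S' S(2) rep' by (intro exI[of _ S'] exI[of _ w]) auto
qed

end

section \<open>The nondegenerate hyperbola\<close>

locale nondegenerate_moments = hyperbolic_moments +
  assumes c: "c \<noteq> 0"
begin

text \<open>
  The functional induced by \<open>L\<close> through the parametrisation \<open>t \<mapsto> (t, c / t)\<close>, shifted by \<open>t\<close> to
  the power \<open>2n\<close> so that it lives on polynomials instead of Laurent polynomials.
\<close>

definition \<Lambda> :: "real poly \<Rightarrow> real" where
  "\<Lambda> f = (\<Sum>k\<le>4 * n. Polynomial.coeff f k *
     (if 2 * n \<le> k then L (U ^ (k - 2 * n)) else L (V ^ (2 * n - k)) / c ^ (2 * n - k)))"

lemma ulin_\<Lambda>: "ulin \<Lambda>"
  by (simp add: ulin_def \<Lambda>_def distrib_right sum.distrib sum_distrib_left mult.assoc)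

lemma \<Lambda>_monom:
  assumes "k \<le> 4 * n"
  shows "\<Lambda> (Polynomial.monom a k) =
    a * (if 2 * n \<le> k then L (U ^ (k - 2 * n)) else L (V ^ (2 * n - k)) / c ^ (2 * n - k))"
proof -
  have "\<Lambda> (Polynomial.monom a k) = (\<Sum>i\<le>4 * n. if i = k then
    a * (if 2 * n \<le> k then L (U ^ (k - 2 * n)) else L (V ^ (2 * n - k)) / c ^ (2 * n - k)) else 0)"
    unfolding \<Lambda>_def by (intro sum.cong) auto
  then show ?thesis using assms by simp
qed

text \<open>
  The polynomial \<open>f\<close> is the restriction of \<open>q\<close> to the curve, cleared of denominators.
\<close>

definition rep :: "nat \<Rightarrow> bipoly \<Rightarrow> real poly \<Rightarrow> bool" where
  "rep m q f \<longleftrightarrow> q \<in> bipolys m \<and> Polynomial.degree f \<le> 2 * m \<and>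
     (\<forall>t. t \<noteq> 0 \<longrightarrow> poly f t = t ^ m * ev q t (c / t))"

lemma rep_UV:
  assumes "i + j \<le> m"
  shows "rep m (U ^ i * V ^ j) (Polynomial.monom (c ^ j) (m + i - j))"
proof -
  have "c ^ j * t ^ (m + i - j) = t ^ m * (t ^ i * (c / t) ^ j)" if "t \<noteq> 0" for t
  proof -
    have "t ^ (m + i - j) * t ^ j = t ^ m * t ^ i"
      using assms by (simp add: power_add[symmetric])
    then show ?thesis using that by (simp add: power_divide field_simps)
  qed
  then show ?thesis
    using assms by (auto simp: rep_def UV_bipolys poly_monom intro: order_trans[OF degree_monom_le])
qed

lemma rep_add: "rep m p f \<Longrightarrow> rep m q g \<Longrightarrow> rep m (p + q) (f + g)"
  by (auto simp: rep_def bipolys_add distrib_left intro: degree_add_le)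

lemma rep_scal: "rep m p f \<Longrightarrow> rep m (scal a * p) (Polynomial.smult a f)"
  by (auto simp: rep_def bipolys_scal intro: order_trans[OF degree_smult_le])

lemma rep_mult: "rep m p f \<Longrightarrow> rep m' q g \<Longrightarrow> rep (m + m') (p * q) (f * g)"
  by (auto simp: rep_def bipolys_mult power_add intro!: order_trans[OF degree_mult_le])

lemma poly_eq_off_0:
  fixes f g :: "real poly"
  assumes "\<And>t. t \<noteq> 0 \<Longrightarrow> poly f t = poly g t"
  shows "f = g"
proof (rule ccontr)
  assume "f \<noteq> g"
  then have "finite {t. poly (f - g) t = 0}" by (intro poly_roots_finite) simp
  moreover have "UNIV - {0} \<subseteq> {t. poly (f - g) t = 0}" using assms by auto
  ultimately have "finite (UNIV - {0::real})" by (rule rev_finite_subset)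
  then show False using infinite_UNIV_char_0[where 'a = real] by simp
qed

lemma rep_unique: "rep m q f \<Longrightarrow> rep m q g \<Longrightarrow> f = g"
  by (rule poly_eq_off_0) (simp add: rep_def)

lemma rep_ex: "q \<in> bipolys m \<Longrightarrow> \<exists>f. rep m q f"
  by (induction rule: coord_induct) (blast intro: rep_UV rep_add rep_scal)+

lemma L_UV:
  assumes "i + j \<le> 2 * n"
  shows "L (U ^ i * V ^ j) = \<Lambda> (Polynomial.monom (c ^ j) (2 * n + i - j))"
  using assms
proof (induction "min i j" arbitrary: i j)
  case 0
  then consider "i = 0" | "j = 0" by linarith
  then show ?case
  proof cases
    case 1
    then show ?thesis using 0 c by (cases "j = 0") (auto simp: \<Lambda>_monom)
  next
    case 2
    then show ?thesis using 0 by (simp add: \<Lambda>_monom)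
  qed
next
  case (Suc k)
  then obtain i' j' where ij: "i = Suc i'" "j = Suc j'"
    by (cases i; cases j) auto
  have "L (U ^ i * V ^ j) = c * L (U ^ i' * V ^ j')"
    unfolding ij using Suc.prems ij by (intro L_reduce) simp
  also have "\<dots> = c * \<Lambda> (Polynomial.monom (c ^ j') (2 * n + i' - j'))"
    using Suc ij by (subst Suc.hyps(1)) auto
  also have "\<dots> = \<Lambda> (Polynomial.smult c (Polynomial.monom (c ^ j') (2 * n + i' - j')))"
    by (simp only: ulinD[OF ulin_\<Lambda>])
  also have "\<dots> = \<Lambda> (Polynomial.monom (c ^ j) (2 * n + i - j))"
    by (simp add: smult_monom ij)
  finally show ?case .
qed

lemma L_eq_\<Lambda>:
  assumes "rep (2 * n) q f" shows "L q = \<Lambda> f"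
proof -
  have "q \<in> bipolys (2 * n)" using assms by (simp add: rep_def)
  then have "\<exists>f. rep (2 * n) q f \<and> L q = \<Lambda> f"
  proof (induction rule: coord_induct)
    case (mono i j)
    then show ?case using rep_UV L_UV by blast
  next
    case (add p q)
    then show ?case using rep_add linD(1)[OF L] ulinD(1)[OF ulin_\<Lambda>] by metis
  next
    case (scal p a)
    then show ?case using rep_scal linD(2)[OF L] ulinD(2)[OF ulin_\<Lambda>] by metis
  qed
  then show ?thesis using rep_unique assms by blast
qed

lemma rep_surj:
  assumes "Polynomial.degree f \<le> 2 * m"
  obtains q where "rep m q f"
proof -
  have mon: "\<exists>q. rep m q (Polynomial.monom a k)" if k: "k \<le> 2 * m" for a k
  proof (cases "m \<le> k")
    case True
    then have "rep m (scal a * (U ^ (k - m) * V ^ 0)) (Polynomial.smult a (Polynomial.monom (c ^ 0) (m + (k - m) - 0)))"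
      using k by (intro rep_scal rep_UV) simp
    then show ?thesis using True by (auto simp: smult_monom)
  next
    case False
    then have "rep m (scal (a / c ^ (m - k)) * (U ^ 0 * V ^ (m - k)))
       (Polynomial.smult (a / c ^ (m - k)) (Polynomial.monom (c ^ (m - k)) (m + 0 - (m - k))))"
      using k by (intro rep_scal rep_UV) simp
    then show ?thesis using False c by (auto simp: smult_monom)
  qed
  have "\<exists>q. rep m q (\<Sum>k\<in>K. Polynomial.monom (Polynomial.coeff f k) k)" if "finite K" "K \<subseteq> {..2 * m}" for K
    using that
  proof (induction K rule: finite_induct)
    case empty
    have "rep m 0 0" by (simp add: rep_def ev_def)
    then show ?case by auto
  next
    case (insert k K)
    then obtain q q' where "rep m q (\<Sum>k\<in>K. Polynomial.monom (Polynomial.coeff f k) k)"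
      "rep m q' (Polynomial.monom (Polynomial.coeff f k) k)" using mon by blast
    then have "rep m (q' + q) (Polynomial.monom (Polynomial.coeff f k) k + (\<Sum>k\<in>K. Polynomial.monom (Polynomial.coeff f k) k))"
      by (intro rep_add)
    then show ?case using insert by auto
  qed
  from this[of "{..Polynomial.degree f}"] show ?thesis
    using assms that by (auto simp: poly_as_sum_of_monoms)
qed

lemma \<Lambda>_mult: "rep n p f \<Longrightarrow> rep n q g \<Longrightarrow> \<Lambda> (f * g) = L (p * q)"
  using L_eq_\<Lambda>[of "p * q" "f * g"] rep_mult[of n p f n q g] by (simp add: mult_2)

definition curve_pt :: "real \<Rightarrow> real \<times> real" where "curve_pt t = pt t (c / t)"

lemma curve_pt_curve: "t \<noteq> 0 \<Longrightarrow> curve_pt t \<in> curve"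
  by (simp add: curve_pt_def pt_curve)

lemma curve_curve_pt: "z \<in> curve \<Longrightarrow> \<exists>t. t \<noteq> 0 \<and> z = curve_pt t"
proof -
  assume z: "z \<in> curve"
  obtain u v where uv: "z = pt u v" using pt_surj by blast
  then have "u * v = c" using z pt_curve by simp
  then have "u \<noteq> 0" "v = c / u" using c by (auto simp: field_simps)
  then show ?thesis using uv by (auto simp: curve_pt_def)
qed

lemma inj_curve_pt: "inj_on curve_pt T" by (simp add: inj_on_def curve_pt_def)

lemma interpolable_curve_pt:
  assumes T: "finite T" "0 \<notin> T" "card T \<le> 2 * n + 1"
  shows "interpolable n (curve_pt ` T)"
  unfolding interpolable_def
proof
  fix y :: "real \<times> real \<Rightarrow> real"
  obtain f where f: "Polynomial.degree f \<le> card T - 1" "\<And>t. t \<in> T \<Longrightarrow> poly f t = t ^ n * y (curve_pt t)"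
    using univariate_interpolation[OF T(1), of "\<lambda>t. t ^ n * y (curve_pt t)"] by blast
  obtain q where q: "rep n q f" by (rule rep_surj[of f n]) (use f(1) T(3) in auto)
  have "ev q t (c / t) = y (curve_pt t)" if "t \<in> T" for t
  proof -
    have "t \<noteq> 0" using T(2) that by auto
    then show ?thesis using q f(2)[OF that] by (simp add: rep_def)
  qed
  then show "\<exists>p\<in>bipolys n. \<forall>z\<in>curve_pt ` T. bieval p (fst z) (snd z) = y z"
    using q by (intro bexI[of _ q]) (auto simp: rep_def ev_def curve_pt_def)
qed

text \<open>
  The factor by which the degree was shifted becomes the density \<open>t\<close> to the power \<open>2n\<close> of the
  weights.
\<close>

lemma solved_of_univariate:
  assumes T: "finite T" "0 \<notin> T" "card T \<le> 2 * n + 1"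
    and w: "\<And>f. Polynomial.degree f \<le> 4 * n \<Longrightarrow> \<Lambda> f = (\<Sum>t\<in>T. w t * poly f t)"
  shows solved
proof (rule solved_of_signed[of "curve_pt ` T" "\<lambda>z. w (inv_into T curve_pt z) * inv_into T curve_pt z ^ (2 * n)"])
  fix q assume "q \<in> bipolys (2 * n)"
  then obtain f where f: "rep (2 * n) q f" using rep_ex by blast
  then have "L q = (\<Sum>t\<in>T. w t * poly f t)" using w[of f] L_eq_\<Lambda>[OF f] by (simp add: rep_def)
  also have "\<dots> = (\<Sum>t\<in>T. w t * t ^ (2 * n) * bieval q (fst (curve_pt t)) (snd (curve_pt t)))"
  proof (rule sum.cong)
    fix t assume "t \<in> T"
    then have "t \<noteq> 0" using T(2) by auto
    then show "w t * poly f t = w t * t ^ (2 * n) * bieval q (fst (curve_pt t)) (snd (curve_pt t))"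
      using f by (simp add: rep_def ev_def curve_pt_def)
  qed simp
  finally show "L q = (\<Sum>z\<in>curve_pt ` T. w (inv_into T curve_pt z) * inv_into T curve_pt z ^ (2 * n) * bieval q (fst z) (snd z))"
    by (simp add: sum.reindex[OF inj_curve_pt] inv_into_f_f[OF inj_curve_pt])
qed (use T in \<open>auto intro!: interpolable_curve_pt curve_pt_curve simp: card_image inj_curve_pt\<close>)

text \<open>
  Either every null polynomial vanishes on the whole curve, and \<open>\<Lambda>\<close> is positive definite, or the
  roots of one null polynomial bound the variety; then it consists of at most \<open>2n\<close> points, so
  few that it can be interpolated.
\<close>

lemma nondegenerate_solved:
  assumes rank: "infinite var \<or> rank_M n \<beta> \<le> card var"
  shows solved
proof (cases "\<forall>p\<in>N. \<forall>t. t \<noteq> 0 \<longrightarrow> ev p t (c / t) = 0")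
  case True
  have pd: "\<Lambda> (f * f) > 0" if f: "f \<noteq> 0" "Polynomial.degree f \<le> 2 * n" for f
  proof -
    obtain q where q: "rep n q f" by (rule rep_surj[OF f(2)])
    then have qn: "q \<in> bipolys n" by (simp add: rep_def)
    have "q \<notin> N"
    proof
      assume "q \<in> N"
      then have "poly f t = poly 0 t" if "t \<noteq> 0" for t using True q that by (simp add: rep_def)
      then show False using f(1) poly_eq_off_0 by blast
    qed
    then show ?thesis using pos[OF qn] N_iff[OF qn] \<Lambda>_mult[OF q q] by simp
  qed
  obtain T w where T: "finite T" "card T = Suc (2 * n)" "0 \<notin> T"
      "\<And>f. Polynomial.degree f \<le> 2 * (2 * n) \<Longrightarrow> \<Lambda> f = (\<Sum>z\<in>T. w z * poly f z)"
    by (rule positive_quadrature[OF ulin_\<Lambda> pd]) blast+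
  then show ?thesis by (intro solved_of_univariate[of T w]) auto
next
  case False
  then obtain p0 t0 where p0: "p0 \<in> N" "t0 \<noteq> 0" "ev p0 t0 (c / t0) \<noteq> 0" by blast
  obtain f0 where f0: "rep n p0 f0" using rep_ex[OF N_sub[OF p0(1)]] by blast
  have f0_nz: "f0 \<noteq> 0" using f0 p0 by (auto simp: rep_def)
  define T where "T = {t. t \<noteq> 0 \<and> curve_pt t \<in> var}"
  have T_sub: "T \<subseteq> {t. poly f0 t = 0}"
    using f0 p0(1) by (auto simp: T_def curve_pt_def pt_var rep_def)
  have T: "finite T" "0 \<notin> T"
    using finite_subset[OF T_sub poly_roots_finite[OF f0_nz]] by (auto simp: T_def)
  have cT: "card T \<le> 2 * n"
    using card_mono[OF poly_roots_finite[OF f0_nz] T_sub] card_poly_roots_bound[OF f0_nz] f0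
    by (simp add: rep_def)
  have var: "var = curve_pt ` T"
  proof
    show "var \<subseteq> curve_pt ` T"
    proof
      fix z assume z: "z \<in> var"
      then obtain t where "t \<noteq> 0" "z = curve_pt t" using var_curve curve_curve_pt by blast
      then show "z \<in> curve_pt ` T" using z by (auto simp: T_def)
    qed
  qed (auto simp: T_def)
  then have rank_T: "rank_M n \<beta> \<le> card (curve_pt ` T)"
    using rank T(1) by simp
  have N_T: "p \<in> N" if "p \<in> bipolys n" "\<And>t. t \<in> T \<Longrightarrow> ev p t (c / t) = 0" for p
  proof (rule null_if_vanishes[of "curve_pt ` T"])
    show "bieval p (fst z) (snd z) = 0" if "p \<in> N" "z \<in> curve_pt ` T" for p z
      using that var by (auto simp: var_def)
    show "bieval p (fst z) (snd z) = 0" if "z \<in> curve_pt ` T" for z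
      using that \<open>\<And>t. t \<in> T \<Longrightarrow> ev p t (c / t) = 0\<close> by (auto simp: curve_pt_def ev_def)
  qed (use T cT rank_T that in \<open>auto intro!: interpolable_curve_pt\<close>)
  have orth: "\<Lambda> (root_poly T * s) = 0" if s: "Polynomial.degree s + card T \<le> 4 * n" for s
  proof (rule degree_le_mult_split[OF ulin_mult[OF ulin_\<Lambda>], of "2 * n - card T" "2 * n"])
    fix s t :: "real poly"
    assume s: "Polynomial.degree s \<le> 2 * n - card T" and t: "Polynomial.degree t \<le> 2 * n"
    have "Polynomial.degree (root_poly T * s) \<le> 2 * n"
      using s cT by (intro order_trans[OF degree_mult_le]) (simp add: degree_root_poly)
    then obtain p where p: "rep n p (root_poly T * s)" by (rule rep_surj)
    obtain q where q: "rep n q t" using t by (rule rep_surj)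
    have "t ^ n * ev p t (c / t) = 0" if "t \<in> T" for t
      using p poly_root_poly[OF T(1)] T(2) that unfolding rep_def by (metis mult_zero_left poly_mult)
    then have "p \<in> N" using p T(2) by (intro N_T) (auto simp: rep_def)
    then have "L (q * p) = 0" using q by (intro N_orth) (auto simp: rep_def)
    then show "\<Lambda> (root_poly T * (s * t)) = 0"
      using \<Lambda>_mult[OF q p] by (simp only: mult_ac)
  qed (use s cT in simp)
  obtain w where "\<And>f. Polynomial.degree f \<le> 4 * n \<Longrightarrow> \<Lambda> f = (\<Sum>t\<in>T. w t * poly f t)"
    by (rule interpolatory_quadrature[OF ulin_\<Lambda> T(1) orth]) blast+
  then show ?thesis using T cT by (intro solved_of_univariate[of T w]) auto
qed

end



section \<open>The degenerate hyperbola\<close>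

text \<open>
  The restriction of the Riesz functional to the polynomials in the single linear form \<open>W\<close>, that
  is, to one of the two lines.
\<close>

definition axis :: "nat \<Rightarrow> (nat \<Rightarrow> nat \<Rightarrow> real) \<Rightarrow> bipoly \<Rightarrow> real poly \<Rightarrow> real" where
  "axis n \<beta> W f = (\<Sum>k\<le>2 * n. Polynomial.coeff f k * riesz n \<beta> (W ^ k))"

lemma ulin_axis: "ulin (axis n \<beta> W)"
  by (simp add: ulin_def axis_def distrib_right sum.distrib sum_distrib_left mult.assoc)

lemma axis_monom:
  assumes "k \<le> 2 * n"
  shows "axis n \<beta> W (Polynomial.monom a k) = a * riesz n \<beta> (W ^ k)"
proof -
  have "axis n \<beta> W (Polynomial.monom a k) = (\<Sum>i\<le>2 * n. if i = k then a * riesz n \<beta> (W ^ k) else 0)"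
    unfolding axis_def by (intro sum.cong) auto
  then show ?thesis using assms by simp
qed

lemma axis_one: "axis n \<beta> W 1 = riesz n \<beta> 1"
  using axis_monom[of 0 n \<beta> W 1] by simp

lemma poly_eq_sum_le:
  fixes p :: "real poly"
  assumes "Polynomial.degree p \<le> m"
  shows "poly p x = (\<Sum>k\<le>m. Polynomial.coeff p k * x ^ k)"
  unfolding poly_altdef using assms
  by (intro sum.mono_neutral_left) (auto simp: coeff_eq_0)

lemma degree_mult_X: "Polynomial.degree k \<le> m \<Longrightarrow> Polynomial.degree ([:0, 1:] * k :: real poly) \<le> Suc m"
  by (rule order_trans[OF degree_mult_le]) simp

lemma divide_X:
  fixes f :: "real poly"
  assumes "poly f 0 = 0"
  obtains k where "f = [:0, 1:] * k" "Polynomial.degree k \<le> Polynomial.degree f - 1"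
proof -
  obtain k where k: "f = [:0, 1:] * k" using assms poly_eq_0_iff_dvd[of f 0] by (auto elim: dvdE)
  then have "Polynomial.degree k \<le> Polynomial.degree f - 1"
    by (cases "k = 0") (simp_all add: degree_mult_eq)
  then show ?thesis using that k by blast
qed

text \<open>The polynomial \<open>e\<close> minimises \<open>M (e\<^sup>2)\<close> among the polynomials of degree at most \<open>m + 1\<close> with
  constant term 1, so that \<open>M (e\<^sup>2)\<close> is the largest mass which can be removed at the origin without
  losing nonnegativity on squares.\<close>

lemma removable_mass:
  assumes M: "ulin M"
    and pos: "\<And>k. k \<noteq> 0 \<Longrightarrow> Polynomial.degree k \<le> m \<Longrightarrow> M (([:0, 1:] * k) * ([:0, 1:] * k)) > 0"
  obtains e where "Polynomial.degree e \<le> Suc m" "poly e 0 = 1"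
    "\<And>\<tau> f. \<tau> > 0 \<Longrightarrow> f \<noteq> 0 \<Longrightarrow> Polynomial.degree f \<le> Suc m \<Longrightarrow>
       M (f * f) + (\<tau> - M (e * e)) * poly (f * f) 0 > 0"
proof -
  let ?X = "[:0, 1:] :: real poly"
  have L: "ulin (\<lambda>k. M (?X * ?X * k))" by (rule ulin_mult[OF M])
  have P: "ulin (\<lambda>k. - M (?X * k))"
    using ulin_mult[OF M, of ?X] by (simp add: ulin_def)
  have pos': "M (?X * ?X * (k * k)) > 0" if "k \<noteq> 0" "Polynomial.degree k \<le> m" for k
    using pos[OF that] by (simp only: mult_ac)
  obtain k where k: "Polynomial.degree k \<le> m"
    "\<And>s. Polynomial.degree s \<le> m \<Longrightarrow> M (?X * ?X * (k * s)) = - M (?X * s)"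
    using riesz_representation[OF L P pos'] by blast
  define e where "e = 1 + ?X * k"
  have e0: "poly e 0 = 1" by (simp add: e_def)
  have orth: "M (e * (?X * r)) = 0" if "Polynomial.degree r \<le> m" for r
  proof -
    have "(1 + A * k) * (A * r) = A * r + A * A * (k * r)" for A :: "real poly"
      by (simp add: algebra_simps)
    then have "e * (?X * r) = ?X * r + ?X * ?X * (k * r)" unfolding e_def .
    then show ?thesis using k(2)[OF that] by (simp only: ulinD[OF M])
  qed
  show ?thesis
  proof (rule that[of e])
    show e_deg: "Polynomial.degree e \<le> Suc m"
      unfolding e_def using degree_mult_X[OF k(1)] by (intro degree_add_le) simp_all
    show "poly e 0 = 1" by (rule e0)
    fix \<tau> :: real and f :: "real poly"
    assume \<tau>: "\<tau> > 0" and f: "f \<noteq> 0" "Polynomial.degree f \<le> Suc m"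
    define a where "a = poly f 0"
    have "poly (f - Polynomial.smult a e) 0 = 0" by (simp add: e0 a_def)
    then obtain r where r: "f - Polynomial.smult a e = ?X * r"
        "Polynomial.degree r \<le> Polynomial.degree (f - Polynomial.smult a e) - 1"
      by (rule divide_X)
    have "Polynomial.degree (f - Polynomial.smult a e) \<le> Suc m"
      using f e_deg by (intro degree_diff_le) (auto intro: order_trans[OF degree_smult_le])
    then have r_deg: "Polynomial.degree r \<le> m" using r(2) by simp
    have f_eq: "f = Polynomial.smult a e + ?X * r" using r(1) by (simp add: algebra_simps)
    have "f * f = Polynomial.smult (a * a) (e * e) + (Polynomial.smult (2 * a) (e * (?X * r)) + (?X * r) * (?X * r))"
    proof -
      have "(C * e + Y) * (C * e + Y) = (C * C) * (e * e) + ((C + C) * (e * Y) + Y * Y)" for C Y :: "real poly"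
        by (simp add: algebra_simps)
      from this[of "[:a:]" "?X * r"] show ?thesis unfolding f_eq by simp
    qed
    then have "M (f * f) = a * a * M (e * e) + M ((?X * r) * (?X * r))"
      by (simp only: ulinD[OF M] orth[OF r_deg])
    then have eq: "M (f * f) + (\<tau> - M (e * e)) * poly (f * f) 0 = \<tau> * (a * a) + M ((?X * r) * (?X * r))"
      by (simp add: a_def algebra_simps)
    show "M (f * f) + (\<tau> - M (e * e)) * poly (f * f) 0 > 0"
    proof (cases "r = 0")
      case True
      then have "a \<noteq> 0" using f f_eq by auto
      then have "\<tau> * (a * a) > 0" using \<tau> by (metis mult_pos_pos not_square_less_zero linorder_neqE_linordered_idom mult_eq_0_iff)
      then show ?thesis unfolding eq using True by (simp add: ulinD[OF M])
    next
      case False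
      then show ?thesis unfolding eq using pos[OF False r_deg] \<tau> by (intro add_nonneg_pos) auto
    qed
  qed
qed

locale degenerate_moments = hyperbolic_moments +
  assumes c0: "c = 0"
begin

text \<open>
  The two lines play symmetric roles.
\<close>

lemma swap: "degenerate_moments V U a2 a1 a3 b2 b1 b3 c n \<beta>"
proof -
  have "bieval V (a2 * u + a1 * v + a3) (b2 * u + b1 * v + b3) = u" for u v
    using V_eval[of v u] by (simp add: add.commute)
  moreover have "bieval U (a2 * u + a1 * v + a3) (b2 * u + b1 * v + b3) = v" for u v
    using U_eval[of v u] by (simp add: add.commute)
  ultimately show ?thesis
    using U_deg V_deg X_eq Y_eq n pos rg Q_null c0
    by unfold_locales (simp_all add: add.commute mult.commute)
qed

lemma curve_cross: "pt u 0 \<in> curve" "pt 0 v \<in> curve"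
  unfolding pt_curve by (simp_all add: c0)

lemma curveE:
  assumes "z \<in> curve" obtains u where "z = pt u 0" | v where "v \<noteq> 0" "z = pt 0 v"
proof -
  obtain u v where z: "z = pt u v" using pt_surj by blast
  then have "u * v = 0" using assms pt_curve c0 by simp
  then show ?thesis using that z by (cases "v = 0") auto
qed

text \<open>
  The polynomials \<open>f\<close> and \<open>g\<close> are the restrictions of \<open>q\<close> to the two lines; they agree at the
  origin.
\<close>

definition rep :: "nat \<Rightarrow> bipoly \<Rightarrow> real poly \<Rightarrow> real poly \<Rightarrow> bool" where
  "rep m q f g \<longleftrightarrow> q \<in> bipolys m \<and> Polynomial.degree f \<le> m \<and> Polynomial.degree g \<le> m \<and>
     (\<forall>t. poly f t = ev q t 0) \<and> (\<forall>t. poly g t = ev q 0 t)"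

lemma rep_origin: "rep m q f g \<Longrightarrow> poly g 0 = poly f 0"
  by (simp add: rep_def)

lemma rep_UV:
  assumes "i + j \<le> m"
  shows "rep m (U ^ i * V ^ j) (if j = 0 then Polynomial.monom 1 i else 0) (if i = 0 then Polynomial.monom 1 j else 0)"
  using assms by (auto simp: rep_def UV_bipolys poly_monom degree_monom_eq)

lemma rep_add: "rep m p f g \<Longrightarrow> rep m q f' g' \<Longrightarrow> rep m (p + q) (f + f') (g + g')"
  by (auto simp: rep_def bipolys_add intro: degree_add_le)

lemma rep_scal: "rep m p f g \<Longrightarrow> rep m (scal a * p) (Polynomial.smult a f) (Polynomial.smult a g)"
  by (auto simp: rep_def bipolys_scal intro: order_trans[OF degree_smult_le])

lemma rep_mult: "rep m p f g \<Longrightarrow> rep m' q f' g' \<Longrightarrow> rep (m + m') (p * q) (f * f') (g * g')"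
  by (auto simp: rep_def bipolys_mult intro!: order_trans[OF degree_mult_le])

lemma rep_mono: "rep m p f g \<Longrightarrow> m \<le> m' \<Longrightarrow> rep m' p f g"
  by (auto simp: rep_def intro: bipolys_mono)

lemma rep_unique: "rep m q f g \<Longrightarrow> rep m q f' g' \<Longrightarrow> f = f' \<and> g = g'"
  by (simp add: rep_def poly_eq_poly_eq_iff[symmetric] fun_eq_iff)

lemma rep_ex: "q \<in> bipolys m \<Longrightarrow> \<exists>f g. rep m q f g"
  by (induction rule: coord_induct) (blast intro: rep_UV rep_add rep_scal)+

text \<open>
  Mixed monomials in \<open>U\<close> and \<open>V\<close> do not contribute, and the constant term, counted on both
  lines, has to be subtracted once.
\<close>

lemma L_rep:
  assumes "rep (2 * n) q f g"
  shows "L q = axis n \<beta> U f + axis n \<beta> V g - poly f 0 * L 1"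
proof -
  note ax = ulinD[OF ulin_axis]
  have "q \<in> bipolys (2 * n)" using assms by (simp add: rep_def)
  then have "\<exists>f g. rep (2 * n) q f g \<and> L q = axis n \<beta> U f + axis n \<beta> V g - poly f 0 * L 1"
  proof (induction rule: coord_induct)
    case (mono i j)
    have "L (U ^ i * V ^ j) = axis n \<beta> U (if j = 0 then Polynomial.monom 1 i else 0)
       + axis n \<beta> V (if i = 0 then Polynomial.monom 1 j else 0)
       - poly (if j = 0 then Polynomial.monom 1 i else 0) 0 * L 1"
    proof (cases "i = 0 \<or> j = 0")
      case True
      then show ?thesis using mono by (auto simp: axis_monom axis_one ax poly_monom)
    next
      case False
      then obtain i' j' where ij: "i = Suc i'" "j = Suc j'" by (cases i; cases j) auto
      then have "L (U ^ i * V ^ j) = c * L (U ^ i' * V ^ j')"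
        unfolding ij using mono ij by (intro L_reduce) simp
      then show ?thesis using False by (simp add: c0 ax)
    qed
    then show ?case using rep_UV[OF mono] by blast
  next
    case (add p q)
    then obtain f g f' g' where
      "rep (2 * n) p f g" "L p = axis n \<beta> U f + axis n \<beta> V g - poly f 0 * L 1"
      "rep (2 * n) q f' g'" "L q = axis n \<beta> U f' + axis n \<beta> V g' - poly f' 0 * L 1" by blast
    then have "rep (2 * n) (p + q) (f + f') (g + g') \<and> L (p + q) =
        axis n \<beta> U (f + f') + axis n \<beta> V (g + g') - poly (f + f') 0 * L 1"
      using rep_add[of "2 * n" p f g q f' g'] by (simp add: linD[OF L] ax algebra_simps)
    then show ?case by blast
  next
    case (scal p a)
    then obtain f g where
      "rep (2 * n) p f g" "L p = axis n \<beta> U f + axis n \<beta> V g - poly f 0 * L 1" by blast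
    then have "rep (2 * n) (scal a * p) (Polynomial.smult a f) (Polynomial.smult a g) \<and> L (scal a * p) =
        axis n \<beta> U (Polynomial.smult a f) + axis n \<beta> V (Polynomial.smult a g)
        - poly (Polynomial.smult a f) 0 * L 1"
      using rep_scal[of "2 * n" p f g a] by (simp add: linD[OF L] ax distrib_left right_diff_distrib)
    then show ?case by blast
  qed
  then show ?thesis using rep_unique assms by metis
qed

lemma L_rep_mult:
  assumes "rep n p f g" "rep n q f' g'"
  shows "L (p * q) = axis n \<beta> U (f * f') + axis n \<beta> V (g * g') - poly (f * f') 0 * L 1"
  by (rule L_rep) (use rep_mult[OF assms] in \<open>simp add: mult_2\<close>)

lemma rep_surj:
  assumes "Polynomial.degree f \<le> m" "Polynomial.degree g \<le> m" "poly g 0 = poly f 0"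
  obtains q where "rep m q f g"
proof
  let ?p = "\<lambda>W h. \<Sum>k\<le>m. scal (Polynomial.coeff h k) * W ^ k"
  let ?q = "?p U f + ?p V g - scal (poly f 0)"
  have "?q \<in> bipolys m"
    by (intro bipolys_diff bipolys_add bipolys_sum bipolys_scal bipolys_scal0 U_bipolys V_bipolys) auto
  moreover have "ev (?p U h) u v = poly h u" "ev (?p V h) u v = poly h v" if "Polynomial.degree h \<le> m" for h u v
    using poly_eq_sum_le[OF that] by (simp_all add: ev_sum)
  ultimately show "rep m ?q f g" using assms by (simp add: rep_def)
qed

lemma rep_null: "rep n q f g \<Longrightarrow> rep n q' f g \<Longrightarrow> q' \<in> N \<Longrightarrow> q \<in> N"
  using L_rep_mult[of q f g q f g] L_rep_mult[of q' f g q' f g] N_iff[of q] N_iff[of q']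
  by (simp add: rep_def)

subsection \<open>Nodes on the two lines\<close>

definition cross :: "real set \<Rightarrow> real set \<Rightarrow> (real \<times> real) set" where
  "cross A B = (\<lambda>u. pt u 0) ` A \<union> (\<lambda>v. pt 0 v) ` B"

text \<open>
  The origin may be a node on the first line only; its weight is the one given for that line.
\<close>

definition cross_weight :: "(real \<Rightarrow> real) \<Rightarrow> (real \<Rightarrow> real) \<Rightarrow> real \<times> real \<Rightarrow> real" where
  "cross_weight wA wB z = (let v = bieval V (fst z) (snd z) in
     if v = 0 then wA (bieval U (fst z) (snd z)) else wB v)"

lemma cross_weight_pt:
  "cross_weight wA wB (pt u 0) = wA u" "v \<noteq> 0 \<Longrightarrow> cross_weight wA wB (pt 0 v) = wB v"
  using ev_simps(6,7) by (simp_all add: cross_weight_def ev_def)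

lemma card_cross:
  assumes "finite A" "finite B" "0 \<notin> B"
  shows "card (cross A B) = card A + card B"
  unfolding cross_def using assms
  by (subst card_Un_disjoint) (auto simp: card_image inj_on_def)

lemma sum_cross:
  assumes "finite A" "finite B" "0 \<notin> B" "rep m q f g"
  shows "(\<Sum>z\<in>cross A B. cross_weight wA wB z * bieval q (fst z) (snd z))
     = (\<Sum>a\<in>A. wA a * poly f a) + (\<Sum>b\<in>B. wB b * poly g b)"
proof -
  have disj: "(\<lambda>u. pt u 0) ` A \<inter> (\<lambda>v. pt 0 v) ` B = {}" using assms(3) by auto
  have "(\<Sum>b\<in>B. cross_weight wA wB (pt 0 b) * ev q 0 b) = (\<Sum>b\<in>B. wB b * poly g b)"
  proof (rule sum.cong)
    fix b assume "b \<in> B"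
    then have "b \<noteq> 0" using assms(3) by auto
    then show "cross_weight wA wB (pt 0 b) * ev q 0 b = wB b * poly g b"
      using assms(4) by (simp add: cross_weight_pt rep_def)
  qed simp
  moreover have "(\<Sum>a\<in>A. cross_weight wA wB (pt a 0) * ev q a 0) = (\<Sum>a\<in>A. wA a * poly f a)"
    using assms(4) by (simp add: cross_weight_pt rep_def)
  ultimately show ?thesis
    unfolding cross_def using assms(1,2) disj
    by (subst sum.union_disjoint) (auto simp: sum.reindex inj_on_def ev_def)
qed

lemma cross_curve: "cross A B \<subseteq> curve"
  by (auto simp: cross_def curve_cross)

lemma finite_cross: "finite A \<Longrightarrow> finite B \<Longrightarrow> finite (cross A B)"
  by (simp add: cross_def)

text \<open>
  The values on the first line are interpolated first; on the second line they leave the value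
  at the origin prescribed, whence one node less there.
\<close>

lemma interpolable_cross:
  assumes "finite A" "finite B" "0 \<notin> B" "card A \<le> Suc n" "card B \<le> n"
  shows "interpolable n (cross A B)"
  unfolding interpolable_def
proof
  fix y :: "real \<times> real \<Rightarrow> real"
  obtain f where f: "Polynomial.degree f \<le> card A - 1" "\<And>a. a \<in> A \<Longrightarrow> poly f a = y (pt a 0)"
    using univariate_interpolation[OF assms(1), of "\<lambda>a. y (pt a 0)"] by blast
  obtain g where g: "Polynomial.degree g \<le> card (insert 0 B) - 1"
      "\<And>b. b \<in> insert 0 B \<Longrightarrow> poly g b = (if b = 0 then poly f 0 else y (pt 0 b))"
    using univariate_interpolation[of "insert 0 B" "\<lambda>b. if b = 0 then poly f 0 else y (pt 0 b)"] assms(2)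
    by blast
  obtain q where q: "rep n q f g"
    by (rule rep_surj[of f n g]) (use assms f(1) g in auto)
  have "bieval q (fst z) (snd z) = y z" if "z \<in> cross A B" for z
    using that unfolding cross_def
  proof
    assume "z \<in> (\<lambda>u. pt u 0) ` A"
    then obtain a where "a \<in> A" "z = pt a 0" by auto
    then show ?thesis using f(2)[of a] q by (simp add: rep_def ev_def)
  next
    assume "z \<in> (\<lambda>v. pt 0 v) ` B"
    then obtain b where b: "b \<in> B" "z = pt 0 b" by auto
    then have "b \<noteq> 0" using assms(3) by auto
    then show ?thesis using g(2)[of b] b q by (simp add: rep_def ev_def)
  qed
  then show "\<exists>p\<in>bipolys n. \<forall>z\<in>cross A B. bieval p (fst z) (snd z) = y z"
    using q unfolding rep_def by blast
qed

lemma solved_of_cross: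
  assumes AB: "finite A" "finite B" "0 \<notin> B" "card A \<le> Suc n" "card B \<le> n"
    and rep: "\<And>q f g. rep (2 * n) q f g \<Longrightarrow> L q = (\<Sum>a\<in>A. wA a * poly f a) + (\<Sum>b\<in>B. wB b * poly g b)"
  shows solved
proof (rule solved_of_signed[of "cross A B" "cross_weight wA wB"])
  fix q assume "q \<in> bipolys (2 * n)"
  then obtain f g where "rep (2 * n) q f g" using rep_ex by blast
  then show "L q = (\<Sum>z\<in>cross A B. cross_weight wA wB z * bieval q (fst z) (snd z))"
    using rep sum_cross[OF AB(1-3)] by simp
next
  show "card (cross A B) \<le> 2 * n + 1" using AB card_cross[OF AB(1-3)] by simp
qed (intro finite_cross cross_curve interpolable_cross AB)+

subsection \<open>Finite variety\<close>

definition var_axis :: "real set" where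
  "var_axis = {u. u \<noteq> 0 \<and> pt u 0 \<in> var}"

lemma var_axis_bound:
  assumes "p \<in> N" "ev p u 0 \<noteq> 0"
  shows "finite var_axis" "card var_axis \<le> n" "pt 0 0 \<in> var \<Longrightarrow> Suc (card var_axis) \<le> n"
proof -
  obtain f g where f: "rep n p f g" using rep_ex[OF N_sub[OF assms(1)]] by blast
  have f0: "f \<noteq> 0" using f assms(2) by (auto simp: rep_def)
  have deg: "card {x. poly f x = 0} \<le> n"
    using card_poly_roots_bound[OF f0] f by (simp add: rep_def)
  have fin: "finite {x. poly f x = 0}" by (rule poly_roots_finite[OF f0])
  have sub: "var_axis \<subseteq> {x. poly f x = 0}"
    using f assms(1) by (auto simp: var_axis_def pt_var rep_def)
  show "finite var_axis" "card var_axis \<le> n"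
    using finite_subset[OF sub fin] card_mono[OF fin sub] deg by simp_all
  assume "pt 0 0 \<in> var"
  then have "insert 0 var_axis \<subseteq> {x. poly f x = 0}"
    using sub f assms(1) by (auto simp: pt_var rep_def)
  from card_mono[OF fin this] have "card (insert 0 var_axis) \<le> n" using deg by simp
  then show "Suc (card var_axis) \<le> n"
    using \<open>finite var_axis\<close> by (simp add: var_axis_def)
qed

text \<open>
  The origin is added as a node, because then the multiples of the root polynomial vanish at the
  origin and extend by zero to the second line. If the origin belongs to the variety, such an
  extension is a null polynomial as long as its degree permits. Otherwise the null polynomials
  are completed on the second line by a multiple of its root polynomial, and the zero at the
  origin is supplied by the other factor of the product.
\<close>

lemma axis_quadrature:
  assumes A: "finite A" "0 \<notin> A" "card A \<le> n" "\<And>u. u \<noteq> 0 \<Longrightarrow> pt u 0 \<in> var \<longleftrightarrow> u \<in> A"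
    and B: "finite B" "0 \<notin> B" "card B \<le> n" "\<And>v. v \<noteq> 0 \<Longrightarrow> pt 0 v \<in> var \<longleftrightarrow> v \<in> B"
    and e: "pt 0 0 \<in> var \<Longrightarrow> Suc (card A) \<le> n"
    and vanish: "\<And>p. p \<in> bipolys n \<Longrightarrow> (\<And>z. z \<in> var \<Longrightarrow> bieval p (fst z) (snd z) = 0) \<Longrightarrow> p \<in> N"
  obtains w where "\<And>f. Polynomial.degree f \<le> 2 * n \<Longrightarrow>
      axis n \<beta> U f = (\<Sum>a\<in>insert 0 A. w a * poly f a)"
proof -
  let ?X = "[:0, 1:] :: real poly"
  have null: "q \<in> N" if q: "rep n q f g" and f: "\<And>a. a \<in> A \<Longrightarrow> poly f a = 0"
    and g: "\<And>b. b \<in> B \<Longrightarrow> poly g b = 0" and o: "pt 0 0 \<in> var \<Longrightarrow> poly f 0 = 0" for q f g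
  proof (rule vanish)
    show "q \<in> bipolys n" using q by (simp add: rep_def)
    fix z assume z: "z \<in> var"
    then show "bieval q (fst z) (snd z) = 0"
    proof (cases rule: curveE[OF subsetD[OF var_curve z]])
      case (1 u)
      then have "poly f u = 0" using z A(4)[of u] f o by (cases "u = 0") auto
      then show ?thesis using q 1 by (simp add: rep_def ev_def)
    next
      case (2 v)
      then have "poly g v = 0" using z B(4)[of v] g by auto
      then show ?thesis using q 2 by (simp add: rep_def ev_def)
    qed
  qed
  have rpA: "poly (root_poly A) a = 0" if "a \<in> A" for a using poly_root_poly[OF A(1)] that by simp
  have rpB: "poly (root_poly B) b = 0" if "b \<in> B" for b using poly_root_poly[OF B(1)] that by simp
  have rp0: "poly (root_poly B) 0 \<noteq> 0" using poly_root_poly[OF B(1)] B(2) by simp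
  have rp: "root_poly (insert 0 A) = ?X * root_poly A"
    using A by (simp add: root_poly_def)
  have orth: "axis n \<beta> U (root_poly (insert 0 A) * s) = 0"
    if s: "Polynomial.degree s + card (insert 0 A) \<le> 2 * n" for s
  proof (cases "pt 0 0 \<in> var")
    case True
    note e = e[OF True]
    show ?thesis
    proof (rule degree_le_mult_split[OF ulin_mult[OF ulin_axis], of "n - Suc (card A)" n])
      fix s t :: "real poly"
      assume s: "Polynomial.degree s \<le> n - Suc (card A)" and t: "Polynomial.degree t \<le> n"
      have "Polynomial.degree (root_poly (insert 0 A) * s) \<le> n"
        using s A e by (intro order_trans[OF degree_mult_le]) (simp add: degree_root_poly)
      then obtain p where p: "rep n p (root_poly (insert 0 A) * s) 0"
        by (rule rep_surj[where g = 0]) (simp_all add: rp)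
      obtain q where q: "rep n q t [:poly t 0:]"
        by (rule rep_surj[OF t, where g = "[:poly t 0:]"]) simp_all
      have "p \<in> N" by (rule null[OF p]) (simp_all add: rp rpA)
      then have "L (q * p) = 0" using q by (intro N_orth) (auto simp: rep_def)
      then have "axis n \<beta> U (t * (root_poly (insert 0 A) * s)) = 0"
        unfolding L_rep_mult[OF q p] by (simp add: ulinD[OF ulin_axis] rp)
      then show "axis n \<beta> U (root_poly (insert 0 A) * (s * t)) = 0" by (simp only: mult_ac)
    qed (use s e A in simp)
  next
    case False
    show ?thesis
    proof (rule degree_le_mult_split[OF ulin_mult[OF ulin_axis], of "n - card A" "n - 1"])
      fix s t :: "real poly"
      assume s: "Polynomial.degree s \<le> n - card A" and t: "Polynomial.degree t \<le> n - 1"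
      let ?f = "root_poly A * s"
      let ?g = "Polynomial.smult (poly ?f 0 / poly (root_poly B) 0) (root_poly B)"
      have "Polynomial.degree ?f \<le> n"
        using s A by (intro order_trans[OF degree_mult_le]) (simp add: degree_root_poly)
      then obtain p where p: "rep n p ?f ?g"
        by (rule rep_surj) (use B rp0 in \<open>auto simp: degree_root_poly\<close>)
      have "Polynomial.degree (?X * t) \<le> n" using degree_mult_X[OF t] n by simp
      then obtain q where q: "rep n q (?X * t) 0" by (rule rep_surj[where g = 0]) simp_all
      have "p \<in> N" by (rule null[OF p]) (use False in \<open>simp_all add: rpA rpB\<close>)
      then have "L (q * p) = 0" using q by (intro N_orth) (auto simp: rep_def)
      then have "axis n \<beta> U ((?X * t) * ?f) = 0"
        unfolding L_rep_mult[OF q p] by (simp add: ulinD[OF ulin_axis])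
      then show "axis n \<beta> U (root_poly (insert 0 A) * (s * t)) = 0" unfolding rp by (simp only: mult_ac)
    qed (use s A n in simp)
  qed
  have "finite (insert 0 A)" using A by simp
  then obtain w where "\<And>f. Polynomial.degree f \<le> 2 * n \<Longrightarrow> axis n \<beta> U f = (\<Sum>a\<in>insert 0 A. w a * poly f a)"
    by (rule interpolatory_quadrature[OF ulin_axis _ orth]) blast+
  then show ?thesis by (rule that)
qed

text \<open>
  The quadrature formulas on the two lines are added, and the contributions at the origin are
  collected into one weight; it is zero if the origin does not belong to the variety.
\<close>

lemma finite_variety_solved:
  assumes rank: "rank_M n \<beta> \<le> card var"
    and p: "p \<in> N" "ev p u 0 \<noteq> 0" and q: "q \<in> N" "ev q 0 v \<noteq> 0"
  shows solved
proof -
  interpret sw: degenerate_moments V U a2 a1 a3 b2 b1 b3 c n \<beta> by (rule swap)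
  have sw_pt: "sw.pt s t = pt t s" for s t by (simp add: sw.pt_def pt_def add.commute)
  have sw_ev: "sw.ev r s t = ev r t s" for r s t by (simp add: sw.ev_def ev_def sw_pt)
  let ?A = "var_axis" and ?B = "sw.var_axis"
  have A: "finite ?A" "0 \<notin> ?A" "card ?A \<le> n" "\<And>u. u \<noteq> 0 \<Longrightarrow> pt u 0 \<in> var \<longleftrightarrow> u \<in> ?A"
    "pt 0 0 \<in> var \<Longrightarrow> Suc (card ?A) \<le> n"
    using var_axis_bound[OF p] by (auto simp: var_axis_def)
  have "sw.ev q v 0 \<noteq> 0" using q(2) sw_ev by simp
  from sw.var_axis_bound[OF q(1) this]
  have B: "finite ?B" "0 \<notin> ?B" "card ?B \<le> n" "\<And>v. v \<noteq> 0 \<Longrightarrow> pt 0 v \<in> var \<longleftrightarrow> v \<in> ?B"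
    "pt 0 0 \<in> var \<Longrightarrow> Suc (card ?B) \<le> n"
    by (auto simp: sw.var_axis_def sw_pt)
  define A' where "A' = (if pt 0 0 \<in> var then insert 0 ?A else ?A)"
  have A': "finite A'" "card A' \<le> n" using A by (auto simp: A'_def)
  have var: "var = cross A' ?B"
  proof
    show "var \<subseteq> cross A' ?B"
    proof
      fix z assume z: "z \<in> var"
      then show "z \<in> cross A' ?B"
      proof (cases rule: curveE[OF subsetD[OF var_curve z]])
        case (1 u)
        then show ?thesis using z A(4)[of u] by (cases "u = 0") (auto simp: cross_def A'_def)
      next
        case (2 v)
        then show ?thesis using z B(4)[of v] by (auto simp: cross_def)
      qed
    qed
    show "cross A' ?B \<subseteq> var"
      by (auto simp: cross_def A'_def var_axis_def sw.var_axis_def sw_pt split: if_splits)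
  qed
  have vanish: "r \<in> N" if "r \<in> bipolys n" "\<And>z. z \<in> var \<Longrightarrow> bieval r (fst z) (snd z) = 0" for r
  proof (rule null_if_vanishes[of var])
    show "finite var" "interpolable n var"
      unfolding var using A' B by (simp_all add: finite_cross interpolable_cross)
    show "bieval r (fst z) (snd z) = 0" if "r \<in> N" "z \<in> var" for r z
      using that by (auto simp: var_def)
  qed (use rank that in auto)
  obtain wA where wA: "\<And>f. Polynomial.degree f \<le> 2 * n \<Longrightarrow>
      axis n \<beta> U f = (\<Sum>a\<in>insert 0 ?A. wA a * poly f a)"
    by (rule axis_quadrature[OF A(1-4) B(1-4) A(5) vanish]) blast+
  obtain wB where wB: "\<And>f. Polynomial.degree f \<le> 2 * n \<Longrightarrow>
      axis n \<beta> V f = (\<Sum>a\<in>insert 0 ?B. wB a * poly f a)"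
    by (rule sw.axis_quadrature[of ?B ?A])
       (use A B vanish in \<open>auto simp: sw_pt\<close>)
  show ?thesis
  proof (rule solved_of_cross[of "insert 0 ?A" ?B "wA(0 := wA 0 + wB 0 - L 1)" wB])
    fix q f g assume q: "rep (2 * n) q f g"
    have "(\<Sum>a\<in>?A. (wA(0 := wA 0 + wB 0 - L 1)) a * poly f a) = (\<Sum>a\<in>?A. wA a * poly f a)"
      using A(2) by (intro sum.cong) auto
    moreover have "axis n \<beta> U f = wA 0 * poly f 0 + (\<Sum>a\<in>?A. wA a * poly f a)"
      using wA[of f] q A(1,2) by (simp add: rep_def)
    moreover have "axis n \<beta> V g = wB 0 * poly f 0 + (\<Sum>b\<in>?B. wB b * poly g b)"
      using wB[of g] q B(1,2) rep_origin[OF q] by (simp add: rep_def)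
    ultimately show "L q = (\<Sum>a\<in>insert 0 ?A. (wA(0 := wA 0 + wB 0 - L 1)) a * poly f a)
        + (\<Sum>b\<in>?B. wB b * poly g b)"
      unfolding L_rep[OF q] using A(1,2) by (simp add: algebra_simps)
  qed (use A B in auto)
qed

subsection \<open>One line in the variety\<close>

text \<open>
  The null polynomials vanish on the first line, so they are divisible by \<open>v\<close> on the second. The
  one with cofactor \<open>h\<close> of least degree plays the role of an orthogonal polynomial for the
  functional \<open>v\<^sup>2 L\<close> on the second line: a conjugate pair of roots or a double root would
  produce a null polynomial of smaller degree, and so would the root 0. Its roots and the origin
  carry an exact quadrature formula on the second line. The weight found at the origin is
  transferred to the first line, where the functional becomes positive definite: extending \<open>f\<close>
  by the multiple of \<open>h\<close> with the same value at the origin gives a polynomial at whose square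
  \<open>L\<close> takes the value of the new functional at \<open>f\<^sup>2\<close>.
\<close>

lemma line_in_variety_solved:
  assumes line: "\<And>p u. p \<in> N \<Longrightarrow> ev p u 0 = 0"
    and p0: "p0 \<in> N" "ev p0 0 v0 \<noteq> 0"
  shows solved
proof -
  let ?X = "[:0, 1:] :: real poly"
  note ax = ulinD[OF ulin_axis]
  define K where "K h \<longleftrightarrow> h \<noteq> 0 \<and> Polynomial.degree h \<le> n - 1 \<and> (\<exists>q\<in>N. rep n q 0 (?X * h))" for h
  have sq: "axis n \<beta> V ((?X * k) * (?X * k)) \<ge> 0"
       "axis n \<beta> V ((?X * k) * (?X * k)) = 0 \<Longrightarrow> k \<noteq> 0 \<Longrightarrow> K k"
    if k: "Polynomial.degree k \<le> n - 1" for k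
  proof -
    have "Polynomial.degree (?X * k) \<le> n" using degree_mult_X[OF k] n by simp
    then obtain q where q: "rep n q 0 (?X * k)"
      by (rule rep_surj[where f = 0, OF _ _ , rotated 1]) simp_all
    then have qn: "q \<in> bipolys n" by (simp add: rep_def)
    have e: "L (q * q) = axis n \<beta> V ((?X * k) * (?X * k))"
      unfolding L_rep_mult[OF q q] by (simp add: ax)
    show "axis n \<beta> V ((?X * k) * (?X * k)) \<ge> 0" using pos[OF qn] e by simp
    show "K k" if "axis n \<beta> V ((?X * k) * (?X * k)) = 0" "k \<noteq> 0"
      unfolding K_def using that k q e N_iff[OF qn] by auto
  qed
  have "\<exists>h. K h"
  proof -
    obtain f g where fg: "rep n p0 f g" using rep_ex[OF N_sub[OF p0(1)]] by blast
    have "poly f u = 0" for u using fg line[OF p0(1)] by (simp add: rep_def)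
    then have f: "f = 0" using poly_all_0_iff_0 by blast
    then have "poly g 0 = 0" using rep_origin[OF fg] by simp
    then obtain k where k: "g = ?X * k" "Polynomial.degree k \<le> Polynomial.degree g - 1" by (rule divide_X)
    have "g \<noteq> 0" using fg p0(2) by (auto simp: rep_def)
    then have "K k" using k fg p0(1) f unfolding K_def by (auto simp: rep_def)
    then show ?thesis by blast
  qed
  then obtain h where h: "K h" and min: "\<And>k. K k \<Longrightarrow> Polynomial.degree h \<le> Polynomial.degree k"
    by (metis ex_has_least_nat)
  obtain q where q: "q \<in> N" "rep n q 0 (?X * h)" using h by (auto simp: K_def)
  have h0: "h \<noteq> 0" and h_deg: "Polynomial.degree h \<le> n - 1" using h by (auto simp: K_def)
  have orth: "axis n \<beta> V (g * (?X * h)) = 0" if g: "Polynomial.degree g \<le> n" for g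
  proof -
    obtain r where r: "rep n r [:poly g 0:] g"
      by (rule rep_surj[of "[:poly g 0:]" n g]) (use g in simp_all)
    then have "L (r * q) = 0" using q by (intro N_orth) (auto simp: rep_def)
    then show ?thesis unfolding L_rep_mult[OF r q(2)] by (simp add: ax)
  qed
  have h_at_0: "poly h 0 \<noteq> 0"
  proof
    assume "poly h 0 = 0"
    then obtain k where k: "h = ?X * k" "Polynomial.degree k \<le> Polynomial.degree h - 1" by (rule divide_X)
    have k0: "k \<noteq> 0" using k h0 by auto
    then have "Polynomial.degree h = Suc (Polynomial.degree k)" unfolding k(1) by (subst degree_mult_eq) auto
    moreover have "axis n \<beta> V (k * (?X * h)) = 0" using k(2) h_deg n by (intro orth) simp
    then have "axis n \<beta> V ((?X * k) * (?X * k)) = 0" unfolding k(1) by (simp only: mult_ac)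
    then have "K k" using k(2) h_deg k0 by (intro sq) simp_all
    ultimately show False using min[of k] by simp
  qed
  have h_roots: "card {x. poly h x = 0} = Polynomial.degree h"
  proof (rule simple_real_roots[OF h0])
    fix a b :: real and k
    show "h \<noteq> [:a\<^sup>2 + b\<^sup>2, - 2 * a, 1:] * k"
    proof
      assume e: "h = [:a\<^sup>2 + b\<^sup>2, - 2 * a, 1:] * k"
      let ?l = "[:-a, 1:] * k"
      have k0: "k \<noteq> 0" using e h0 by auto
      then have l0: "?l \<noteq> 0" by (metis mult_eq_0_iff one_neq_zero pCons_eq_0_iff)
      have d: "Polynomial.degree h = 2 + Polynomial.degree k"
        unfolding e using k0 by (subst degree_mult_eq) auto
      have dl: "Polynomial.degree ?l = Suc (Polynomial.degree k)"
        using k0 by (subst degree_mult_eq) auto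
      have "(?X * k) * (?X * h) = (?X * ?X) * (h * k)" by (simp only: mult_ac)
      also have "\<dots> = (?X * ?X) * (?l * ?l + Polynomial.smult (b\<^sup>2) (k * k))"
        unfolding e by (simp only: quadratic_factor_form)
      also have "\<dots> = (?X * ?l) * (?X * ?l) + Polynomial.smult (b\<^sup>2) ((?X * k) * (?X * k))"
        by (simp only: distrib_left mult_smult_right mult_ac)
      finally have "axis n \<beta> V ((?X * ?l) * (?X * ?l)) + b\<^sup>2 * axis n \<beta> V ((?X * k) * (?X * k))
          = axis n \<beta> V ((?X * k) * (?X * h))" by (simp only: ax)
      also have "\<dots> = 0"
        using d h_deg by (intro orth order_trans[OF degree_mult_X[OF order_refl]]) simp
      finally have "axis n \<beta> V ((?X * ?l) * (?X * ?l)) + b\<^sup>2 * axis n \<beta> V ((?X * k) * (?X * k)) = 0" .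
      moreover have "axis n \<beta> V ((?X * ?l) * (?X * ?l)) \<ge> 0" using dl d h_deg by (intro sq) simp
      moreover have "b\<^sup>2 * axis n \<beta> V ((?X * k) * (?X * k)) \<ge> 0"
        using d h_deg by (intro mult_nonneg_nonneg sq) simp_all
      ultimately have "axis n \<beta> V ((?X * ?l) * (?X * ?l)) = 0" by linarith
      then have "K ?l" using dl d h_deg l0 by (intro sq) simp_all
      then show False using min[of ?l] dl d by simp
    qed
  qed
  define R where "R = {x. poly h x = 0}"
  have R: "finite R" "0 \<notin> R" "card R = Polynomial.degree h"
    using poly_roots_finite[OF h0] h_at_0 h_roots by (auto simp: R_def)
  define a where "a = lead_coeff h"
  have a0: "a \<noteq> 0" using h0 by (simp add: a_def)
  have h_eq: "h = Polynomial.smult a (root_poly R)"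
    unfolding R_def a_def by (rule root_poly_of_simple_roots[OF h0 h_roots])
  have rp: "root_poly (insert 0 R) = ?X * root_poly R"
    using R by (simp add: root_poly_def)
  have quad: "axis n \<beta> V (root_poly (insert 0 R) * s) = 0"
    if s: "Polynomial.degree s + card (insert 0 R) \<le> 2 * n" for s
  proof (rule degree_le_mult_split[OF ulin_mult[OF ulin_axis], of "n - Suc (card R)" n])
    fix s t :: "real poly"
    assume s: "Polynomial.degree s \<le> n - Suc (card R)" and t: "Polynomial.degree t \<le> n"
    obtain p where p: "rep (Suc (card R)) p 0 (?X * h)"
      by (rule rep_surj[of 0 "Suc (card R)" "?X * h"]) (use R degree_mult_X[of h] in simp_all)
    \<comment> \<open>recursive generation requires a representative of degree as small as the degree of \<open>v h\<close> permits,
        so that the product with \<open>s\<close> has degree at most \<open>n\<close>\<close>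
    have "rep n p 0 (?X * h)" using p R h_deg n by (intro rep_mono[OF p]) simp
    then have pN: "p \<in> N" using rep_null q by blast
    obtain r where r: "rep (n - Suc (card R)) r [:poly s 0:] s"
      by (rule rep_surj[of "[:poly s 0:]" "n - Suc (card R)" s]) (use s in simp_all)
    have pr: "rep n (p * r) (0 * [:poly s 0:]) ((?X * h) * s)"
      using rep_mult[OF p r] R h_deg n by (simp only: le_add_diff_inverse)
    have "r \<in> bipolys n" using r by (auto simp: rep_def intro: bipolys_mono)
    then have "p * r \<in> N" using pN pr by (intro rg) (auto simp: rep_def)
    moreover obtain w where w: "rep n w [:poly t 0:] t"
      by (rule rep_surj[of "[:poly t 0:]" n t]) (use t in simp_all)
    ultimately have "L (w * (p * r)) = 0" by (intro N_orth) (auto simp: rep_def)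
    then have "axis n \<beta> V (t * ((?X * h) * s)) = 0"
      unfolding L_rep_mult[OF w pr] by (simp add: ax)
    moreover have "t * ((?X * h) * s) = Polynomial.smult a (root_poly (insert 0 R) * (s * t))"
      unfolding h_eq rp by (simp only: mult_smult_right mult_smult_left mult_ac)
    ultimately show "axis n \<beta> V (root_poly (insert 0 R) * (s * t)) = 0"
      using a0 by (simp only: ax) simp
  qed (use s R h_deg n in simp)
  have "finite (insert 0 R)" using R by simp
  obtain w where w: "\<And>g. Polynomial.degree g \<le> 2 * n \<Longrightarrow> axis n \<beta> V g = (\<Sum>b\<in>insert 0 R. w b * poly g b)"
    by (rule interpolatory_quadrature[OF ulin_axis \<open>finite (insert 0 R)\<close> quad]) blast+
  then have w: "axis n \<beta> V g = w 0 * poly g 0 + (\<Sum>b\<in>R. w b * poly g b)" if "Polynomial.degree g \<le> 2 * n" for g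
    using that R by simp
  define \<Lambda> where "\<Lambda> f = axis n \<beta> U f + (w 0 - L 1) * poly f 0" for f
  have \<Lambda>: "ulin \<Lambda>" by (simp add: ulin_def \<Lambda>_def ax algebra_simps)
  have pd: "\<Lambda> (f * f) > 0" if f: "f \<noteq> 0" "Polynomial.degree f \<le> n" for f
  proof -
    define g where "g = Polynomial.smult (poly f 0 / poly h 0) h"
    have g_deg: "Polynomial.degree g \<le> n - 1"
      unfolding g_def using h_deg by (intro order_trans[OF degree_smult_le])
    obtain r where r: "rep n r f g"
      by (rule rep_surj[of f n g]) (use f g_deg h_at_0 in \<open>auto simp: g_def\<close>)
    have rn: "r \<in> bipolys n" using r by (simp add: rep_def)
    have "r \<notin> N"
    proof
      assume "r \<in> N"
      then have "poly f u = 0" for u using line r by (simp add: rep_def)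
      then show False using f(1) poly_all_0_iff_0 by blast
    qed
    then have "L (r * r) > 0" using pos[OF rn] N_iff[OF rn] by simp
    moreover have "L (r * r) = \<Lambda> (f * f)"
    proof -
      have "Polynomial.degree (g * g) \<le> 2 * n"
        using g_deg by (intro order_trans[OF degree_mult_le]) simp
      moreover have "(\<Sum>b\<in>R. w b * poly (g * g) b) = 0"
        by (intro sum.neutral) (simp add: R_def g_def)
      ultimately have "axis n \<beta> V (g * g) = w 0 * poly (g * g) 0" using w[of "g * g"] by simp
      then show ?thesis
        unfolding L_rep_mult[OF r r] \<Lambda>_def using rep_origin[OF r] by (simp add: algebra_simps)
    qed
    ultimately show ?thesis by simp
  qed
  obtain A wA where A: "finite A" "card A = Suc n"
    "\<And>f. Polynomial.degree f \<le> 2 * n \<Longrightarrow> \<Lambda> f = (\<Sum>z\<in>A. wA z * poly f z)"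
    by (rule positive_quadrature[OF \<Lambda> pd]) blast+
  show ?thesis
  proof (rule solved_of_cross[of A R wA w])
    fix r f g assume r: "rep (2 * n) r f g"
    then show "L r = (\<Sum>a\<in>A. wA a * poly f a) + (\<Sum>b\<in>R. w b * poly g b)"
      using A(3)[of f] w[of g] rep_origin[OF r] unfolding L_rep[OF r] \<Lambda>_def
      by (simp add: rep_def algebra_simps)
  qed (use A R h_deg n in auto)
qed

subsection \<open>Both lines in the variety\<close>

text \<open>
  No null polynomial survives on the curve, so the form is positive definite there. If \<open>e\<close> and
  \<open>e'\<close> are the minimisers on the two lines, \<open>(e, e')\<close> is a polynomial on the curve, and \<open>\<tau> > 0\<close>
  is the value of \<open>L\<close> at its square. This is exactly the room between \<open>L 1\<close> and the least masses
  at the origin which the two lines need; each line receives half of it.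
\<close>

lemma cross_in_variety_solved:
  assumes lines: "\<And>p t. p \<in> N \<Longrightarrow> ev p t 0 = 0" "\<And>p t. p \<in> N \<Longrightarrow> ev p 0 t = 0"
  shows solved
proof -
  let ?X = "[:0, 1:] :: real poly"
  note ax = ulinD[OF ulin_axis]
  have pos_L: "L (q * q) > 0" if q: "rep n q f g" and fg: "f \<noteq> 0 \<or> g \<noteq> 0" for q f g
  proof -
    have qn: "q \<in> bipolys n" using q by (simp add: rep_def)
    have "q \<notin> N"
    proof
      assume "q \<in> N"
      then have "poly f u = 0" "poly g u = 0" for u using lines q by (simp_all add: rep_def)
      then show False using fg poly_all_0_iff_0 by blast
    qed
    then show ?thesis using pos[OF qn] N_iff[OF qn] by simp
  qed
  have pos_U: "axis n \<beta> U ((?X * k) * (?X * k)) > 0" and pos_V: "axis n \<beta> V ((?X * k) * (?X * k)) > 0"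
    if k: "k \<noteq> 0" "Polynomial.degree k \<le> n - 1" for k
  proof -
    have d: "Polynomial.degree (?X * k) \<le> n" using degree_mult_X[OF k(2)] n by simp
    have nz: "?X * k \<noteq> 0" using k(1) by (metis mult_eq_0_iff one_neq_zero pCons_eq_0_iff)
    obtain q where q: "rep n q (?X * k) 0" by (rule rep_surj[of "?X * k" n 0]) (use d in simp_all)
    have "0 < L (q * q)" by (rule pos_L[OF q]) (use nz in blast)
    also have "L (q * q) = axis n \<beta> U ((?X * k) * (?X * k))"
      unfolding L_rep_mult[OF q q] by (simp add: ax)
    finally show "axis n \<beta> U ((?X * k) * (?X * k)) > 0" .
    obtain r where r: "rep n r 0 (?X * k)" by (rule rep_surj[of 0 n "?X * k"]) (use d in simp_all)
    have "0 < L (r * r)" by (rule pos_L[OF r]) (use nz in blast)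
    also have "L (r * r) = axis n \<beta> V ((?X * k) * (?X * k))"
      unfolding L_rep_mult[OF r r] by (simp add: ax)
    finally show "axis n \<beta> V ((?X * k) * (?X * k)) > 0" .
  qed
  have Sn: "Suc (n - 1) = n" using n by simp
  obtain e where e: "Polynomial.degree e \<le> n" "poly e 0 = 1"
    "\<And>\<tau> f. \<tau> > 0 \<Longrightarrow> f \<noteq> 0 \<Longrightarrow> Polynomial.degree f \<le> n \<Longrightarrow>
       axis n \<beta> U (f * f) + (\<tau> - axis n \<beta> U (e * e)) * poly (f * f) 0 > 0"
    by (rule removable_mass[where m = "n - 1", unfolded Sn, OF ulin_axis pos_U]) blast+
  obtain e' where e': "Polynomial.degree e' \<le> n" "poly e' 0 = 1"
    "\<And>\<tau> f. \<tau> > 0 \<Longrightarrow> f \<noteq> 0 \<Longrightarrow> Polynomial.degree f \<le> n \<Longrightarrow>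
       axis n \<beta> V (f * f) + (\<tau> - axis n \<beta> V (e' * e')) * poly (f * f) 0 > 0"
    by (rule removable_mass[where m = "n - 1", unfolded Sn, OF ulin_axis pos_V]) blast+
  obtain q where q: "rep n q e e'" by (rule rep_surj[OF e(1) e'(1)]) (use e e' in simp)
  define \<tau> where "\<tau> = L (q * q)"
  have \<tau>: "\<tau> > 0" unfolding \<tau>_def by (rule pos_L[OF q]) (use e(2) in auto)
  have \<tau>_eq: "\<tau> = axis n \<beta> U (e * e) + axis n \<beta> V (e' * e') - L 1"
    unfolding \<tau>_def L_rep_mult[OF q q] using e(2) by simp
  define \<Lambda>1 where "\<Lambda>1 f = axis n \<beta> U f + (\<tau> / 2 - axis n \<beta> U (e * e)) * poly f 0" for f
  define \<Lambda>2 where "\<Lambda>2 f = axis n \<beta> V f + (\<tau> / 2 - axis n \<beta> V (e' * e')) * poly f 0" for f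
  have \<Lambda>: "ulin \<Lambda>1" "ulin \<Lambda>2" by (simp_all add: ulin_def \<Lambda>1_def \<Lambda>2_def ax algebra_simps)
  have pd1: "\<Lambda>1 (f * f) > 0" and pd2: "\<Lambda>2 (f * f) > 0" if "f \<noteq> 0" "Polynomial.degree f \<le> n" for f
    unfolding \<Lambda>1_def \<Lambda>2_def using e(3)[of "\<tau> / 2" f] e'(3)[of "\<tau> / 2" f] \<tau> that by simp_all
  obtain A wA where A: "finite A" "card A = Suc n" "0 \<notin> A" "\<And>z. z \<in> A \<Longrightarrow> wA z > 0"
    "\<And>f. Polynomial.degree f \<le> 2 * n \<Longrightarrow> \<Lambda>1 f = (\<Sum>z\<in>A. wA z * poly f z)"
    by (rule positive_quadrature[OF \<Lambda>(1) pd1]) blast+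
  obtain B wB where B: "finite B" "card B = Suc n" "0 \<notin> B" "\<And>z. z \<in> B \<Longrightarrow> wB z > 0"
    "\<And>f. Polynomial.degree f \<le> 2 * n \<Longrightarrow> \<Lambda>2 f = (\<Sum>z\<in>B. wB z * poly f z)"
    by (rule positive_quadrature[OF \<Lambda>(2) pd2]) blast+
  \<comment> \<open>the rank is computed from \<open>2n + 1\<close> auxiliary points; the \<open>2n + 2\<close> Gauss nodes are too many for
      interpolation\<close>
  define C where "C = real ` {..n}"
  define D where "D = real ` {1..n}"
  have CD: "finite C" "finite D" "0 \<notin> D" "card C = Suc n" "card D = n"
    by (auto simp: C_def D_def card_image inj_on_def)
  have "rank_M n \<beta> = card (cross C D)"
  proof (rule rank_eq_card)
    show "finite (cross C D)" "interpolable n (cross C D)"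
      using CD by (simp_all add: finite_cross interpolable_cross)
    fix p assume p: "p \<in> bipolys n"
    obtain f g where fg: "rep n p f g" using rep_ex[OF p] by blast
    show "p \<in> N \<longleftrightarrow> (\<forall>z\<in>cross C D. bieval p (fst z) (snd z) = 0)"
    proof
      assume "p \<in> N"
      then show "\<forall>z\<in>cross C D. bieval p (fst z) (snd z) = 0"
        using lines by (auto simp: cross_def ev_def)
    next
      assume v: "\<forall>z\<in>cross C D. bieval p (fst z) (snd z) = 0"
      have fC: "poly f u = 0" if "u \<in> C" for u
        using v fg that by (auto simp: cross_def rep_def ev_def)
      have gD: "poly g u = 0" if "u \<in> D" for u
        using v fg that by (auto simp: cross_def rep_def ev_def)
      have "f = 0"
      proof (rule ccontr)
        assume "f \<noteq> 0"
        then have "card C \<le> Polynomial.degree f"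
          using fC by (intro order_trans[OF card_mono card_poly_roots_bound] poly_roots_finite) auto
        then show False using fg CD by (simp add: rep_def)
      qed
      moreover have "g = 0"
      proof (rule ccontr)
        assume "g \<noteq> 0"
        moreover have "poly g 0 = 0" using rep_origin[OF fg] \<open>f = 0\<close> by simp
        ultimately have "card (insert 0 D) \<le> Polynomial.degree g"
          using gD by (intro order_trans[OF card_mono card_poly_roots_bound] poly_roots_finite) auto
        then show False using fg CD by (simp add: rep_def)
      qed
      ultimately have "L (p * p) = 0" using L_rep_mult[OF fg fg] by (simp add: ax)
      then show "p \<in> N" using N_iff[OF p] by simp
    qed
  qed
  then have rank: "rank_M n \<beta> = 2 * n + 1" using CD by (simp add: card_cross)
  show ?thesis
    unfolding solved_def
  proof (intro exI conjI ballI)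
    show "finite (cross A B)" using A B by (simp add: finite_cross)
    show "cross A B \<subseteq> curve" by (rule cross_curve)
    show "cross_weight wA wB z > 0" if "z \<in> cross A B" for z
    proof -
      from that consider a where "a \<in> A" "z = pt a 0" | b where "b \<in> B" "z = pt 0 b"
        by (auto simp: cross_def)
      then show ?thesis
      proof cases
        case 1
        then show ?thesis using A(4) by (simp add: cross_weight_pt)
      next
        case 2
        then have "b \<noteq> 0" using B(3) by auto
        then show ?thesis using 2 B(4) by (simp add: cross_weight_pt)
      qed
    qed
    show "L r = (\<Sum>z\<in>cross A B. cross_weight wA wB z * bieval r (fst z) (snd z))"
      if r: "r \<in> bipolys (2 * n)" for r
    proof -
      obtain f g where fg: "rep (2 * n) r f g" using rep_ex[OF r] by blast
      have e'_eq: "axis n \<beta> V (e' * e') = \<tau> + L 1 - axis n \<beta> U (e * e)" using \<tau>_eq by simp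
      have "L r = \<Lambda>1 f + \<Lambda>2 g"
        unfolding L_rep[OF fg] \<Lambda>1_def \<Lambda>2_def e'_eq using rep_origin[OF fg] by (simp add: algebra_simps)
      also have "\<dots> = (\<Sum>z\<in>cross A B. cross_weight wA wB z * bieval r (fst z) (snd z))"
        using A(5)[of f] B(5)[of g] fg sum_cross[OF A(1) B(1,3) fg] by (simp add: rep_def)
      finally show ?thesis .
    qed
    show "rank_M n \<beta> = card (cross A B) \<and> card (cross A B) \<le> 2 * n + 1 \<or> rank_M n \<beta> = 2 * n + 1 \<and> card (cross A B) \<le> 2 * n + 2"
      using rank A B by (simp add: card_cross)
  qed
qed

lemma degenerate_solved:
  assumes rank: "infinite var \<or> rank_M n \<beta> \<le> card var"
  shows solved
proof -
  interpret sw: degenerate_moments V U a2 a1 a3 b2 b1 b3 c n \<beta> by (rule swap)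
  have sw_ev: "sw.ev p s t = ev p t s" for p s t
    by (simp add: sw.ev_def ev_def sw.pt_def pt_def add.commute)
  have sw_solved: "sw.solved \<longleftrightarrow> solved"
    by (simp add: sw.solved_def solved_def sw.curve_def curve_def mult.commute)
  consider "\<And>p t. p \<in> N \<Longrightarrow> ev p t 0 = 0" "\<And>p t. p \<in> N \<Longrightarrow> ev p 0 t = 0"
    | p v where "\<And>p t. p \<in> N \<Longrightarrow> ev p t 0 = 0" "p \<in> N" "ev p 0 v \<noteq> 0"
    | p u where "\<And>p t. p \<in> N \<Longrightarrow> ev p 0 t = 0" "p \<in> N" "ev p u 0 \<noteq> 0"
    | p u q v where "p \<in> N" "ev p u 0 \<noteq> 0" "q \<in> N" "ev q 0 v \<noteq> 0"
    by blast
  then show ?thesis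
  proof cases
    case 1
    then show ?thesis by (rule cross_in_variety_solved)
  next
    case 2
    then show ?thesis by (rule line_in_variety_solved)
  next
    case 3
    have "sw.solved" by (rule sw.line_in_variety_solved[of p u]) (use 3 in \<open>simp_all add: sw_ev\<close>)
    then show ?thesis by (simp add: sw_solved)
  next
    case 4
    have "sw.ev q v 0 \<noteq> 0" using 4 by (simp add: sw_ev)
    have "var \<subseteq> (\<lambda>u. pt u 0) ` (insert 0 var_axis) \<union> (\<lambda>v. pt 0 v) ` sw.var_axis"
    proof
      fix z assume z: "z \<in> var"
      then show "z \<in> (\<lambda>u. pt u 0) ` (insert 0 var_axis) \<union> (\<lambda>v. pt 0 v) ` sw.var_axis"
      proof (cases rule: curveE[OF subsetD[OF var_curve z]])
        case (1 u)
        then show ?thesis using z by (auto simp: var_axis_def)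
      next
        case (2 v)
        then have "v \<in> sw.var_axis"
          using z by (simp add: sw.var_axis_def sw.pt_def pt_def add.commute)
        then show ?thesis using 2 by auto
      qed
    qed
    then have "finite var"
      using var_axis_bound(1)[OF 4(1,2)] sw.var_axis_bound(1)[OF 4(3) \<open>sw.ev q v 0 \<noteq> 0\<close>]
      by (meson finite_Un finite_imageI finite_insert rev_finite_subset)
    then show ?thesis using rank finite_variety_solved[OF _ 4] by simp
  qed
qed

end



section \<open>Coordinates for a given hyperbola\<close>

text \<open>
  A binary quadratic form of positive discriminant is a product of two linear forms; the square
  of their determinant is the discriminant, so they are independent.
\<close>

lemma indefinite_form_factors:
  fixes A B C :: real
  assumes "B\<^sup>2 - 4 * A * C > 0"
  obtains p1 q1 p2 q2 where "p1 * p2 = A" "p1 * q2 + p2 * q1 = B" "q1 * q2 = C" "p1 * q2 - p2 * q1 \<noteq> 0"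
proof (cases "A = 0")
  case True
  then have "B \<noteq> 0" using assms by auto
  then show ?thesis using that[where ?p1.0 = 0 and ?q1.0 = 1 and ?p2.0 = B and ?q2.0 = C] True by simp
next
  case False
  define s where "s = sqrt (B\<^sup>2 - 4 * A * C)"
  have s: "s * s = B * B - 4 * A * C" "s > 0" using assms by (simp_all add: s_def power2_eq_square)
  show ?thesis
  proof (rule that[where ?p1.0 = A and ?q1.0 = "(B + s) / 2" and ?p2.0 = 1 and ?q2.0 = "(B - s) / (2 * A)"])
    show "(B + s) / 2 * ((B - s) / (2 * A)) = C"
      using False s by (simp add: field_simps)
  qed (use False s in \<open>simp_all add: field_simps\<close>)
qed

text \<open>
  The linear part of \<open>Q\<close> is absorbed by translating the two linear factors of the quadratic
  part; the shifts \<open>u\<close> and \<open>v\<close> solve a linear system whose determinant is that of the factors.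
\<close>

lemma hyperbola_coords:
  assumes "hyperbola Q"
  obtains U V a1 a2 a3 b1 b2 b3 c where "plane_coords U V a1 a2 a3 b1 b2 b3" "Q = U * V - scal c"
proof -
  let ?x = "mono2 0 1" and ?y = "mono2 1 0"
  have Q2: "Q \<in> bipolys 2" and disc: "(cf Q 1 1)\<^sup>2 - 4 * cf Q 0 2 * cf Q 2 0 > 0"
    using assms by (auto simp: hyperbola_def)
  obtain p1 q1 p2 q2 where pq: "p1 * p2 = cf Q 0 2" "p1 * q2 + p2 * q1 = cf Q 1 1" "q1 * q2 = cf Q 2 0"
    and d0: "p1 * q2 - p2 * q1 \<noteq> 0"
    by (rule indefinite_form_factors[OF disc])
  define d where "d = p1 * q2 - p2 * q1"
  define u where "u = (p1 * cf Q 1 0 - q1 * cf Q 0 1) / d"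
  define v where "v = (q2 * cf Q 0 1 - p2 * cf Q 1 0) / d"
  have uv: "v * p1 + u * p2 = cf Q 0 1" "v * q1 + u * q2 = cf Q 1 0"
    using d0 by (simp_all add: u_def v_def d_def divide_simps) (simp_all add: algebra_simps)
  define U where "U = scal p1 * ?x + scal q1 * ?y + scal u"
  define V where "V = scal p2 * ?x + scal q2 * ?y + scal v"
  define c where "c = u * v - cf Q 0 0"
  have idx: "{(i, j). i + j \<le> (2::nat)} = {(0,0), (0,1), (1,0), (0,2), (1,1), (2,0)}"
    using set_mono_idx[of 2] mono_idx_2 by simp
  have "Q = scal (cf Q 0 0) * mono2 0 0 + (scal (cf Q 0 1) * mono2 0 1 + (scal (cf Q 1 0) * mono2 1 0
    + (scal (cf Q 0 2) * mono2 0 2 + (scal (cf Q 1 1) * mono2 1 1 + scal (cf Q 2 0) * mono2 2 0))))"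
    by (subst bipolys_expand[OF Q2]) (simp add: idx)
  also have "\<dots> = U * V - scal c"
  proof -
    have m: "mono2 0 2 = ?x * ?x" "mono2 1 1 = ?x * ?y" "mono2 2 0 = ?y * ?y" "mono2 0 0 = 1"
      by (simp_all add: mono2_mult mono2_00 numeral_2_eq_2)
    show ?thesis
      unfolding U_def V_def c_def m pq[symmetric] uv[symmetric] scal_simps by (simp add: algebra_simps)
  qed
  finally have Q: "Q = U * V - scal c" .
  have deg1: "mono2 0 1 \<in> bipolys 1" "mono2 1 0 \<in> bipolys 1" by (simp_all add: mono2_bipolys)
  have inv: "(q2 * (p1 * x + q1 * y) - q1 * (p2 * x + q2 * y)) / d = x"
      "(p1 * (p2 * x + q2 * y) - p2 * (p1 * x + q1 * y)) / d = y" for x y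
    using d0 by (simp_all add: d_def field_simps)
  define a1 where "a1 = q2 / d"
  define a2 where "a2 = - q1 / d"
  define a3 where "a3 = (q1 * v - q2 * u) / d"
  define b1 where "b1 = - p2 / d"
  define b2 where "b2 = p1 / d"
  define b3 where "b3 = (p2 * u - p1 * v) / d"
  have id: "a1 * p1 + a2 * p2 = 1" "a1 * q1 + a2 * q2 = 0" "a1 * u + a2 * v + a3 = 0"
     "b1 * p1 + b2 * p2 = 0" "b1 * q1 + b2 * q2 = 1" "b1 * u + b2 * v + b3 = 0"
     "p1 * a1 + q1 * b1 = 1" "p1 * a2 + q1 * b2 = 0" "p1 * a3 + q1 * b3 + u = 0"
     "p2 * a1 + q2 * b1 = 0" "p2 * a2 + q2 * b2 = 1" "p2 * a3 + q2 * b3 + v = 0"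
    using d0 unfolding a1_def a2_def a3_def b1_def b2_def b3_def d_def
    by (simp_all add: divide_simps) (simp_all add: algebra_simps)
  have "plane_coords U V a1 a2 a3 b1 b2 b3"
  proof
    show "U \<in> bipolys 1" "V \<in> bipolys 1"
      unfolding U_def V_def by (intro bipolys_add bipolys_scal bipolys_scal0 deg1)+
    have comb: "scal a * U + scal b * V + scal e
        = scal (a * p1 + b * p2) * ?x + scal (a * q1 + b * q2) * ?y + scal (a * u + b * v + e)" for a b e
      unfolding U_def V_def scal_simps by (simp add: algebra_simps)
    show "mono2 0 1 = scal a1 * U + scal a2 * V + scal a3"
         "mono2 1 0 = scal b1 * U + scal b2 * V + scal b3"
      unfolding comb id by (simp_all add: scal_simps)
    fix s t
    have "bieval U (a1 * s + a2 * t + a3) (b1 * s + b2 * t + b3)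
        = (p1 * a1 + q1 * b1) * s + (p1 * a2 + q1 * b2) * t + (p1 * a3 + q1 * b3 + u)"
      by (simp add: U_def algebra_simps)
    then show "bieval U (a1 * s + a2 * t + a3) (b1 * s + b2 * t + b3) = s" unfolding id by simp
    have "bieval V (a1 * s + a2 * t + a3) (b1 * s + b2 * t + b3)
        = (p2 * a1 + q2 * b1) * s + (p2 * a2 + q2 * b2) * t + (p2 * a3 + q2 * b3 + v)"
      by (simp add: V_def algebra_simps)
    then show "bieval V (a1 * s + a2 * t + a3) (b1 * s + b2 * t + b3) = t" unfolding id by simp
  qed
  then show ?thesis using that Q by blast
qed

section \<open>Representing measures\<close>

definition discrete_measure :: "(real \<times> real) set \<Rightarrow> (real \<times> real \<Rightarrow> real) \<Rightarrow> (real \<times> real) measure" where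
  "discrete_measure S w = distr (point_measure S (\<lambda>z. ennreal (w z))) borel (\<lambda>z. z)"

lemma sets_discrete_measure [simp]: "sets (discrete_measure S w) = sets borel"
  by (simp add: discrete_measure_def)

lemma emeasure_discrete_measure:
  assumes "finite S" "A \<in> sets borel"
  shows "emeasure (discrete_measure S w) A = (\<Sum>z\<in>S. ennreal (w z) * indicator A z)"
proof -
  have "emeasure (discrete_measure S w) A = emeasure (point_measure S (\<lambda>z. ennreal (w z))) (A \<inter> S)"
    unfolding discrete_measure_def using assms(2)
    by (subst emeasure_distr) (auto simp: space_point_measure measurable_def sets_point_measure)
  also have "\<dots> = (\<Sum>z\<in>A \<inter> S. ennreal (w z))"
    using assms(1) by (subst emeasure_point_measure_finite) auto
  also have "\<dots> = (\<Sum>z\<in>S. ennreal (w z) * indicator A z)"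
    using assms(1) by (intro sum.mono_neutral_cong_left) (auto simp: indicator_def)
  finally show ?thesis .
qed

lemma integral_discrete_measure:
  fixes f :: "real \<times> real \<Rightarrow> real"
  assumes "finite S" "\<And>z. z \<in> S \<Longrightarrow> w z > 0" "f \<in> borel_measurable borel"
  shows "integrable (discrete_measure S w) f"
    and "integral\<^sup>L (discrete_measure S w) f = (\<Sum>z\<in>S. w z * f z)"
proof -
  have id: "(\<lambda>z. z) \<in> point_measure S (\<lambda>z. ennreal (w z)) \<rightarrow>\<^sub>M borel"
    by (auto simp: measurable_def space_point_measure sets_point_measure)
  show "integrable (discrete_measure S w) f"
    unfolding discrete_measure_def using assms
    by (subst integrable_distr_eq[OF id]) (auto intro!: integrable_point_measure_finite)
  show "integral\<^sup>L (discrete_measure S w) f = (\<Sum>z\<in>S. w z * f z)"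
    unfolding discrete_measure_def using assms
    by (subst integral_distr[OF id]) (auto simp: lebesgue_integral_point_measure_finite less_imp_le)
qed

lemma measure_supp_discrete_measure:
  assumes S: "finite S" "\<And>z. z \<in> S \<Longrightarrow> w z > 0"
  shows "measure_supp (discrete_measure S w) = S"
proof -
  have null: "emeasure (discrete_measure S w) W = 0 \<longleftrightarrow> W \<inter> S = {}" if "open W" for W
  proof -
    have "emeasure (discrete_measure S w) W = (\<Sum>z\<in>S. ennreal (w z) * indicator W z)"
      using S that by (intro emeasure_discrete_measure) auto
    also have "\<dots> = 0 \<longleftrightarrow> (\<forall>z\<in>S. ennreal (w z) * indicator W z = 0)"
      using S by (intro sum_nonneg_eq_0_iff) auto
    also have "\<dots> \<longleftrightarrow> W \<inter> S = {}"
      using S(2) by (force simp: indicator_def)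
    finally show ?thesis .
  qed
  have "closed S" using S by (simp add: finite_imp_closed)
  then show ?thesis
    unfolding measure_supp_def using null[of "- S"] null by (auto simp: open_Compl)
qed

lemma discrete_measure_represents:
  assumes S: "finite S" "\<And>z. z \<in> S \<Longrightarrow> w z > 0" "S \<subseteq> zero_set Q"
    and rep: "\<And>q. q \<in> bipolys (2 * n) \<Longrightarrow> riesz n \<beta> q = (\<Sum>z\<in>S. w z * bieval q (fst z) (snd z))"
  shows "Q_representing_measure n \<beta> Q (discrete_measure S w)" "atomic (card S) (discrete_measure S w)"
proof -
  have "integrable (discrete_measure S w) (\<lambda>(x, y). y ^ i * x ^ j) \<and>
      \<beta> i j = (\<integral>(x, y). y ^ i * x ^ j \<partial>discrete_measure S w)" if ij: "i + j \<le> 2 * n" for i j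
  proof -
    have m: "(\<lambda>(x, y). y ^ i * x ^ j) \<in> borel_measurable (borel :: (real \<times> real) measure)"
      unfolding case_prod_unfold by (intro borel_measurable_continuous_onI continuous_intros)
    have "\<beta> i j = (\<Sum>z\<in>S. w z * (case z of (x, y) \<Rightarrow> y ^ i * x ^ j))"
      using rep[OF mono2_bipolys[OF ij]] riesz_mono2[OF ij] by (simp add: case_prod_unfold)
    then show ?thesis using integral_discrete_measure[OF S(1,2) m] by simp
  qed
  then show "Q_representing_measure n \<beta> Q (discrete_measure S w)"
    unfolding Q_representing_measure_def representing_measure_def
    using measure_supp_discrete_measure[of S w] S by simp
  show "atomic (card S) (discrete_measure S w)"
    unfolding atomic_def using S emeasure_discrete_measure[OF S(1)]
    by (intro conjI exI[of _ S] exI[of _ w]) auto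
qed

text \<open>
  The complement of the support is a union of possibly uncountably many open null sets; by the
  Lindeloef property countably many suffice.
\<close>

lemma emeasure_outside_supp:
  fixes \<mu> :: "'a::second_countable_topology measure"
  assumes "sets \<mu> = sets borel"
  shows "emeasure \<mu> (- measure_supp \<mu>) = 0" and "closed (measure_supp \<mu>)"
proof -
  let ?F = "{U. open U \<and> emeasure \<mu> U = 0}"
  have e: "- measure_supp \<mu> = \<Union> ?F" by (simp add: measure_supp_def)
  have "open (\<Union> ?F)" by (rule open_Union) auto
  then show "closed (measure_supp \<mu>)" by (simp add: measure_supp_def closed_def)
  obtain F' where F': "F' \<subseteq> ?F" "countable F'" "\<Union> F' = \<Union> ?F"
    using Lindelof[of ?F] by auto
  have "(\<Union>W\<in>F'. W) \<in> null_sets \<mu>"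
  proof (rule null_sets_UN'[OF F'(2)])
    fix W assume "W \<in> F'"
    then have "open W" "emeasure \<mu> W = 0" using F'(1) by auto
    then show "W \<in> null_sets \<mu>" using assms by (intro null_setsI) simp_all
  qed
  then have "emeasure \<mu> (\<Union> F') = 0" by auto
  then show "emeasure \<mu> (- measure_supp \<mu>) = 0" using F' e by simp
qed

lemma representing_measure_integral:
  assumes "representing_measure n \<beta> \<mu>" "q \<in> bipolys (2 * n)"
  shows "integrable \<mu> (\<lambda>z. bieval q (fst z) (snd z))"
    and "riesz n \<beta> q = (\<integral>z. bieval q (fst z) (snd z) \<partial>\<mu>)"
proof -
  have m: "integrable \<mu> (\<lambda>z. snd z ^ i * fst z ^ j)" "\<beta> i j = (\<integral>z. snd z ^ i * fst z ^ j \<partial>\<mu>)"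
    if "i + j \<le> 2 * n" for i j
    using assms(1) that by (auto simp: representing_measure_def case_prod_unfold)
  have e: "(\<lambda>z. bieval q (fst z) (snd z))
      = (\<lambda>z. \<Sum>k\<in>{(i, j). i + j \<le> 2 * n}. case_prod (cf q) k * (snd z ^ fst k * fst z ^ snd k))"
    by (subst bipolys_expand[OF assms(2)]) (simp add: bieval_sum case_prod_unfold)
  show "integrable \<mu> (\<lambda>z. bieval q (fst z) (snd z))"
    unfolding e using m by (intro Bochner_Integration.integrable_sum integrable_mult_right) auto
  have "(\<integral>z. bieval q (fst z) (snd z) \<partial>\<mu>)
      = (\<Sum>k\<in>{(i, j). i + j \<le> 2 * n}. case_prod (cf q) k * (\<integral>z. snd z ^ fst k * fst z ^ snd k \<partial>\<mu>))"
    unfolding e using m by (subst Bochner_Integration.integral_sum) auto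
  also have "\<dots> = riesz n \<beta> q"
    unfolding riesz_def using m by (intro sum.cong) auto
  finally show "riesz n \<beta> q = (\<integral>z. bieval q (fst z) (snd z) \<partial>\<mu>)" by simp
qed

lemma bieval_continuous: "continuous_on UNIV (\<lambda>z. bieval q (fst z) (snd z))"
proof -
  have "\<exists>m. q \<in> bipolys m"
  proof -
    define m where "m = Polynomial.degree q + (\<Sum>i\<le>Polynomial.degree q. Polynomial.degree (Polynomial.coeff q i))"
    have "i + j \<le> m" if "cf q i j \<noteq> 0" for i j
    proof -
      have i: "i \<le> Polynomial.degree q" using that by (intro le_degree) (auto simp: cf_def)
      have "j \<le> Polynomial.degree (Polynomial.coeff q i)" using that by (intro le_degree) (simp add: cf_def)
      also have "\<dots> \<le> (\<Sum>i\<le>Polynomial.degree q. Polynomial.degree (Polynomial.coeff q i))"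
        using i by (intro member_le_sum) auto
      finally show ?thesis using i by (simp add: m_def)
    qed
    then have "q \<in> bipolys m" by (rule bipolysI)
    then show ?thesis by blast
  qed
  then obtain m where "q \<in> bipolys m" by blast
  then have e: "(\<lambda>z. bieval q (fst z) (snd z))
      = (\<lambda>z. \<Sum>k\<in>{(i, j). i + j \<le> m}. case_prod (cf q) k * (snd z ^ fst k * fst z ^ snd k))"
    by (subst bipolys_expand[of q m]) (simp_all add: bieval_sum case_prod_unfold)
  show ?thesis unfolding e by (intro continuous_intros)
qed

text \<open>
  If \<open>p\<^sup>2\<close> has integral zero, then \<open>p\<close> vanishes almost everywhere, and by continuity on the
  support.
\<close>

lemma null_iff_vanishes_on_supp:
  assumes \<mu>: "representing_measure n \<beta> \<mu>" and p: "p \<in> bipolys n"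
  shows "p \<in> null n (riesz n \<beta>) \<longleftrightarrow> (\<forall>z\<in>measure_supp \<mu>. bieval p (fst z) (snd z) = 0)"
proof -
  let ?f = "\<lambda>z. bieval p (fst z) (snd z)"
  have sets: "sets \<mu> = sets borel" using \<mu> by (simp add: representing_measure_def)
  have sq: "q * q' \<in> bipolys (2 * n)" if "q \<in> bipolys n" "q' \<in> bipolys n" for q q'
    using bipolys_mult[OF that] by (simp add: mult_2)
  show ?thesis
  proof
    assume "p \<in> null n (riesz n \<beta>)"
    then have "riesz n \<beta> (p * p) = 0" using p by (simp add: null_def)
    then have "(\<integral>z. ?f z * ?f z \<partial>\<mu>) = 0"
      using representing_measure_integral(2)[OF \<mu> sq[OF p p]] by simp
    moreover have "integrable \<mu> (\<lambda>z. ?f z * ?f z)"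
      using representing_measure_integral(1)[OF \<mu> sq[OF p p]] by simp
    ultimately have "AE z in \<mu>. ?f z * ?f z = 0"
      by (subst (asm) integral_nonneg_eq_0_iff_AE) auto
    then have ae: "AE z in \<mu>. ?f z = 0" by simp
    have op: "open {z. ?f z \<noteq> 0}"
      using open_Collect_neq[OF bieval_continuous continuous_on_const, of p 0] by simp
    have "emeasure \<mu> {z. ?f z \<noteq> 0} = 0"
    proof -
      have "{z. ?f z \<noteq> 0} \<in> sets \<mu>" using op sets by simp
      moreover have "space \<mu> = UNIV" using sets_eq_imp_space_eq[OF sets] by simp
      ultimately show ?thesis using ae by (subst (asm) AE_iff_measurable) auto
    qed
    then show "\<forall>z\<in>measure_supp \<mu>. ?f z = 0"
      using op by (auto simp: measure_supp_def)
  next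
    assume v: "\<forall>z\<in>measure_supp \<mu>. ?f z = 0"
    have ae: "AE z in \<mu>. ?f z = 0"
    proof (rule AE_I[of _ _ "- measure_supp \<mu>"])
      show "{z \<in> space \<mu>. ?f z \<noteq> 0} \<subseteq> - measure_supp \<mu>" using v by auto
      show "emeasure \<mu> (- measure_supp \<mu>) = 0" by (rule emeasure_outside_supp[OF sets])
      show "- measure_supp \<mu> \<in> sets \<mu>"
        using emeasure_outside_supp(2)[OF sets] sets by (simp add: open_Compl)
    qed
    have "riesz n \<beta> (q * p) = 0" if q: "q \<in> bipolys n" for q
    proof -
      have "riesz n \<beta> (q * p) = (\<integral>z. bieval (q * p) (fst z) (snd z) \<partial>\<mu>)"
        by (rule representing_measure_integral(2)[OF \<mu> sq[OF q p]])
      also have "\<dots> = 0" using ae by (intro integral_eq_zero_AE) auto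
      finally show ?thesis .
    qed
    then show "p \<in> null n (riesz n \<beta>)" using p by (simp add: null_def)
  qed
qed

lemma variety_eq: "variety n \<beta> = {z. \<forall>p\<in>null n (riesz n \<beta>). bieval p (fst z) (snd z) = 0}"
proof -
  have "p \<in> bipolys n \<and> col_poly n \<beta> p = 0\<^sub>v (mdim n) \<longleftrightarrow> p \<in> null n (riesz n \<beta>)" for p
    using col_poly_null[of p n \<beta>] by (auto simp: null_def)
  then have "variety n \<beta> = \<Inter>{zero_set p |p. p \<in> null n (riesz n \<beta>)}" by (simp add: variety_def)
  also have "\<dots> = {z. \<forall>p\<in>null n (riesz n \<beta>). z \<in> zero_set p}" by blast
  finally show ?thesis by (simp add: zero_set_def case_prod_unfold)
qed

lemma rank_le_card_supp:
  assumes "representing_measure n \<beta> \<mu>" "finite (measure_supp \<mu>)"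
  shows "rank_M n \<beta> \<le> card (measure_supp \<mu>)"
  by (rule rank_le[where \<phi> = "\<lambda>z p. bieval p (fst z) (snd z)"])
     (use assms in \<open>auto simp: lin_bieval null_iff_vanishes_on_supp\<close>)

lemma necessary_conditions:
  assumes \<mu>: "Q_representing_measure n \<beta> Q \<mu>" and Q: "Q \<in> bipolys n"
  shows "psd (moment_matrix n \<beta>)" "recursively_generated n \<beta>" "col_poly n \<beta> Q = 0\<^sub>v (mdim n)"
    "infinite (variety n \<beta>) \<or> rank_M n \<beta> \<le> card (variety n \<beta>)"
proof -
  have r: "representing_measure n \<beta> \<mu>" and supp: "measure_supp \<mu> \<subseteq> zero_set Q"
    using \<mu> by (auto simp: Q_representing_measure_def)
  note null = null_iff_vanishes_on_supp[OF r]
  show "psd (moment_matrix n \<beta>)"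
    unfolding psd_iff
  proof
    fix p assume p: "p \<in> bipolys n"
    then have "p * p \<in> bipolys (2 * n)" using bipolys_mult[OF p p] by (simp add: mult_2)
    then show "riesz n \<beta> (p * p) \<ge> 0"
      using representing_measure_integral(2)[OF r] by simp
  qed
  show "recursively_generated n \<beta>"
    unfolding recursively_generated_def by (auto simp: col_poly_null null)
  show "col_poly n \<beta> Q = 0\<^sub>v (mdim n)"
    using supp Q by (auto simp: col_poly_null null zero_set_def)
  have "measure_supp \<mu> \<subseteq> variety n \<beta>"
    using null by (auto simp: variety_eq null_def)
  then show "infinite (variety n \<beta>) \<or> rank_M n \<beta> \<le> card (variety n \<beta>)"
    using rank_le_card_supp[OF r] by (meson card_mono finite_subset order_trans)
qed

lemma quadrature_exists:
  assumes n: "n \<ge> 2" and hyp: "hyperbola Q"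
    and psd: "psd (moment_matrix n \<beta>)" and rg: "recursively_generated n \<beta>"
    and Q: "col_poly n \<beta> Q = 0\<^sub>v (mdim n)"
    and rank: "infinite (variety n \<beta>) \<or> rank_M n \<beta> \<le> card (variety n \<beta>)"
  obtains S w where "finite S" "S \<subseteq> zero_set Q" "\<And>z. z \<in> S \<Longrightarrow> w z > (0::real)"
    "\<And>q. q \<in> bipolys (2 * n) \<Longrightarrow> riesz n \<beta> q = (\<Sum>z\<in>S. w z * bieval q (fst z) (snd z))"
    "rank_M n \<beta> = card S \<and> card S \<le> 2 * n + 1 \<or> rank_M n \<beta> = 2 * n + 1 \<and> card S \<le> 2 * n + 2"
proof -
  obtain U V a1 a2 a3 b1 b2 b3 c where co: "plane_coords U V a1 a2 a3 b1 b2 b3" and Qc: "Q = U * V - scal c"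
    by (rule hyperbola_coords[OF hyp])
  have Q2: "Q \<in> bipolys n" using hyp n by (auto simp: hyperbola_def intro: bipolys_mono)
  interpret plane_coords U V a1 a2 a3 b1 b2 b3 by (rule co)
  interpret hyperbolic_moments U V a1 a2 a3 b1 b2 b3 c n \<beta>
  proof
    show "riesz n \<beta> (p * p) \<ge> 0" if "p \<in> bipolys n" for p
      using psd that by (simp add: psd_iff)
    show "p * q \<in> null n (riesz n \<beta>)"
      if "p \<in> null n (riesz n \<beta>)" "q \<in> bipolys n" "p * q \<in> bipolys n" for p q
      using rg that col_poly_null[of p n \<beta>] col_poly_null[of "p * q" n \<beta>]
      by (auto simp: recursively_generated_def null_def)
    show "U * V - scal c \<in> null n (riesz n \<beta>)"
      using Q col_poly_null[OF Q2] Qc by simp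
  qed (rule n)
  have rank': "infinite var \<or> rank_M n \<beta> \<le> card var"
    using rank by (simp add: variety_eq var_def)
  have solved
  proof (cases "c = 0")
    case True
    then interpret degenerate_moments U V a1 a2 a3 b1 b2 b3 c n \<beta> by unfold_locales
    show ?thesis by (rule degenerate_solved[OF rank'])
  next
    case False
    then interpret nondegenerate_moments U V a1 a2 a3 b1 b2 b3 c n \<beta> by unfold_locales
    show ?thesis by (rule nondegenerate_solved[OF rank'])
  qed
  then obtain S w where S: "finite S" "S \<subseteq> curve" "\<forall>z\<in>S. w z > (0::real)"
     "\<forall>q\<in>bipolys (2 * n). L q = (\<Sum>z\<in>S. w z * bieval q (fst z) (snd z))"
     "rank_M n \<beta> = card S \<and> card S \<le> 2 * n + 1 \<or> rank_M n \<beta> = 2 * n + 1 \<and> card S \<le> 2 * n + 2"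
    unfolding solved_def by (elim exE conjE) (rule that)
  moreover have "curve = zero_set Q"
    by (auto simp: curve_def zero_set_def Qc)
  ultimately show ?thesis by (intro that[of S w]) simp_all
qed

theorem theorem1p1:
  fixes n :: nat and Q :: bipoly and \<beta> :: "nat \<Rightarrow> nat \<Rightarrow> real"
  assumes "n \<ge> 2" and "hyperbola Q" and "\<beta> 0 0 > 0"
  shows "((\<exists>\<mu>. Q_representing_measure n \<beta> Q \<mu>) \<longleftrightarrow>
            psd (moment_matrix n \<beta>) \<and>
            recursively_generated n \<beta> \<and>
            col_poly n \<beta> Q = 0\<^sub>v (mdim n) \<and>
            (infinite (variety n \<beta>) \<or> rank_M n \<beta> \<le> card (variety n \<beta>))) \<and>
         ((\<exists>\<mu>. Q_representing_measure n \<beta> Q \<mu>) \<longrightarrow>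
            rank_M n \<beta> \<le> 2 * n + 1 \<and>
            (rank_M n \<beta> \<le> 2 * n \<longrightarrow>
               (\<exists>\<mu>. Q_representing_measure n \<beta> Q \<mu> \<and> atomic (rank_M n \<beta>) \<mu>)) \<and>
            (rank_M n \<beta> = 2 * n + 1 \<longrightarrow>
               (\<exists>\<mu>. Q_representing_measure n \<beta> Q \<mu> \<and> finite (measure_supp \<mu>) \<and>
                    2 * n + 1 \<le> card (measure_supp \<mu>) \<and>
                    card (measure_supp \<mu>) \<le> 2 * n + 2)))"
proof -
  have Q2: "Q \<in> bipolys n" using assms by (auto simp: hyperbola_def intro: bipolys_mono)
  let ?G = "\<lambda>\<mu>. Q_representing_measure n \<beta> Q \<mu> \<and> finite (measure_supp \<mu>) \<and>
      atomic (card (measure_supp \<mu>)) \<mu> \<and>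
      (rank_M n \<beta> = card (measure_supp \<mu>) \<and> card (measure_supp \<mu>) \<le> 2 * n + 1 \<or>
        rank_M n \<beta> = 2 * n + 1 \<and> card (measure_supp \<mu>) \<le> 2 * n + 2)"
  have suff: "\<exists>\<mu>. ?G \<mu>"
    if cond: "psd (moment_matrix n \<beta>)" "recursively_generated n \<beta>" "col_poly n \<beta> Q = 0\<^sub>v (mdim n)"
      "infinite (variety n \<beta>) \<or> rank_M n \<beta> \<le> card (variety n \<beta>)"
  proof -
    obtain S w where S: "finite S" "S \<subseteq> zero_set Q" "\<And>z. z \<in> S \<Longrightarrow> w z > (0::real)"
      "\<And>q. q \<in> bipolys (2 * n) \<Longrightarrow> riesz n \<beta> q = (\<Sum>z\<in>S. w z * bieval q (fst z) (snd z))"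
      "rank_M n \<beta> = card S \<and> card S \<le> 2 * n + 1 \<or> rank_M n \<beta> = 2 * n + 1 \<and> card S \<le> 2 * n + 2"
      by (rule quadrature_exists[OF assms(1,2) cond]) blast
    then show ?thesis
      using discrete_measure_represents[of S w Q n \<beta>] measure_supp_discrete_measure[of S w]
      by (intro exI[of _ "discrete_measure S w"]) simp
  qed
  have nec: "\<exists>\<mu>. ?G \<mu>"
    if "\<exists>\<mu>. Q_representing_measure n \<beta> Q \<mu>"
  proof -
    from that obtain \<mu> where "Q_representing_measure n \<beta> Q \<mu>" by blast
    from suff[OF necessary_conditions[OF this Q2]] show ?thesis .
  qed
  have low: "rank_M n \<beta> \<le> card (measure_supp \<mu>)"
    if "Q_representing_measure n \<beta> Q \<mu>" "finite (measure_supp \<mu>)" for \<mu>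
    using that by (auto simp: Q_representing_measure_def intro: rank_le_card_supp)
  show ?thesis
  proof (intro conjI iffI impI)
    assume ex: "\<exists>\<mu>. Q_representing_measure n \<beta> Q \<mu>"
    then obtain \<mu>0 where "Q_representing_measure n \<beta> Q \<mu>0" by blast
    from necessary_conditions[OF this Q2] show "psd (moment_matrix n \<beta>)" "recursively_generated n \<beta>" "col_poly n \<beta> Q = 0\<^sub>v (mdim n)"
        "infinite (variety n \<beta>) \<or> rank_M n \<beta> \<le> card (variety n \<beta>)"
      by this
    obtain \<mu> where \<mu>: "Q_representing_measure n \<beta> Q \<mu>" "finite (measure_supp \<mu>)"
      "atomic (card (measure_supp \<mu>)) \<mu>"
      and r: "rank_M n \<beta> = card (measure_supp \<mu>) \<and> card (measure_supp \<mu>) \<le> 2 * n + 1 \<or>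
        rank_M n \<beta> = 2 * n + 1 \<and> card (measure_supp \<mu>) \<le> 2 * n + 2"
      using nec[OF ex] by blast
    show "rank_M n \<beta> \<le> 2 * n + 1" using r by linarith
    show "\<exists>\<mu>. Q_representing_measure n \<beta> Q \<mu> \<and> atomic (rank_M n \<beta>) \<mu>" if "rank_M n \<beta> \<le> 2 * n"
    proof -
      have "rank_M n \<beta> = card (measure_supp \<mu>)" using r that by linarith
      then show ?thesis using \<mu>(1,3) by (intro exI[of _ \<mu>]) simp
    qed
    show "\<exists>\<mu>. Q_representing_measure n \<beta> Q \<mu> \<and> finite (measure_supp \<mu>) \<and>
        2 * n + 1 \<le> card (measure_supp \<mu>) \<and> card (measure_supp \<mu>) \<le> 2 * n + 2"
      if "rank_M n \<beta> = 2 * n + 1"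
    proof -
      have "2 * n + 1 \<le> card (measure_supp \<mu>)" using low[OF \<mu>(1,2)] that by linarith
      moreover have "card (measure_supp \<mu>) \<le> 2 * n + 2" using r by linarith
      ultimately show ?thesis using \<mu>(1,2) by (intro exI[of _ \<mu>] conjI)
    qed
  next
    assume "psd (moment_matrix n \<beta>) \<and> recursively_generated n \<beta> \<and> col_poly n \<beta> Q = 0\<^sub>v (mdim n) \<and>
      (infinite (variety n \<beta>) \<or> rank_M n \<beta> \<le> card (variety n \<beta>))"
    then have "\<exists>\<mu>. ?G \<mu>"
      by (elim conjE) (rule suff)
    then show "\<exists>\<mu>. Q_representing_measure n \<beta> Q \<mu>" by (elim exE conjE) (rule exI)
  qed
qed

end
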